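(* Let $\mathcal{K}=\Sigma_{n,2d}^*\subset\mathbb{R}^U$ be the dual sum-of-squares cone, let $\Lambda$ be the linear operator associated with an arbitrary pair of ordered bases $\mathbf{p}$ of $\mathcal{V}_{n,d}$ and $\mathbf{q}$ of $\mathcal{V}_{n,2d}$, and let $L=\binom{n+d}{n}$. For every $\varepsilon>0$, the parameters $\eta,\alpha_p,\alpha_c,r_c$ of the predictor-corrector algorithm described in the context can be chosen such that, given any initial solution $\mathbf{z}^0=(\bar{\mathbf{x}}^0,\mathbf{y}^0,\bar{\mathbf{s}}^0)\in\mathcal{N}(\eta)$, the algorithm using the barrier function $F(\mathbf{x})=-\ln(\det(\Lambda(\mathbf{x})))$ for $\mathcal{K}$ terminates with a solution $\mathbf{z}^*=(\bar{\mathbf{x}}^*,\mathbf{y}^*,\bar{\mathbf{s}}^* )$ satisfying $$\mu(\mathbf{z}^* )\leq\varepsilon\,\mu(\mathbf{z}^0)\quad\text{and}\quad\|\mathbf{G}(\mathbf{y}^*,\bar{\mathbf{x}}^* )-(\mathbf{0},\bar{\mathbf{s}}^* )\|\leq\varepsilon\,\|\mathbf{G}(\mathbf{y}^0,\bar{\mathbf{x}}^0)-(\mathbf{0},\bar{\mathbf{s}}^0)\|$$ in $O(L^{0.5}\log\varepsilon^{-1})$ iterations.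
   Context: Sum-of-squares cone. $\mathcal{V}_{n,r}$ is the space of real $n$-variate polynomials of total degree at most $r$; $L=\dim\mathcal{V}_{n,d}=\binom{n+d}{n}$, $U=\dim\mathcal{V}_{n,2d}=\binom{n+2d}{n}$. $\mathbb{S}^L$ is the space of real symmetric $L\times L$ matrices. Fix ordered bases $\mathbf{p}=(p_1,\ldots,p_L)$ of $\mathcal{V}_{n,d}$ and $\mathbf{q}=(q_1,\ldots,q_U)$ of $\mathcal{V}_{n,2d}$. A vector $\mathbf{s}\in\mathbb{R}^U$ is identified with the polynomial $\sum_u s_uq_u$, and $\Sigma_{n,2d}\subset\mathbb{R}^U$ is the cone of those $\mathbf{s}$ for which this polynomial is a finite sum of squares of polynomials in $\mathcal{V}_{n,d}$. $\Sigma_{n,2d}^*=\{\mathbf{x}\in\mathbb{R}^U : \mathbf{s}^{\mathrm T}\mathbf{x}\ge 0\ \forall\,\mathbf{s}\in\Sigma_{n,2d}\}$. $\Lambda:\mathbb{R}^U\to\mathbb{S}^L$ is the unique linear map with $\Lambda(\mathbf{q})=\mathbf{p}\mathbf{p}^{\mathrm T}$, i.e. $\Lambda(\mathbf{x})=\sum_u x_u\mathbf{E}_u$ where $p_ip_j=\sum_u(\mathbf{E}_u)_{ij}q_u$ as polynomials for all $i,j$. It is known that $\Sigma_{n,2d}^*=\{\mathbf{x}:\Lambda(\mathbf{x})\succeq 0\}$ and that $F(\mathbf{x})=-\ln\det\Lambda(\mathbf{x})$, defined on the interior $\mathcal{K}^\circ$ of $\mathcal{K}=\Sigma_{n,2d}^*$,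 is a logarithmically homogeneous self-concordant barrier for $\mathcal{K}$ with barrier parameter $\nu=L$. Problem. Given $\mathbf{A}\in\mathbb{R}^{k\times N}$, $\mathbf{b}\in\mathbb{R}^k$, $\mathbf{c}\in\mathbb{R}^N$ (here $N=U$), consider the conic problem $\min\{\mathbf{c}^{\mathrm T}\mathbf{x}:\mathbf{A}\mathbf{x}=\mathbf{b},\ \mathbf{x}\in\mathcal{K}\}$ and its dual $\max\{\mathbf{b}^{\mathrm T}\mathbf{y}:\mathbf{A}^{\mathrm T}\mathbf{y}+\mathbf{s}=\mathbf{c},\ \mathbf{s}\in\mathcal{K}^*\}$. Put $\bar{\mathbf{x}}=(\mathbf{x},\tau)$, $\bar{\mathbf{s}}=(\mathbf{s},\kappa)$, $\bar{\mathcal{K}}=\mathcal{K}\times\mathbb{R}_+$, $\bar{\mathcal{K}}^*=\mathcal{K}^*\times\mathbb{R}_+$, $\mathbf{z}=(\bar{\mathbf{x}},\mathbf{y},\bar{\mathbf{s}})$, $\mathcal{F}=\bar{\mathcal{K}}\times\mathbb{R}^k\times\bar{\mathcal{K}}^*$, and $$\mathbf{G}=\begin{pmatrix}\mathbf{0}&\mathbf{A}&-\mathbf{b}\\-\mathbf{A}^{\mathrm T}&\mathbf{0}&\mathbf{c}\\ \mathbf{b}^{\mathrm T}&-\mathbf{c}^{\mathrm T}&0\end{pmatrix}.$$ The homogeneous self-dual embedding of the primal-dual pair is: $\mathbf{G}(\mathbf{y},\bar{\mathbf{x}})-(\mathbf{0},\bar{\mathbf{s}})=(\mathbf{0},\mathbf{0})$,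 $\mathbf{z}\in\mathcal{F}$. Let $\bar F(\bar{\mathbf{x}})=F(\mathbf{x})-\ln\tau$, with gradient $\bar g$ and Hessian $\bar H$, and $\bar\nu=\nu+1$. Let $\mu(\mathbf{z})=\bar{\mathbf{x}}^{\mathrm T}\bar{\mathbf{s}}/\bar\nu$, $\psi(\mathbf{z})=\bar{\mathbf{s}}+\mu(\mathbf{z})\bar g(\bar{\mathbf{x}})$, and for $0\le\theta<1$, $\mathcal{N}(\theta)=\{\mathbf{z}\in\mathcal{F}^\circ:\|\bar H(\bar{\mathbf{x}})^{-1/2}\psi(\mathbf{z})\|\le\theta\mu(\mathbf{z})\}$, where $\mathcal{F}^\circ$ is the interior of $\mathcal{F}$ and $\|\cdot\|$ is the Euclidean norm. Algorithm (Skajaa--Ye predictor-corrector method). Parameters: $0<\eta<1$, $\alpha_p,\alpha_c>0$, integer $r_c>0$. Start from $\mathbf{z}=\mathbf{z}^0\in\mathcal{N}(\eta)$. Each iteration (loop pass) does the following, unless the termination criterion holds, in which case the current $\mathbf{z}$ is returned. Prediction: solve for $\Delta_{\mathbf z}=(\Delta_{\bar{\mathbf x}},\Delta_{\mathbf y},\Delta_{\bar{\mathbf s}})$ the system $\mathbf{G}(\Delta_{\mathbf y},\Delta_{\bar{\mathbf x}})-(\mathbf{0},\Delta_{\bar{\mathbf s}})=-(\mathbf{G}(\mathbf{y},\bar{\mathbf{x}})-(\mathbf{0},\bar{\mathbf{s}}))$, $\Delta_{\bar{\mathbf s}}+\mu(\mathbf{z})\bar H(\bar{\mathbf{x}})\Delta_{\bar{\mathbf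 x}}=-\bar{\mathbf{s}}$, and set $\mathbf{z}\leftarrow\mathbf{z}+\alpha_p\Delta_{\mathbf z}$. Correction: repeat $r_c$ times: solve $\mathbf{G}(\Delta_{\mathbf y},\Delta_{\bar{\mathbf x}})-(\mathbf{0},\Delta_{\bar{\mathbf s}})=\mathbf{0}$, $\Delta_{\bar{\mathbf s}}+\mu(\mathbf{z})\bar H(\bar{\mathbf{x}})\Delta_{\bar{\mathbf x}}=-\psi(\mathbf{z})$ at the current $\mathbf{z}$, and set $\mathbf{z}\leftarrow\mathbf{z}+\alpha_c\Delta_{\mathbf z}$. Termination criterion: the two displayed inequalities of the claim hold for the current $\mathbf{z}$. The $O(\cdot)$ notation is used in the usual asymptotic sense (small $\varepsilon$), with an absolute constant. *)

theory Defs
  imports "HOL-Analysis.Derivative" "HOL-Library.Poly_Mapping" "Jordan_Normal_Form.Determinant"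
begin

text \<open>
  All dimensions here are natural numbers rather than types, because the constant hidden in the
  \<open>O\<close>-notation must not depend on them.  Hence vectors and matrices are those of
  \<open>Jordan_Normal_Form\<close>, with \<open>carrier_vec m\<close> as the space of real vectors of length \<open>m\<close>.
\<close>

no_notation inner (infix \<open>\<bullet>\<close> 70)
no_notation vec_nth (infixl \<open>$\<close> 90)

type_synonym rvec = "real Matrix.vec"
type_synonym rmat = "real Matrix.mat"


section \<open>Vectors\<close>

definition vnorm :: "rvec \<Rightarrow> real" where
  "vnorm v = sqrt (v \<bullet> v)"

definition dual_cone :: "nat \<Rightarrow> rvec set \<Rightarrow> rvec set" where
  "dual_cone m S = {x \<in> carrier_vec m. \<forall>s\<in>S. s \<bullet> x \<ge> 0}"

definition gradient :: "nat \<Rightarrow> (rvec \<Rightarrow> real) \<Rightarrow> rvec \<Rightarrow> rvec" where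
  "gradient m f x = Matrix.vec m (\<lambda>i. deriv (\<lambda>t. f (x + t \<cdot>\<^sub>v unit_vec m i)) 0)"

definition hessian :: "nat \<Rightarrow> (rvec \<Rightarrow> real) \<Rightarrow> rvec \<Rightarrow> rmat" where
  "hessian m f x =
     Matrix.mat m m (\<lambda>(i, j). deriv (\<lambda>t. gradient m f (x + t \<cdot>\<^sub>v unit_vec m j) $ i) 0)"

text \<open>
  For positive definite \<open>M\<close>, the matrix chosen here is unique: it is the symmetric positive
  semidefinite square root of the inverse of \<open>M\<close>.
\<close>

definition inv_sqrt_mat :: "rmat \<Rightarrow> rmat" where
  "inv_sqrt_mat M = (let m = dim_row M in
     SOME R. R \<in> carrier_mat m m \<and> transpose_mat R = R \<and>
       (\<forall>v\<in>carrier_vec m. v \<bullet> (R *\<^sub>v v) \<ge> 0) \<and> R * R * M = 1\<^sub>m m)"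


section \<open>Polynomials and the sum-of-squares cone\<close>

text \<open>
  A polynomial in the variables \<open>0, \<dots>, n - 1\<close> maps exponent vectors to coefficients.
\<close>

type_synonym mpoly = "(nat \<Rightarrow>\<^sub>0 nat) \<Rightarrow>\<^sub>0 real"

definition poly_scale :: "real \<Rightarrow> mpoly \<Rightarrow> mpoly" where
  "poly_scale c f = Poly_Mapping.single 0 c * f"

interpretation mpoly: vector_space poly_scale
  by unfold_locales
    (simp_all add: poly_scale_def distrib_left distrib_right single_add mult_single
      flip: mult.assoc)

definition poly_space :: "nat \<Rightarrow> nat \<Rightarrow> mpoly set" where
  "poly_space n r = {f. \<forall>m\<in>Poly_Mapping.keys f. Poly_Mapping.keys m \<subseteq> {..<n} \<and>
     (\<Sum>i\<in>Poly_Mapping.keys m. Poly_Mapping.lookup m i) \<le> r}"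

definition ordered_basis :: "mpoly set \<Rightarrow> nat \<Rightarrow> (nat \<Rightarrow> mpoly) \<Rightarrow> bool" where
  "ordered_basis V m p \<longleftrightarrow>
     inj_on p {..<m} \<and> mpoly.independent (p ` {..<m}) \<and> mpoly.span (p ` {..<m}) = V"

definition dim_L :: "nat \<Rightarrow> nat \<Rightarrow> nat" where
  "dim_L n d = (n + d) choose n"

definition dim_U :: "nat \<Rightarrow> nat \<Rightarrow> nat" where
  "dim_U n d = (n + 2 * d) choose n"

definition sos_cone :: "nat \<Rightarrow> nat \<Rightarrow> (nat \<Rightarrow> mpoly) \<Rightarrow> rvec set" where
  "sos_cone n d q = {s \<in> carrier_vec (dim_U n d).
     \<exists>fs. set fs \<subseteq> poly_space n d \<and>
       (\<Sum>u<dim_U n d. poly_scale (s $ u) (q u)) = sum_list (map (\<lambda>f. f\<^sup>2) fs)}"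

definition Emat :: "nat \<Rightarrow> nat \<Rightarrow> (nat \<Rightarrow> mpoly) \<Rightarrow> (nat \<Rightarrow> mpoly) \<Rightarrow> nat \<Rightarrow> rmat" where
  "Emat n d p q u = Matrix.mat (dim_L n d) (dim_L n d)
     (\<lambda>(i, j). mpoly.representation (q ` {..<dim_U n d}) (p i * p j) (q u))"

definition Lambda_op :: "nat \<Rightarrow> nat \<Rightarrow> (nat \<Rightarrow> mpoly) \<Rightarrow> (nat \<Rightarrow> mpoly) \<Rightarrow> rvec \<Rightarrow> rmat" where
  "Lambda_op n d p q x = Matrix.mat (dim_L n d) (dim_L n d)
     (\<lambda>ij. \<Sum>u<dim_U n d. x $ u * Emat n d p q u $$ ij)"


section \<open>Conic problems and their homogeneous self-dual embedding\<close>

record conic_problem =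
  dim_x :: nat
  dim_y :: nat
  coneK :: "rvec set"
  barrier :: "rvec \<Rightarrow> real"
  barrier_param :: real
  matA :: rmat
  vecb :: rvec
  vecc :: rvec

definition sos_problem ::
  "nat \<Rightarrow> nat \<Rightarrow> (nat \<Rightarrow> mpoly) \<Rightarrow> (nat \<Rightarrow> mpoly) \<Rightarrow> nat \<Rightarrow> rmat \<Rightarrow> rvec \<Rightarrow> rvec \<Rightarrow> conic_problem" where
  "sos_problem n d p q k A b c =
     \<lparr> dim_x = dim_U n d, dim_y = k,
       coneK = dual_cone (dim_U n d) (sos_cone n d q),
       barrier = (\<lambda>x. - ln (Determinant.det (Lambda_op n d p q x))),
       barrier_param = real (dim_L n d),
       matA = A, vecb = b, vecc = c \<rparr>"

text \<open>An iterate \<open>(xb, y, sb)\<close> has \<open>xb = (x, \<tau>)\<close> and \<open>sb = (s, \<kappa>)\<close>, with the scalar as last entry.\<close>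

type_synonym iterate = "rvec \<times> rvec \<times> rvec"

definition extended_cone :: "rvec set \<Rightarrow> rvec set" where
  "extended_cone C = {x @\<^sub>v vec_of_list [t] | x t. x \<in> C \<and> t \<ge> 0}"

definition iterate_space :: "conic_problem \<Rightarrow> iterate set" where
  "iterate_space P =
     carrier_vec (dim_x P + 1) \<times> carrier_vec (dim_y P) \<times> carrier_vec (dim_x P + 1)"

definition feasible_set :: "conic_problem \<Rightarrow> iterate set" where
  "feasible_set P =
     extended_cone (coneK P) \<times> carrier_vec (dim_y P) \<times>
     extended_cone (dual_cone (dim_x P) (coneK P))"

definition feasible_interior :: "conic_problem \<Rightarrow> iterate set" where
  "feasible_interior P = {(xb, y, sb) \<in> iterate_space P.
     \<exists>e>0. \<forall>(xb', y', sb') \<in> iterate_space P.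
       vnorm (xb' - xb) < e \<and> vnorm (y' - y) < e \<and> vnorm (sb' - sb) < e
       \<longrightarrow> (xb', y', sb') \<in> feasible_set P}"

definition Gmat :: "conic_problem \<Rightarrow> rmat" where
  "Gmat P = (let k = dim_y P; N = dim_x P; A = matA P; b = vecb P; c = vecc P in
     four_block_mat
       (four_block_mat (0\<^sub>m k k) A (- transpose_mat A) (0\<^sub>m N N))
       (mat_of_cols (k + N) [(- b) @\<^sub>v c])
       (mat_of_rows (k + N) [b @\<^sub>v (- c)])
       (0\<^sub>m 1 1))"

definition residual :: "conic_problem \<Rightarrow> iterate \<Rightarrow> rvec" where
  "residual P = (\<lambda>(xb, y, sb). Gmat P *\<^sub>v (y @\<^sub>v xb) - (0\<^sub>v (dim_y P) @\<^sub>v sb))"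

definition barrier_ext :: "conic_problem \<Rightarrow> rvec \<Rightarrow> real" where
  "barrier_ext P xb = barrier P (vec_first xb (dim_x P)) - ln (xb $ dim_x P)"

definition gbar :: "conic_problem \<Rightarrow> rvec \<Rightarrow> rvec" where
  "gbar P = gradient (dim_x P + 1) (barrier_ext P)"

definition Hbar :: "conic_problem \<Rightarrow> rvec \<Rightarrow> rmat" where
  "Hbar P = hessian (dim_x P + 1) (barrier_ext P)"

definition mu :: "conic_problem \<Rightarrow> iterate \<Rightarrow> real" where
  "mu P = (\<lambda>(xb, y, sb). (xb \<bullet> sb) / (barrier_param P + 1))"

definition psi :: "conic_problem \<Rightarrow> iterate \<Rightarrow> rvec" where
  "psi P = (\<lambda>(xb, y, sb). sb + mu P (xb, y, sb) \<cdot>\<^sub>v gbar P xb)"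

definition neighborhood :: "conic_problem \<Rightarrow> real \<Rightarrow> iterate set" where
  "neighborhood P \<theta> = {(xb, y, sb) \<in> feasible_interior P.
     vnorm (inv_sqrt_mat (Hbar P xb) *\<^sub>v psi P (xb, y, sb)) \<le> \<theta> * mu P (xb, y, sb)}"


section \<open>The predictor-corrector algorithm\<close>

definition move :: "real \<Rightarrow> iterate \<Rightarrow> iterate \<Rightarrow> iterate" where
  "move \<alpha> = (\<lambda>(dx, dy, ds) (xb, y, sb). (xb + \<alpha> \<cdot>\<^sub>v dx, y + \<alpha> \<cdot>\<^sub>v dy, sb + \<alpha> \<cdot>\<^sub>v ds))"

text \<open>
  The steps are relations, since the linear systems determine \<open>dy\<close> uniquely only if \<open>A\<close> has full
  row rank.  No step is possible outside the interior, where \<open>gbar\<close> and \<open>Hbar\<close> have no meaning.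
\<close>

definition prediction_step :: "conic_problem \<Rightarrow> real \<Rightarrow> iterate \<Rightarrow> iterate \<Rightarrow> bool" where
  "prediction_step P \<alpha> = (\<lambda>(xb, y, sb) z'. (xb, y, sb) \<in> feasible_interior P \<and>
     (\<exists>dx dy ds. (dx, dy, ds) \<in> iterate_space P \<and>
       residual P (dx, dy, ds) = - residual P (xb, y, sb) \<and>
       ds + mu P (xb, y, sb) \<cdot>\<^sub>v (Hbar P xb *\<^sub>v dx) = - sb \<and>
       z' = move \<alpha> (dx, dy, ds) (xb, y, sb)))"

definition correction_step :: "conic_problem \<Rightarrow> real \<Rightarrow> iterate \<Rightarrow> iterate \<Rightarrow> bool" where
  "correction_step P \<alpha> = (\<lambda>(xb, y, sb) z'. (xb, y, sb) \<in> feasible_interior P \<and>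
     (\<exists>dx dy ds. (dx, dy, ds) \<in> iterate_space P \<and>
       residual P (dx, dy, ds) = 0\<^sub>v (dim_y P + dim_x P + 1) \<and>
       ds + mu P (xb, y, sb) \<cdot>\<^sub>v (Hbar P xb *\<^sub>v dx) = - psi P (xb, y, sb) \<and>
       z' = move \<alpha> (dx, dy, ds) (xb, y, sb)))"

definition stopping :: "conic_problem \<Rightarrow> real \<Rightarrow> iterate \<Rightarrow> iterate \<Rightarrow> bool" where
  "stopping P \<epsilon> z0 z \<longleftrightarrow>
     mu P z \<le> \<epsilon> * mu P z0 \<and> vnorm (residual P z) \<le> \<epsilon> * vnorm (residual P z0)"

text \<open>
  Total correctness of a nondeterministic step: it can be carried out, and whatever solution of
  its linear system is taken, the new iterate satisfies \<open>Q\<close>.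
\<close>

definition surely :: "(iterate \<Rightarrow> iterate \<Rightarrow> bool) \<Rightarrow> (iterate \<Rightarrow> bool) \<Rightarrow> iterate \<Rightarrow> bool" where
  "surely R Q z \<longleftrightarrow> (\<exists>z'. R z z') \<and> (\<forall>z'. R z z' \<longrightarrow> Q z')"

text \<open>
  \<open>terminates_within P \<alpha>\<^sub>p \<alpha>\<^sub>c r\<^sub>c stop Q m z\<close>: started at \<open>z\<close>, with step sizes \<open>\<alpha>\<^sub>p\<close>, \<open>\<alpha>\<^sub>c\<close> and
  \<open>r\<^sub>c\<close> correction steps per iteration, the algorithm is sure to return, after at most \<open>m\<close>
  iterations, an iterate satisfying \<open>Q\<close>.
\<close>

primrec terminates_within :: "conic_problem \<Rightarrow> real \<Rightarrow> real \<Rightarrow> nat \<Rightarrow>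
    (iterate \<Rightarrow> bool) \<Rightarrow> (iterate \<Rightarrow> bool) \<Rightarrow> nat \<Rightarrow> iterate \<Rightarrow> bool" where
  "terminates_within P \<alpha>p \<alpha>c rc stop Q 0 = (\<lambda>z. stop z \<and> Q z)"
| "terminates_within P \<alpha>p \<alpha>c rc stop Q (Suc m) = (\<lambda>z. if stop z then Q z else
     surely (prediction_step P \<alpha>p)
       ((surely (correction_step P \<alpha>c) ^^ rc) (terminates_within P \<alpha>p \<alpha>c rc stop Q m)) z)"

end

theory Submission
  imports Defs "Jordan_Normal_Form.Spectral_Radius"
begin

text \<open>
  Since \<open>F x - ln \<tau> = - ln det (diag (\<Lambda> x, \<tau>))\<close>, the extended barrier is the log-determinant of one
  linear matrix pencil of size \<open>L + 1\<close>, and after a change of coordinates taking the current matrix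
  to the identity the local norm becomes the Frobenius norm.  Elementary estimates for this norm
  replace the general theory of self-concordant functions: the step of length \<open>\<delta> < 1\<close> stays in the
  cone, the gradient differs from its linearisation by at most \<open>\<delta>\<^sup>2\<close> in the new dual norm, and
  changing the base point costs a factor \<open>1 + \<delta>\<close>.

  The skew-symmetry of \<open>G\<close> makes \<open>x + \<Delta>x\<close> and \<open>s + \<Delta>s\<close> orthogonal in the predictor step, whence
  \<open>\<Delta>x\<close> has local norm at most \<open>sqrt (L + 1)\<close>.  A step of length \<open>\<alpha> = 1 / (10 * sqrt (L + 1))\<close> thus leads
  from \<open>N(1/10)\<close> to \<open>N(1/5)\<close> and multiplies \<open>\<mu>\<close> and the residual by at most \<open>1 - 9\<alpha>/10\<close>.  One full
  corrector step converges quadratically, returns to \<open>N(1/10)\<close>, does not increase \<open>\<mu>\<close>, and keeps the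
  residual.
\<close>

section \<open>Symmetric matrices\<close>

text \<open>The hidden constant is uniform over all problem sizes, so no estimate may lose a factor
  that depends on the dimension; the dimension enters only through the local norm of
  \<open>x\<close> at itself, which is \<open>sqrt (L + 1)\<close>. Two obstacles shape the rest.
  Membership of the new \<open>s\<close> in the interior of the dual cone has to be shown without a
  barrier for that cone: for a cone element \<open>y\<close> the local norm is at most
  \<open>- (g x \<bullet> y)\<close>, because the Frobenius norm of a positive semidefinite matrix
  is at most its trace, so every \<open>s\<close> close to \<open>- \<mu> g x\<close> in the dual
  norm is positive on the cone with a margin. And the Newton systems may be degenerate in
  \<open>y\<close> if \<open>A\<close> lacks full row rank: a solution is obtained from an
  orthogonality criterion, while the estimates use only relations that hold for every solution. The
  widths 1/10 and 1/5 are round numbers that fit together: after the corrector two errors of size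
  (1/5)^2 remain, and their sum is below 1/10 of the new \<open>\<mu>\<close>.\<close>

definition positive_semidefinite :: "nat \<Rightarrow> rmat \<Rightarrow> bool" where
  "positive_semidefinite n A \<longleftrightarrow> A \<in> carrier_mat n n \<and> A\<^sup>T = A \<and>
     (\<forall>v\<in>carrier_vec n. v \<bullet> (A *\<^sub>v v) \<ge> 0)"

definition positive_definite :: "nat \<Rightarrow> rmat \<Rightarrow> bool" where
  "positive_definite n A \<longleftrightarrow> A \<in> carrier_mat n n \<and> A\<^sup>T = A \<and>
     (\<forall>v\<in>carrier_vec n. v \<noteq> 0\<^sub>v n \<longrightarrow> v \<bullet> (A *\<^sub>v v) > 0)"

lemma scalar_prod_self_nonneg [simp]: "(v::rvec) \<bullet> v \<ge> 0"
  by (auto simp: scalar_prod_def intro!: sum_nonneg)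

lemma scalar_prod_self_pos:
  assumes "(v::rvec) \<in> carrier_vec n" "v \<noteq> 0\<^sub>v n"
  shows "v \<bullet> v > 0"
  using conjugate_square_greater_0_vec[of v n] assms by simp

lemma scalar_prod_self_eq_0:
  assumes "(v::rvec) \<in> carrier_vec n"
  shows "v \<bullet> v = 0 \<longleftrightarrow> v = 0\<^sub>v n"
  using conjugate_square_eq_0_vec[of v n] assms by simp

lemma positive_definite_imp_semidefinite:
  assumes "positive_definite n A"
  shows "positive_semidefinite n A"
  unfolding positive_semidefinite_def
proof (intro conjI ballI)
  fix v :: rvec assume v: "v \<in> carrier_vec n"
  have A: "A \<in> carrier_mat n n" using assms by (simp add: positive_definite_def)
  show "v \<bullet> (A *\<^sub>v v) \<ge> 0"
  proof (cases "v = 0\<^sub>v n")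
    case True
    then show ?thesis using A by (metis mult_mat_vec_carrier order_refl scalar_prod_left_zero zero_carrier_vec)
  next
    case False
    then show ?thesis using assms v by (auto simp: positive_definite_def less_imp_le)
  qed
qed (use assms in \<open>auto simp: positive_definite_def\<close>)

lemma transpose_swap_scalar_prod:
  fixes A :: rmat
  assumes "A \<in> carrier_mat m n" "x \<in> carrier_vec n" "y \<in> carrier_vec m"
  shows "y \<bullet> (A *\<^sub>v x) = (A\<^sup>T *\<^sub>v y) \<bullet> x"
  using transpose_vec_mult_scalar[OF assms] by simp

lemma symmetric_mat_eigenvector:
  fixes A :: rmat
  assumes A: "A \<in> carrier_mat n n" and sym: "A\<^sup>T = A" and n: "n > 0"
  obtains v k where "v \<in> carrier_vec n" "v \<noteq> 0\<^sub>v n" "A *\<^sub>v v = k \<cdot>\<^sub>v v"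
proof -
  define C where "C = map_mat complex_of_real A"
  have C: "C \<in> carrier_mat n n" using A by (simp add: C_def)
  obtain e where "e \<in> spectrum C" using spectrum_non_empty[OF C n] by auto
  then obtain w where w: "w \<in> carrier_vec n" "w \<noteq> 0\<^sub>v n" "C *\<^sub>v w = e \<cdot>\<^sub>v w"
    using C unfolding spectrum_def eigenvalue_def eigenvector_def by auto
  define a where "a = map_vec Re w"
  define b where "b = map_vec Im w"
  have ab: "a \<in> carrier_vec n" "b \<in> carrier_vec n" using w by (auto simp: a_def b_def)
  have comp: "(C *\<^sub>v w) $ i = Complex ((A *\<^sub>v a) $ i) ((A *\<^sub>v b) $ i)" if "i < n" for i
    using that A w(1) by (auto simp: C_def a_def b_def scalar_prod_def complex_eq_iff)
  have Aa: "A *\<^sub>v a = Re e \<cdot>\<^sub>v a - Im e \<cdot>\<^sub>v b" and Ab: "A *\<^sub>v b = Re e \<cdot>\<^sub>v b + Im e \<cdot>\<^sub>v a"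
    using comp w(1) A unfolding w(3) by (auto intro!: eq_vecI simp: a_def b_def complex_eq_iff)
  have "b \<bullet> (A *\<^sub>v a) = (A *\<^sub>v b) \<bullet> a"
    using transpose_swap_scalar_prod[OF A ab] sym by simp
  moreover have "b \<bullet> (A *\<^sub>v a) = Re e * (b \<bullet> a) - Im e * (b \<bullet> b)"
    unfolding Aa using ab by (simp add: scalar_prod_minus_distrib[of _ n])
  moreover have "(A *\<^sub>v b) \<bullet> a = Re e * (b \<bullet> a) + Im e * (a \<bullet> a)"
    unfolding Ab using ab by (simp add: add_scalar_prod_distrib[of _ n])
  ultimately have z: "Im e * (a \<bullet> a + b \<bullet> b) = 0" by (simp add: algebra_simps)
  have nz: "a \<noteq> 0\<^sub>v n \<or> b \<noteq> 0\<^sub>v n"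
  proof (rule ccontr)
    assume "\<not> ?thesis"
    then have "w $ i = 0" if "i < n" for i
      using that w(1) unfolding a_def b_def by (auto simp: complex_eq_iff vec_eq_iff)
    with w show False by (auto simp: vec_eq_iff)
  qed
  have "a \<bullet> a + b \<bullet> b > 0"
    using nz scalar_prod_self_pos[OF ab(1)] scalar_prod_self_pos[OF ab(2)]
    by (smt (verit) scalar_prod_self_nonneg)
  with z have "Im e = 0" by simp
  with Aa Ab ab have "A *\<^sub>v a = Re e \<cdot>\<^sub>v a" "A *\<^sub>v b = Re e \<cdot>\<^sub>v b"
    by (auto simp: vec_eq_iff)
  with nz ab that show thesis by blast
qed

text \<open>\<open>Q\<close> is the reflection in the hyperplane orthogonal to
  \<open>w = v - e0\<close>, which swaps the two unit vectors \<open>v\<close> and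
  \<open>e0\<close>. The case \<open>v = e0\<close> is split off because \<open>w\<close> would
  vanish.\<close>

lemma householder_reflection:
  fixes v :: rvec
  assumes v: "v \<in> carrier_vec n" and unit: "v \<bullet> v = 1" and n: "n > 0"
  obtains Q where "Q \<in> carrier_mat n n" "Q\<^sup>T = Q" "Q * Q = 1\<^sub>m n" "Q *\<^sub>v v = unit_vec n 0"
proof (cases "v = unit_vec n 0")
  case True
  then show thesis using that[of "1\<^sub>m n"] v by simp
next
  case False
  define w where "w = v - unit_vec n 0"
  have w: "w \<in> carrier_vec n" using v by (simp add: w_def)
  have "w \<noteq> 0\<^sub>v n" using False v by (auto simp: w_def vec_eq_iff)
  then have ww: "w \<bullet> w > 0" using scalar_prod_self_pos[OF w] by simp
  define c where "c = 2 / (w \<bullet> w)"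
  have cw: "c * (w \<bullet> w) = 2" using ww by (simp add: c_def)
  have wv: "w \<bullet> v = 1 - v $ 0" 
    using v n unit by (simp add: w_def minus_scalar_prod_distrib[of _ n])
  have "w \<bullet> w = 2 * (w \<bullet> v)"
    unfolding wv using v n unit
    by (simp add: w_def minus_scalar_prod_distrib[of _ n] scalar_prod_minus_distrib[of _ n])
  with cw have cwv: "c * (w \<bullet> v) = 1" by simp
  define Q where "Q = Matrix.mat n n (\<lambda>(i, j). (if i = j then 1 else 0) - c * w $ i * w $ j)"
  have Q: "Q \<in> carrier_mat n n" by (simp add: Q_def)
  have "Q * Q = 1\<^sub>m n"
  proof (rule eq_matI)
    fix i j assume ij: "i < dim_row (1\<^sub>m n :: rmat)" "j < dim_col (1\<^sub>m n :: rmat)"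
    then have "(Q * Q) $$ (i, j) = (\<Sum>k<n. ((if i = k then 1 else 0) - c * w $ i * w $ k) *
        ((if k = j then 1 else 0) - c * w $ k * w $ j))"
      by (simp add: Q_def scalar_prod_def lessThan_atLeast0)
    also have "\<dots> = (\<Sum>k<n. (if k = i then (if i = j then 1 else 0) - c * w $ i * w $ j else 0)
        - (if k = j then c * w $ i * w $ j else 0)
        + c * w $ i * w $ j * (c * (w $ k * w $ k)))"
      by (intro sum.cong) (auto simp: algebra_simps)
    also have "\<dots> = (if i = j then 1 else 0) - c * w $ i * w $ j - c * w $ i * w $ j
        + c * w $ i * w $ j * (c * (w \<bullet> w))"
      using ij w by (simp add: sum.distrib sum_subtractf scalar_prod_def sum_distrib_left lessThan_atLeast0)
    also have "\<dots> = 1\<^sub>m n $$ (i, j)" using ij by (simp add: cw)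
    finally show "(Q * Q) $$ (i, j) = 1\<^sub>m n $$ (i, j)" .
  qed (simp_all add: Q_def)
  moreover have "Q *\<^sub>v v = unit_vec n 0"
  proof (rule eq_vecI)
    fix i assume i: "i < dim_vec (unit_vec n 0 :: rvec)"
    then have "(Q *\<^sub>v v) $ i = (\<Sum>k<n. (if k = i then v $ i else 0) - w $ i * (c * (w $ k * v $ k)))"
      using v by (auto simp: Q_def scalar_prod_def lessThan_atLeast0 algebra_simps intro!: sum.cong)
    also have "\<dots> = v $ i - w $ i * (c * (w \<bullet> v))"
      using i v by (simp add: sum_subtractf scalar_prod_def sum_distrib_left lessThan_atLeast0)
    also have "\<dots> = v $ i - w $ i" by (simp only: cwv mult_1_right)
    also have "\<dots> = unit_vec n 0 $ i" using i v by (simp add: w_def)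
    finally show "(Q *\<^sub>v v) $ i = unit_vec n 0 $ i" .
  qed (simp add: Q_def)
  moreover have "Q\<^sup>T = Q" by (auto simp: Q_def)
  ultimately show thesis using that Q by blast
qed

text \<open>Witness for the choice in \<open>inv_sqrt_mat\<close>. Induction on the size: a
  Householder reflection \<open>Q\<close> carries a unit eigenvector to the first axis, so
  \<open>Q * A * Q\<close> splits into the eigenvalue and a positive definite block of size
  \<open>n\<close>; the root of that block, bordered by \<open>1 / sqrt l\<close>, is reflected
  back.\<close>

lemma positive_definite_inverse_sqrt:
  assumes "positive_definite n A"
  obtains R where "R \<in> carrier_mat n n" "R\<^sup>T = R" 
    "\<forall>v\<in>carrier_vec n. v \<bullet> (R *\<^sub>v v) \<ge> 0" "R * R * A = 1\<^sub>m n"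
  using assms
proof (induction n arbitrary: A thesis)
  case 0
  then show ?case by (intro "0"(1)[of "1\<^sub>m 0"]) (auto simp: positive_definite_def scalar_prod_def)
next
  case (Suc n A)
  let ?N = "Suc n"
  note assoc [simp] = assoc_mult_mat[of _ ?N ?N _ ?N _ ?N]
  note assocv [simp] = assoc_mult_mat_vec[of _ ?N ?N _ ?N]
  note carr [simp] = mult_carrier_mat[of _ ?N ?N _ ?N]
  have A [simp]: "A \<in> carrier_mat ?N ?N" and sym: "A\<^sup>T = A"
    using Suc.prems by (auto simp: positive_definite_def)
  obtain v0 l where v0: "v0 \<in> carrier_vec ?N" "v0 \<noteq> 0\<^sub>v ?N" "A *\<^sub>v v0 = l \<cdot>\<^sub>v v0"
    using symmetric_mat_eigenvector[OF A sym] by blast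
  define v where "v = (1 / sqrt (v0 \<bullet> v0)) \<cdot>\<^sub>v v0"
  have v [simp]: "v \<in> carrier_vec ?N" using v0 by (simp add: v_def)
  have vv: "v \<bullet> v = 1" using v0 scalar_prod_self_pos[OF v0(1,2)]
    by (simp add: v_def field_simps)
  have Av: "A *\<^sub>v v = l \<cdot>\<^sub>v v"
    using v0 mult_mat_vec[OF A v0(1)] by (simp add: v_def smult_smult_assoc mult.commute)
  have "v \<noteq> 0\<^sub>v ?N" using vv by auto
  then have "v \<bullet> (A *\<^sub>v v) > 0" using Suc.prems by (auto simp: positive_definite_def)
  then have l: "l > 0" using vv by (simp add: Av)
  obtain Q where Q [simp]: "Q \<in> carrier_mat ?N ?N" and Qs: "Q\<^sup>T = Q" and QQ: "Q * Q = 1\<^sub>m ?N"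
    and Qv: "Q *\<^sub>v v = unit_vec ?N 0"
    using householder_reflection[OF v vv] by blast
  have QQ': "Q * (Q * Y) = Y" if "Y \<in> carrier_mat ?N ?N" for Y
    using that QQ by (metis Q assoc left_mult_one_mat)
  have Qe: "Q *\<^sub>v unit_vec ?N 0 = v"
    unfolding Qv[symmetric] using QQ by (metis Q assocv v one_mult_mat_vec)
  define B where "B = Q * A * Q"
  have B [simp]: "B \<in> carrier_mat ?N ?N" by (simp add: B_def)
  have Bs: "B\<^sup>T = B"
    by (simp add: B_def transpose_mult[of _ ?N ?N _ ?N] Qs sym)
  have Bq: "u \<bullet> (B *\<^sub>v u) = (Q *\<^sub>v u) \<bullet> (A *\<^sub>v (Q *\<^sub>v u))" if "u \<in> carrier_vec ?N" for u
    using transpose_swap_scalar_prod[OF Q, of "A *\<^sub>v (Q *\<^sub>v u)" u] that Qs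
    by (simp add: B_def mult_mat_vec_carrier[of _ ?N ?N])
  have Be: "B *\<^sub>v unit_vec ?N 0 = l \<cdot>\<^sub>v unit_vec ?N 0"
    using mult_mat_vec[OF Q v] by (simp add: B_def Qe Av Qv)
  have B0: "B $$ (i, 0) = (if i = 0 then l else 0)" if "i < ?N" for i
  proof -
    have "(B *\<^sub>v unit_vec ?N 0) $ i = B $$ (i, 0)" using that carrier_matD[OF B] by simp
    then show ?thesis using that by (auto simp: Be split: if_splits)
  qed
  have B0': "B $$ (0, i) = (if i = 0 then l else 0)" if "i < ?N" for i
    using B0[OF that] Bs that carrier_matD[OF B] by (metis index_transpose_mat(1) zero_less_Suc)
  define A3 where "A3 = Matrix.mat n n (\<lambda>(i, j). B $$ (Suc i, Suc j))"
  have A3 [simp]: "A3 \<in> carrier_mat n n" by (simp add: A3_def)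
  define L where "L x = Matrix.mat 1 1 (\<lambda>_. x :: real)" for x
  have L [simp]: "L x \<in> carrier_mat 1 1" for x by (simp add: L_def)
  define blk where "blk x Y = four_block_mat (L x) (0\<^sub>m 1 n) (0\<^sub>m n 1) Y" for x :: real and Y
  have blk [simp]: "blk x Y \<in> carrier_mat ?N ?N" if "Y \<in> carrier_mat n n" for x Y
    using four_block_carrier_mat[OF L that] by (simp only: blk_def plus_1_eq_Suc)
  have B_blk: "B = blk l A3"
    by (rule eq_matI) (use carrier_matD[OF B] B0 B0' in \<open>auto simp: blk_def A3_def L_def\<close>)
  have blk_q: "(vCons x u) \<bullet> (blk y Y *\<^sub>v vCons x u) = y * x * x + u \<bullet> (Y *\<^sub>v u)"
    if Y: "Y \<in> carrier_mat n n" and u: "u \<in> carrier_vec n" for x u y Y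
  proof -
    let ?x = "vCons x vNil"
    have x: "?x \<in> carrier_vec 1" by (simp add: carrier_vecI)
    have eq: "vCons x u = ?x @\<^sub>v u" by simp
    show ?thesis
      unfolding eq blk_def
      apply (subst mult_mat_vec_split[OF L Y x u])
      apply (subst scalar_prod_append[of _ 1 _ n])
      using x Y u by (auto simp: L_def scalar_prod_def intro!: mult_mat_vec_carrier)
  qed
  have "positive_definite n A3"
    unfolding positive_definite_def
  proof (intro conjI ballI impI)
    show "A3\<^sup>T = A3" using Bs carrier_matD[OF B]
      by (intro eq_matI) (simp_all add: A3_def, metis Suc_less_eq index_transpose_mat(1))
    fix u :: rvec assume u: "u \<in> carrier_vec n" "u \<noteq> 0\<^sub>v n"
    have c: "vCons 0 u \<in> carrier_vec ?N" using u by simp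
    have nz: "vCons 0 u \<noteq> 0\<^sub>v ?N" using u by (simp add: zero_vec_Suc)
    have "Q *\<^sub>v vCons 0 u \<noteq> 0\<^sub>v ?N"
    proof
      assume "Q *\<^sub>v vCons 0 u = 0\<^sub>v ?N"
      then have "(Q * Q) *\<^sub>v vCons 0 u = Q *\<^sub>v 0\<^sub>v ?N" using assocv[OF Q Q c] by simp
      also have "\<dots> = 0\<^sub>v ?N" 
        by (intro eq_vecI) (simp_all add: carrier_matD[OF Q] row_carrier_vec[OF _ Q])
      finally show False using nz one_mult_mat_vec[OF c] unfolding QQ by simp
    qed
    then have "vCons 0 u \<bullet> (B *\<^sub>v vCons 0 u) > 0"
      unfolding Bq[OF c] using Suc.prems c by (auto simp: positive_definite_def mult_mat_vec_carrier[of _ ?N ?N])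
    then show "u \<bullet> (A3 *\<^sub>v u) > 0" using blk_q[OF A3 u(1), of 0 l] by (simp add: B_blk)
  qed simp
  then obtain R3 where R3 [simp]: "R3 \<in> carrier_mat n n" and R3s: "R3\<^sup>T = R3"
    and R3p: "\<forall>v\<in>carrier_vec n. v \<bullet> (R3 *\<^sub>v v) \<ge> 0" and R3i: "R3 * R3 * A3 = 1\<^sub>m n"
    using Suc.IH by blast
  define S where "S = blk (1 / sqrt l) R3"
  have S [simp]: "S \<in> carrier_mat ?N ?N" by (simp add: S_def)
  have blk_mult: "blk x Y * blk x' Y' = blk (x * x') (Y * Y')"
    if "Y \<in> carrier_mat n n" "Y' \<in> carrier_mat n n" for x Y x' Y'
  proof -
    have "L x * L x' = L (x * x')" by (rule eq_matI) (auto simp: L_def scalar_prod_def)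
    then show ?thesis using that unfolding blk_def
      by (subst mult_four_block_mat[OF L zero_carrier_mat zero_carrier_mat that(1) 
          L zero_carrier_mat zero_carrier_mat that(2)]) (auto simp: L_def)
  qed
  have SSB: "S * (S * B) = 1\<^sub>m ?N"
  proof -
    have "S * S * B = blk (1 / sqrt l * (1 / sqrt l) * l) (R3 * R3 * A3)"
      unfolding S_def B_blk using mult_carrier_mat[OF R3 R3] by (simp add: blk_mult)
    also have "\<dots> = blk 1 (1\<^sub>m n)" using l R3i by (simp add: real_sqrt_mult_self)
    also have "\<dots> = 1\<^sub>m ?N" by (rule eq_matI) (auto simp: blk_def L_def)
    finally show ?thesis by simp
  qed
  define R where "R = Q * S * Q"
  have R: "R \<in> carrier_mat ?N ?N" by (simp add: R_def)
  have Ss: "S\<^sup>T = S"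
    unfolding S_def blk_def
    by (subst transpose_four_block_mat[OF L zero_carrier_mat zero_carrier_mat R3])
       (auto simp: L_def R3s intro!: cong_four_block_mat)
  have "R\<^sup>T = R" by (simp add: R_def transpose_mult[of _ ?N ?N _ ?N] Qs Ss)
  moreover have "v \<bullet> (R *\<^sub>v v) \<ge> 0" if v: "v \<in> carrier_vec ?N" for v
  proof -
    have Qv: "Q *\<^sub>v v \<in> carrier_vec ?N" using v by (simp add: mult_mat_vec_carrier[of _ ?N ?N])
    then obtain x u where xu: "Q *\<^sub>v v = vCons x u" "u \<in> carrier_vec n"
      by (cases "Q *\<^sub>v v") auto
    have "v \<bullet> (R *\<^sub>v v) = (Q *\<^sub>v v) \<bullet> (S *\<^sub>v (Q *\<^sub>v v))"
      using transpose_swap_scalar_prod[OF Q, of "S *\<^sub>v (Q *\<^sub>v v)" v] v Qs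
      by (simp add: R_def mult_mat_vec_carrier[of _ ?N ?N])
    also have "\<dots> = 1 / sqrt l * x * x + u \<bullet> (R3 *\<^sub>v u)"
      unfolding xu S_def by (rule blk_q[OF R3 xu(2)])
    also have "\<dots> \<ge> 0" using R3p xu l by simp
    finally show ?thesis .
  qed
  moreover have "R * R * A = 1\<^sub>m ?N"
  proof -
    have "A = Q * (B * Q)" using QQ QQ' by (simp add: B_def right_mult_one_mat[OF A])
    then have "R * R * A = Q * (S * (S * (B * Q)))"
      by (simp add: R_def QQ')
    also have "\<dots> = Q * ((S * (S * B)) * Q)" by simp
    also have "\<dots> = 1\<^sub>m ?N" unfolding SSB by (simp add: QQ left_mult_one_mat[OF Q])
    finally show ?thesis .
  qed
  ultimately show ?case using Suc.prems R by blast
qed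

section \<open>Trace and Frobenius norm\<close>

definition mtrace :: "rmat \<Rightarrow> real" where
  "mtrace A = (\<Sum>i<dim_row A. A $$ (i, i))"

definition fnorm :: "rmat \<Rightarrow> real" where
  "fnorm A = sqrt (\<Sum>i<dim_row A. \<Sum>j<dim_col A. (A $$ (i, j))\<^sup>2)"

lemma mtrace_mult:
  assumes "A \<in> carrier_mat m n" "B \<in> carrier_mat n m"
  shows "mtrace (A * B) = (\<Sum>i<m. \<Sum>j<n. A $$ (i, j) * B $$ (j, i))"
  using assms by (auto simp: mtrace_def scalar_prod_def lessThan_atLeast0 intro!: sum.cong)

lemma mtrace_comm:
  assumes "A \<in> carrier_mat m n" "B \<in> carrier_mat n m"
  shows "mtrace (A * B) = mtrace (B * A)"
  unfolding mtrace_mult[OF assms] mtrace_mult[OF assms(2,1)]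
  by (subst sum.swap) (simp add: mult.commute)

lemma mtrace_add:
  assumes "A \<in> carrier_mat n n" "B \<in> carrier_mat n n"
  shows "mtrace (A + B) = mtrace A + mtrace B"
  using assms by (auto simp: mtrace_def sum.distrib)

lemma mtrace_smult:
  assumes "A \<in> carrier_mat n n"
  shows "mtrace (c \<cdot>\<^sub>m A) = c * mtrace A"
  using assms by (auto simp: mtrace_def sum_distrib_left)

lemma mtrace_one [simp]: "mtrace (1\<^sub>m n) = real n"
  by (simp add: mtrace_def)

lemma fnorm_nonneg [simp]: "fnorm A \<ge> 0"
  by (auto simp: fnorm_def intro!: sum_nonneg)

lemma fnorm_sq_sum:
  assumes "A \<in> carrier_mat m n"
  shows "(fnorm A)\<^sup>2 = (\<Sum>i<m. \<Sum>j<n. (A $$ (i, j))\<^sup>2)"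
  using assms by (simp add: fnorm_def sum_nonneg)

lemma fnorm_sq:
  assumes "A \<in> carrier_mat m n"
  shows "(fnorm A)\<^sup>2 = mtrace (A * A\<^sup>T)"
proof -
  have "(fnorm A)\<^sup>2 = (\<Sum>i<m. \<Sum>j<n. (A $$ (i, j))\<^sup>2)"
    by (rule fnorm_sq_sum[OF assms])
  also have "\<dots> = mtrace (A * A\<^sup>T)"
    using assms by (subst mtrace_mult[of _ m n]) (auto simp: power2_eq_square)
  finally show ?thesis .
qed

lemma fnorm_transpose [simp]: "fnorm (A\<^sup>T) = fnorm A"
  unfolding fnorm_def by (subst sum.swap) simp

lemma fnorm_0_iff:
  assumes "A \<in> carrier_mat m n"
  shows "fnorm A = 0 \<longleftrightarrow> A = 0\<^sub>m m n"
proof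
  assume "fnorm A = 0"
  then have "\<forall>i<m. \<forall>j<n. A $$ (i, j) = 0"
    using assms by (auto simp: fnorm_def sum_nonneg_eq_0_iff sum_nonneg)
  then show "A = 0\<^sub>m m n" using assms by auto
qed (use assms in \<open>auto simp: fnorm_def\<close>)

lemma Cauchy_Schwarz_scalar_prod:
  assumes "(v::rvec) \<in> carrier_vec n" "w \<in> carrier_vec n"
  shows "(v \<bullet> w)\<^sup>2 \<le> (v \<bullet> v) * (w \<bullet> w)"
  using Cauchy_Schwarz_ineq_sum[of "\<lambda>i. v $ i" "\<lambda>i. w $ i" "{0..<n}"] assms
  by (simp add: scalar_prod_def power2_eq_square)

lemma mtrace_mult_le_fnorm:
  assumes "A \<in> carrier_mat m n" "B \<in> carrier_mat n m"
  shows "\<bar>mtrace (A * B)\<bar> \<le> fnorm A * fnorm B"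
proof -
  let ?S = "{..<m} \<times> {..<n}"
  have "\<bar>mtrace (A * B)\<bar>\<^sup>2 = (\<Sum>(i, j)\<in>?S. A $$ (i, j) * B $$ (j, i))\<^sup>2"
    by (simp add: mtrace_mult[OF assms] sum.cartesian_product)
  also have "\<dots> \<le> (\<Sum>(i, j)\<in>?S. (A $$ (i, j))\<^sup>2) * (\<Sum>(i, j)\<in>?S. (B $$ (j, i))\<^sup>2)"
    using Cauchy_Schwarz_ineq_sum[of "\<lambda>(i, j). A $$ (i, j)" "\<lambda>(i, j). B $$ (j, i)" ?S]
    by (simp add: case_prod_unfold)
  also have "\<dots> = (fnorm A)\<^sup>2 * (fnorm (B\<^sup>T))\<^sup>2"
    using assms by (simp add: fnorm_sq_sum[of A m n] fnorm_sq_sum[of "B\<^sup>T" m n] sum.cartesian_product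
        case_prod_unfold del: fnorm_transpose)
  finally have "\<bar>mtrace (A * B)\<bar>\<^sup>2 \<le> (fnorm A * fnorm B)\<^sup>2"
    unfolding power_mult_distrib fnorm_transpose .
  then show ?thesis by (rule power2_le_imp_le) simp
qed

lemma vec_sq_mult_le_fnorm:
  assumes A: "A \<in> carrier_mat m n" and v: "v \<in> carrier_vec n"
  shows "(A *\<^sub>v v) \<bullet> (A *\<^sub>v v) \<le> (fnorm A)\<^sup>2 * (v \<bullet> v)"
proof -
  have "(A *\<^sub>v v) \<bullet> (A *\<^sub>v v) = (\<Sum>i<m. (row A i \<bullet> v)\<^sup>2)"
    using A by (simp add: scalar_prod_def[of "A *\<^sub>v v"] lessThan_atLeast0 power2_eq_square)
  also have "\<dots> \<le> (\<Sum>i<m. (row A i \<bullet> row A i) * (v \<bullet> v))"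
    using A v by (intro sum_mono Cauchy_Schwarz_scalar_prod) auto
  also have "\<dots> = (fnorm A)\<^sup>2 * (v \<bullet> v)"
    using A by (auto simp: fnorm_def sum_nonneg sum_distrib_right scalar_prod_def lessThan_atLeast0
        power2_eq_square intro!: sum.cong)
  finally show ?thesis .
qed

text \<open>The Frobenius norm dominates the operator norm; this takes the place of an eigenvalue
  bound whenever \<open>1 + D\<close> is compared with the identity.\<close>

lemma scalar_prod_mult_mat_le_fnorm:
  assumes A: "A \<in> carrier_mat n n" and v: "v \<in> carrier_vec n"
  shows "\<bar>v \<bullet> (A *\<^sub>v v)\<bar> \<le> fnorm A * (v \<bullet> v)"
proof (rule power2_le_imp_le)
  have "\<bar>v \<bullet> (A *\<^sub>v v)\<bar>\<^sup>2 \<le> (v \<bullet> v) * ((A *\<^sub>v v) \<bullet> (A *\<^sub>v v))"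
    using Cauchy_Schwarz_scalar_prod[OF v mult_mat_vec_carrier[OF A v]] by simp
  also have "\<dots> \<le> (v \<bullet> v) * ((fnorm A)\<^sup>2 * (v \<bullet> v))"
    using vec_sq_mult_le_fnorm[OF A v] by (intro mult_left_mono) auto
  finally show "\<bar>v \<bullet> (A *\<^sub>v v)\<bar>\<^sup>2 \<le> (fnorm A * (v \<bullet> v))\<^sup>2"
    by (simp add: power2_eq_square ac_simps)
qed simp

lemma fnorm_sq_columns:
  assumes "A \<in> carrier_mat m n"
  shows "(fnorm A)\<^sup>2 = (\<Sum>j<n. col A j \<bullet> col A j)"
proof -
  have "(fnorm A)\<^sup>2 = (\<Sum>i<m. \<Sum>j<n. (A $$ (i, j))\<^sup>2)"
    by (rule fnorm_sq_sum[OF assms])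
  also have "\<dots> = (\<Sum>j<n. col A j \<bullet> col A j)"
    using assms by (subst sum.swap) (simp add: scalar_prod_def power2_eq_square flip: lessThan_atLeast0)
  finally show ?thesis .
qed

text \<open>Applied column by column. Only an operator bound \<open>c\<close> for \<open>A\<close>
  is assumed, which matters for factors close to an orthogonal matrix: their operator norm is near
  1, while their Frobenius norm grows with the dimension.\<close>

lemma fnorm_mult_le_of_vec:
  assumes A: "A \<in> carrier_mat m n" and B: "B \<in> carrier_mat n k"
    and bound: "\<And>v. v \<in> carrier_vec n \<Longrightarrow> (A *\<^sub>v v) \<bullet> (A *\<^sub>v v) \<le> c\<^sup>2 * (v \<bullet> v)" and c: "c \<ge> 0"
  shows "fnorm (A * B) \<le> c * fnorm B"
proof (rule power2_le_imp_le)
  have "(fnorm (A * B))\<^sup>2 = (\<Sum>j<k. col (A * B) j \<bullet> col (A * B) j)"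
    by (rule fnorm_sq_columns[OF mult_carrier_mat[OF A B]])
  also have "\<dots> = (\<Sum>j<k. (A *\<^sub>v col B j) \<bullet> (A *\<^sub>v col B j))"
    by (intro sum.cong refl) (simp only: lessThan_iff col_mult2[OF A B])
  also have "\<dots> \<le> (\<Sum>j<k. c\<^sup>2 * (col B j \<bullet> col B j))"
    using B by (intro sum_mono bound) auto
  also have "\<dots> = (c * fnorm B)\<^sup>2"
    by (simp add: fnorm_sq_columns[OF B] power_mult_distrib sum_distrib_left)
  finally show "(fnorm (A * B))\<^sup>2 \<le> (c * fnorm B)\<^sup>2" .
qed (use c in simp)

lemma fnorm_mult_le:
  assumes "A \<in> carrier_mat m n" "B \<in> carrier_mat n k"
  shows "fnorm (A * B) \<le> fnorm A * fnorm B"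
  by (rule fnorm_mult_le_of_vec[OF assms vec_sq_mult_le_fnorm[OF assms(1)] fnorm_nonneg])

text \<open>The parabola is nonnegative at its vertex \<open>- b / c\<close>. The degenerate case
  \<open>c = 0\<close> occurs too, since a diagonal entry of a semidefinite matrix may vanish; there
  a nonconstant line takes the value -1 somewhere.\<close>

lemma quadratic_nonneg_discriminant:
  fixes a b c :: real
  assumes "\<And>t. a + 2 * b * t + c * t\<^sup>2 \<ge> 0" and "c \<ge> 0"
  shows "b\<^sup>2 \<le> a * c"
proof (cases "c = 0")
  case True
  have "b = 0"
  proof (rule ccontr)
    assume "b \<noteq> 0"
    with assms(1)[of "- (a + 1) / (2 * b)"] True show False by simp
  qed
  with True show ?thesis by simp
next
  case False
  with \<open>c \<ge> 0\<close> False have c: "c > 0" by simp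
  have "a + 2 * b * (- b / c) + c * (- b / c)\<^sup>2 = a - b\<^sup>2 / c"
    using c by (simp add: field_simps power2_eq_square)
  with assms(1)[of "- b / c"] have "b\<^sup>2 / c \<le> a" by simp
  then show ?thesis using c by (simp add: field_simps)
qed

text \<open>Every 2-by-2 principal minor is nonnegative; summing these inequalities bounds the norm.\<close>

lemma fnorm_le_mtrace:
  assumes "positive_semidefinite n A"
  shows "fnorm A \<le> mtrace A"
proof -
  have A: "A \<in> carrier_mat n n" and sym: "A\<^sup>T = A"
    and pos: "\<And>v. v \<in> carrier_vec n \<Longrightarrow> v \<bullet> (A *\<^sub>v v) \<ge> 0"
    using assms by (auto simp: positive_semidefinite_def)
  have ent: "unit_vec n i \<bullet> (A *\<^sub>v unit_vec n j) = A $$ (i, j)" if "i < n" "j < n" for i j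
    using A that by simp
  have diag: "A $$ (i, i) \<ge> 0" if "i < n" for i
    using pos[of "unit_vec n i"] that ent[OF that that] by simp
  have minor: "(A $$ (i, j))\<^sup>2 \<le> A $$ (i, i) * A $$ (j, j)" if i: "i < n" and j: "j < n" for i j
  proof (rule quadratic_nonneg_discriminant[OF _ diag[OF j]])
    \<comment> \<open>The quadratic form along \<open>e_i + t e_j\<close> is a polynomial in
      \<open>t\<close> whose discriminant condition is the inequality for the minor.\<close>
    fix t :: real
    let ?u = "unit_vec n i" and ?v = "unit_vec n j"
    have Ac: "A *\<^sub>v x \<in> carrier_vec n" if "x \<in> carrier_vec n" for x using A that by simp
    have "A $$ (j, i) = A $$ (i, j)" using A sym i j by (metis carrier_matD index_transpose_mat(1))
    moreover have "A *\<^sub>v (?u + t \<cdot>\<^sub>v ?v) = A *\<^sub>v ?u + t \<cdot>\<^sub>v (A *\<^sub>v ?v)"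
      by (simp add: mult_add_distrib_mat_vec[OF A] mult_mat_vec[OF A])
    moreover have "(?u + t \<cdot>\<^sub>v ?v) \<bullet> (a + t \<cdot>\<^sub>v b) = ?u \<bullet> a + t * (?u \<bullet> b) + t * (?v \<bullet> a) + t * t * (?v \<bullet> b)"
      if "a \<in> carrier_vec n" "b \<in> carrier_vec n" for a b :: rvec
      using that by (simp add: add_scalar_prod_distrib[of _ n] scalar_prod_add_distrib[of _ n] ring_distribs
          del: scalar_prod_left_unit)
    ultimately have "(?u + t \<cdot>\<^sub>v ?v) \<bullet> (A *\<^sub>v (?u + t \<cdot>\<^sub>v ?v))
      = A $$ (i, i) + 2 * A $$ (i, j) * t + A $$ (j, j) * t\<^sup>2"
      by (simp only: Ac unit_vec_carrier ent i j power2_eq_square) simp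
    moreover have "(?u + t \<cdot>\<^sub>v ?v) \<bullet> (A *\<^sub>v (?u + t \<cdot>\<^sub>v ?v)) \<ge> 0" by (rule pos) simp
    ultimately show "0 \<le> A $$ (i, i) + 2 * A $$ (i, j) * t + A $$ (j, j) * t\<^sup>2" by linarith
  qed
  have tr: "mtrace A = (\<Sum>i<n. A $$ (i, i))" using A by (simp add: mtrace_def)
  show ?thesis
  proof (rule power2_le_imp_le)
    have "(fnorm A)\<^sup>2 = (\<Sum>i<n. \<Sum>j<n. (A $$ (i, j))\<^sup>2)"
      using A by (simp add: fnorm_def sum_nonneg)
    also have "\<dots> \<le> (\<Sum>i<n. \<Sum>j<n. A $$ (i, i) * A $$ (j, j))"
      by (intro sum_mono minor) auto
    also have "\<dots> = (mtrace A)\<^sup>2"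
      by (simp add: tr power2_eq_square sum_product)
    finally show "(fnorm A)\<^sup>2 \<le> (mtrace A)\<^sup>2" .
    show "0 \<le> mtrace A" unfolding tr using diag by (intro sum_nonneg) auto
  qed
qed

section \<open>Local norms on symmetric matrices\<close>

lemma inv_sqrt_mat:
  assumes "positive_definite n X"
  shows "inv_sqrt_mat X \<in> carrier_mat n n" "(inv_sqrt_mat X)\<^sup>T = inv_sqrt_mat X"
    "inv_sqrt_mat X * inv_sqrt_mat X * X = 1\<^sub>m n"
proof -
  have [simp]: "dim_row X = n" using assms by (auto simp: positive_definite_def)
  define P where "P R \<longleftrightarrow> R \<in> carrier_mat n n \<and> R\<^sup>T = R \<and>
    (\<forall>v\<in>carrier_vec n. v \<bullet> (R *\<^sub>v v) \<ge> 0) \<and> R * R * X = 1\<^sub>m n" for R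
  have "\<exists>R. P R"
    unfolding P_def using positive_definite_inverse_sqrt[OF assms] by metis
  then have "P (SOME R. P R)" by (rule someI_ex)
  moreover have "inv_sqrt_mat X = (SOME R. P R)"
    by (simp add: inv_sqrt_mat_def P_def[abs_def])
  ultimately show "inv_sqrt_mat X \<in> carrier_mat n n" "(inv_sqrt_mat X)\<^sup>T = inv_sqrt_mat X"
    "inv_sqrt_mat X * inv_sqrt_mat X * X = 1\<^sub>m n"
    by (auto simp: P_def)
qed

lemma positive_definite_det_pos:
  assumes "positive_definite n X"
  shows "Determinant.det X > 0"
proof -
  let ?R = "inv_sqrt_mat X"
  note R = inv_sqrt_mat[OF assms]
  have X: "X \<in> carrier_mat n n" using assms by (simp add: positive_definite_def)
  have "Determinant.det (?R * ?R * X) = Determinant.det ?R * Determinant.det ?R * Determinant.det X"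
    using det_mult[OF mult_carrier_mat[OF R(1) R(1)] X] det_mult[OF R(1) R(1)] by simp
  then have "Determinant.det ?R * Determinant.det ?R * Determinant.det X = 1" using R(3) by simp
  then show ?thesis
    using mult_nonneg_nonpos[of "Determinant.det ?R * Determinant.det ?R" "Determinant.det X"]
    by (cases "Determinant.det X > 0") simp_all
qed

text \<open>Here \<open>W\<close> is an inverse square root of \<open>X\<close>, so that \<open>W * Y * W\<close> expresses a symmetric
  matrix \<open>Y\<close> in coordinates where \<open>X\<close> becomes the identity.\<close>

locale root_mat =
  fixes n :: nat and X W :: rmat
  assumes X [simp]: "X \<in> carrier_mat n n" and W [simp]: "W \<in> carrier_mat n n"
    and X_sym: "X\<^sup>T = X" and W_sym: "W\<^sup>T = W" and W_W_X: "W * (W * X) = 1\<^sub>m n"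
begin

lemmas assoc [simp] = assoc_mult_mat[of _ n n _ n _ n]
lemmas carr [simp] = mult_carrier_mat[of _ n n _ n]
lemmas assocv [simp] = assoc_mult_mat_vec[of _ n n _ n]
lemmas carrv [simp] = mult_mat_vec_carrier[of _ n n]

lemmas transpose_mult_sq = transpose_mult[of "_ :: rmat" n n _ n]

text \<open>\<open>T\<close> is the square root of \<open>X\<close>, inverse to \<open>W\<close>,
  and \<open>N\<close> is the inverse of \<open>X\<close>. Both are products of \<open>W\<close> and
  \<open>X\<close>, so a single choice of a root underlies all of them.\<close>

definition T where "T = W * X"
definition N where "N = W * W"

lemma T [simp]: "T \<in> carrier_mat n n" by (simp add: T_def)
lemma N [simp]: "N \<in> carrier_mat n n" by (simp add: N_def)

lemma W_T: "W * T = 1\<^sub>m n" by (simp add: T_def W_W_X)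

lemma T_W: "T * W = 1\<^sub>m n"
  using mat_mult_left_right_inverse[OF W T W_T] .

text \<open>\<open>W\<close> commutes with \<open>X\<close>: the one-sided inverse
  \<open>W * T = 1\<close> is two-sided for square matrices, and \<open>T * W = 1\<close> is then
  inserted in front of \<open>X * W\<close>.\<close>

lemma X_W: "X * W = T"
proof -
  have "X * W = (T * W) * (X * W)" unfolding T_W by (simp add: left_mult_one_mat[of _ n n])
  also have "\<dots> = T * (T * W)" by (simp add: T_def)
  also have "\<dots> = T" unfolding T_W by (simp add: right_mult_one_mat[of _ n n])
  finally show ?thesis .
qed

lemma T_T: "T * T = X"
proof -
  have "T * T = X * (W * T)" by (simp flip: X_W)
  then show ?thesis unfolding W_T by (simp add: right_mult_one_mat[of _ n n])
qed

lemma T_sym: "T\<^sup>T = T"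
  unfolding T_def by (simp add: transpose_mult_sq X_sym W_sym) (simp add: X_W flip: T_def)

lemma N_sym: "N\<^sup>T = N"
  by (simp add: N_def transpose_mult_sq W_sym)

lemma N_X: "N * X = 1\<^sub>m n" by (simp add: N_def W_W_X)

lemma X_N: "X * N = 1\<^sub>m n"
  using mat_mult_left_right_inverse[OF N X N_X] .

text \<open>Products are normalised to the right by \<open>assoc\<close>, so an equation such as
  \<open>W * T = 1\<close> does not match inside a longer product. These variants with a trailing
  factor do.\<close>

lemma cancel:
  assumes "Y \<in> carrier_mat n n"
  shows "W * (T * Y) = Y" "T * (W * Y) = Y" "N * (X * Y) = Y" "X * (N * Y) = Y"
    "T * (T * Y) = X * Y" "W * (W * Y) = N * Y"
proof -
  have one: "1\<^sub>m n * Y = Y" using assms by (rule left_mult_one_mat)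
  note a = assoc[OF _ _ assms, symmetric]
  show "W * (T * Y) = Y" "T * (W * Y) = Y" "N * (X * Y) = Y" "X * (N * Y) = Y"
    "T * (T * Y) = X * Y" "W * (W * Y) = N * Y"
    by (simp_all only: a W T X N W_T T_W N_X X_N T_T one flip: N_def)
qed

lemma mtrace_cyclic:
  assumes "A \<in> carrier_mat n n" "B \<in> carrier_mat n n"
  shows "mtrace (A * B) = mtrace (B * A)"
  by (rule mtrace_comm[OF assms])

text \<open>Cyclicity of the trace joins the factors \<open>W\<close> in pairs, so the scaled norm
  depends on the inverse \<open>N\<close> alone. The right-hand side is the form in which the
  Hessian of the log-determinant appears.\<close>

lemma fnorm_scaled_sq:
  assumes Y: "Y \<in> carrier_mat n n" and sym: "Y\<^sup>T = Y"
  shows "(fnorm (W * Y * W))\<^sup>2 = mtrace (N * (Y * (N * Y)))"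
proof -
  have "(fnorm (W * Y * W))\<^sup>2 = mtrace (W * (Y * (N * (Y * W))))"
    using Y by (simp add: fnorm_sq[of _ n n] transpose_mult_sq sym W_sym cancel)
  also have "\<dots> = mtrace (Y * (N * (Y * W)) * W)"
    using Y by (intro mtrace_cyclic) simp_all
  also have "\<dots> = mtrace ((Y * (N * Y)) * N)" using Y by (simp add: N_def)
  also have "\<dots> = mtrace (N * (Y * (N * Y)))" using Y by (intro mtrace_cyclic) simp_all
  finally show ?thesis .
qed

lemma abs_mtrace_le_scaled:
  assumes Y: "Y \<in> carrier_mat n n" "Y\<^sup>T = Y" and Z: "Z \<in> carrier_mat n n" "Z\<^sup>T = Z"
  shows "\<bar>mtrace (N * (Y * (N * Z)))\<bar> \<le> fnorm (W * Y * W) * fnorm (W * Z * W)"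
proof -
  have "mtrace (N * (Y * (N * Z))) = mtrace (W * (W * (Y * (N * Z))))"
    using Y Z by (simp add: N_def)
  also have "\<dots> = mtrace ((W * (Y * (N * Z))) * W)"
    using Y Z by (intro mtrace_cyclic) simp_all
  also have "\<dots> = mtrace ((W * Y * W) * (W * Z * W))"
    using Y Z by (simp add: N_def)
  finally show ?thesis using mtrace_mult_le_fnorm[of "W * Y * W" n n "W * Z * W"] Y Z by simp
qed

text \<open>Congruence by \<open>W\<close> preserves semidefiniteness, and for semidefinite matrices
  the Frobenius norm is at most the trace. In barrier terms: on the cone the local norm is bounded
  by minus the gradient.\<close>

lemma scaled_norm_le_mtrace:
  assumes "positive_semidefinite n Y"
  shows "fnorm (W * Y * W) \<le> mtrace (N * Y)"
proof -
  have Y: "Y \<in> carrier_mat n n" and sym: "Y\<^sup>T = Y"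
    using assms by (auto simp: positive_semidefinite_def)
  have "positive_semidefinite n (W * Y * W)"
    unfolding positive_semidefinite_def
  proof (intro conjI ballI)
    fix v :: rvec assume v: "v \<in> carrier_vec n"
    have "v \<bullet> ((W * Y * W) *\<^sub>v v) = (W *\<^sub>v v) \<bullet> (Y *\<^sub>v (W *\<^sub>v v))"
      using transpose_swap_scalar_prod[OF W, of "Y *\<^sub>v (W *\<^sub>v v)" v] v Y by (simp add: W_sym)
    also have "\<dots> \<ge> 0" using assms v by (auto simp: positive_semidefinite_def)
    finally show "v \<bullet> ((W * Y * W) *\<^sub>v v) \<ge> 0" .
  qed (use Y in \<open>simp_all add: transpose_mult_sq sym W_sym\<close>)
  from fnorm_le_mtrace[OF this] have "fnorm (W * Y * W) \<le> mtrace (W * (Y * W))" using Y by simp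
  also have "\<dots> = mtrace (Y * W * W)" using Y by (intro mtrace_cyclic) simp_all
  also have "\<dots> = mtrace (N * Y)" using Y mtrace_cyclic[of Y N] by (simp add: N_def)
  finally show ?thesis .
qed

text \<open>\<open>X + H = T * (1 + D) * T\<close> with \<open>D = W * H * W\<close>, and
  \<open>1 + D\<close> is positive definite because the quadratic form of \<open>D\<close> is at
  most \<open>fnorm D < 1\<close> times \<open>u \<bullet> u\<close>. This is the inclusion of the
  Dikin ellipsoid in the domain.\<close>

lemma positive_definite_perturb:
  assumes H: "H \<in> carrier_mat n n" "H\<^sup>T = H" and lt: "fnorm (W * H * W) < 1"
  shows "positive_definite n (X + H)"
  unfolding positive_definite_def
proof (intro conjI ballI impI)
  fix v :: rvec assume v: "v \<in> carrier_vec n" "v \<noteq> 0\<^sub>v n"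
  define u where "u = T *\<^sub>v v"
  define D where "D = W * H * W"
  have D: "D \<in> carrier_mat n n" using H by (simp add: D_def)
  have u: "u \<in> carrier_vec n" using v by (simp add: u_def)
  have Wu: "W *\<^sub>v u = v"
    using v by (simp add: u_def W_T flip: assocv)
  have "u \<noteq> 0\<^sub>v n"
  proof
    assume "u = 0\<^sub>v n"
    then have "v = W *\<^sub>v 0\<^sub>v n" using Wu by simp
    also have "\<dots> = 0\<^sub>v n" by (intro eq_vecI) (simp_all add: carrier_matD[OF W] row_carrier_vec[OF _ W])
    finally show False using v by simp
  qed
  then have uu: "u \<bullet> u > 0" using scalar_prod_self_pos[OF u] by simp
  have "X + H = T * (1\<^sub>m n + D) * T"
  proof -
    have "T * (1\<^sub>m n + D) * T = (T + T * D) * T"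
      using D by (simp add: mult_add_distrib_mat[of _ n n _ n] right_mult_one_mat[of _ n n])
    also have "\<dots> = T * T + T * D * T"
      using D by (simp add: add_mult_distrib_mat[of _ n n _ _ n] del: assoc)
    also have "T * D * T = H"
      using H by (simp add: D_def cancel W_T right_mult_one_mat[of _ n n])
    finally show ?thesis by (simp add: T_T)
  qed
  then have "v \<bullet> ((X + H) *\<^sub>v v) = v \<bullet> (T *\<^sub>v ((1\<^sub>m n + D) *\<^sub>v u))"
    using v D by (simp add: u_def)
  also have "\<dots> = u \<bullet> ((1\<^sub>m n + D) *\<^sub>v u)"
    using transpose_swap_scalar_prod[OF T, of "(1\<^sub>m n + D) *\<^sub>v u" v] v u D by (simp add: T_sym u_def)
  also have "\<dots> = u \<bullet> u + u \<bullet> (D *\<^sub>v u)"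
    using u D by (simp add: add_mult_distrib_mat_vec[of _ n n] scalar_prod_add_distrib[of _ n])
  also have "\<dots> \<ge> u \<bullet> u - fnorm D * (u \<bullet> u)"
    using scalar_prod_mult_mat_le_fnorm[OF D u] by linarith
  also have "u \<bullet> u - fnorm D * (u \<bullet> u) = (1 - fnorm D) * (u \<bullet> u)" by (simp add: algebra_simps)
  finally show "v \<bullet> ((X + H) *\<^sub>v v) > 0"
    using uu lt by (smt (verit) D_def mult_pos_pos)
qed (use H in \<open>simp_all add: transpose_add[of _ n n] X_sym\<close>)

end

text \<open>Two base points at once: names prefixed with \<open>p\<close> refer to
  \<open>X + H\<close> and its root \<open>W'\<close>, unprefixed ones to \<open>X\<close> and
  \<open>W\<close>.\<close>

locale two_root_mats = root_mat + p: root_mat n "X + H" W' for H W' +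
  assumes H [simp]: "H \<in> carrier_mat n n" and H_sym: "H\<^sup>T = H"
begin

text \<open>\<open>C = W * p.T\<close> changes coordinates between the two base points and satisfies
  \<open>C * C\<^sup>T = 1 + D\<close>. Hence its operator norm is at most
  \<open>sqrt (1 + \<delta>)\<close>, and it occurs twice in
  \<open>W * Y * W = C * Y' * C\<^sup>T\<close>.\<close>

lemma scaled_norm_le:
  assumes Y: "Y \<in> carrier_mat n n" and Y_sym: "Y\<^sup>T = Y"
  shows "fnorm (W * Y * W) \<le> (1 + fnorm (W * H * W)) * fnorm (W' * Y * W')"
proof -
  define D where "D = W * H * W"
  define C where "C = W * p.T"
  define Y' where "Y' = W' * Y * W'"
  define \<delta> where "\<delta> = fnorm D"
  have \<delta>: "\<delta> \<ge> 0" by (simp add: \<delta>_def)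
  have D [simp]: "D \<in> carrier_mat n n" by (simp add: D_def)
  have C [simp]: "C \<in> carrier_mat n n" by (simp add: C_def)
  have Y' [simp]: "Y' \<in> carrier_mat n n" using Y by (simp add: Y'_def)
  have Ct: "C\<^sup>T = p.T * W" by (simp add: C_def transpose_mult_sq W_sym p.T_sym)
  have "C * C\<^sup>T = W * ((X + H) * W)"
    by (simp only: Ct) (simp add: C_def p.cancel)
  also have "\<dots> = W * (X * W) + W * (H * W)"
    by (simp add: add_mult_distrib_mat[of _ n n _ _ n] mult_add_distrib_mat[of _ n n _ n])
  also have "\<dots> = 1\<^sub>m n + D" by (simp add: X_W W_T D_def)
  finally have CCt: "C * C\<^sup>T = 1\<^sub>m n + D" .
  have CtC: "(C\<^sup>T *\<^sub>v u) \<bullet> (C\<^sup>T *\<^sub>v u) \<le> (1 + \<delta>) * (u \<bullet> u)" if u: "u \<in> carrier_vec n" for u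
  proof -
    have "(C\<^sup>T *\<^sub>v u) \<bullet> (C\<^sup>T *\<^sub>v u) = u \<bullet> (C *\<^sub>v (C\<^sup>T *\<^sub>v u))"
      using transpose_swap_scalar_prod[OF C, of "C\<^sup>T *\<^sub>v u" u] u by simp
    also have "\<dots> = u \<bullet> ((1\<^sub>m n + D) *\<^sub>v u)" using u by (simp flip: CCt)
    also have "\<dots> = u \<bullet> u + u \<bullet> (D *\<^sub>v u)"
      using u by (simp add: add_mult_distrib_mat_vec[of _ n n] scalar_prod_add_distrib[of _ n])
    also have "\<dots> \<le> (1 + \<delta>) * (u \<bullet> u)"
      using scalar_prod_mult_mat_le_fnorm[OF D u] by (simp add: \<delta>_def algebra_simps)
    finally show ?thesis .
  qed
  \<comment> \<open>Passage from \<open>C\<^sup>T\<close> to \<open>C\<close>: with \<open>a\<close>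
    the squared length of \<open>C v\<close>, Cauchy-Schwarz gives
    \<open>a\<^sup>2 \<le> (1 + \<delta>) * a * (v \<bullet> v)\<close>, and \<open>a\<close>
    cancels.\<close>
  have bound: "(C *\<^sub>v v) \<bullet> (C *\<^sub>v v) \<le> (sqrt (1 + \<delta>))\<^sup>2 * (v \<bullet> v)" if v: "v \<in> carrier_vec n" for v
  proof -
    define a where "a = (C *\<^sub>v v) \<bullet> (C *\<^sub>v v)"
    have a: "a \<ge> 0" by (simp add: a_def)
    have "a = (C\<^sup>T *\<^sub>v (C *\<^sub>v v)) \<bullet> v"
      unfolding a_def using transpose_swap_scalar_prod[OF C v, of "C *\<^sub>v v"] v by simp
    then have "a\<^sup>2 \<le> ((C\<^sup>T *\<^sub>v (C *\<^sub>v v)) \<bullet> (C\<^sup>T *\<^sub>v (C *\<^sub>v v))) * (v \<bullet> v)"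
      using Cauchy_Schwarz_scalar_prod[of "C\<^sup>T *\<^sub>v (C *\<^sub>v v)" n v] v by simp
    also have "\<dots> \<le> ((1 + \<delta>) * a) * (v \<bullet> v)"
      unfolding a_def using v by (intro mult_right_mono CtC) simp_all
    finally have "a * a \<le> a * ((1 + \<delta>) * (v \<bullet> v))" by (simp add: power2_eq_square ac_simps)
    then have "a \<le> (1 + \<delta>) * (v \<bullet> v)"
      using a \<delta> by (cases "a = 0") (auto simp: mult_le_cancel_left)
    then show ?thesis using \<delta> by (simp add: a_def)
  qed
  have "W * Y * W = C * (Y' * C\<^sup>T)"
    using Y by (simp add: Ct) (simp add: C_def Y'_def p.cancel)
  then have "fnorm (W * Y * W) \<le> sqrt (1 + \<delta>) * fnorm (Y' * C\<^sup>T)"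
    using fnorm_mult_le_of_vec[OF C _ bound, of "Y' * C\<^sup>T" n] \<delta> by simp
  also have "fnorm (Y' * C\<^sup>T) = fnorm (C * Y'\<^sup>T)"
    by (subst fnorm_transpose[symmetric]) (simp add: transpose_mult_sq)
  also have "\<dots> \<le> sqrt (1 + \<delta>) * fnorm (Y'\<^sup>T)"
    using fnorm_mult_le_of_vec[OF C _ bound, of "Y'\<^sup>T" n] \<delta> by simp
  finally have "fnorm (W * Y * W) \<le> sqrt (1 + \<delta>) * (sqrt (1 + \<delta>) * fnorm Y')"
    using \<delta> by (simp add: mult_left_mono)
  then show ?thesis
    using \<delta> by (simp add: Y'_def \<delta>_def D_def flip: mult.assoc)
qed

text \<open>In coordinates for \<open>X + H\<close> the remainder has the same Frobenius norm as \<open>(W * H * W)\<^sup>2\<close>, because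
  \<open>M\<close> satisfies \<open>(X + H) * M = M\<^sup>T * (X + H)\<close>.  So no factor \<open>1 / (1 - \<delta>)\<close> appears.\<close>

lemma inverse_taylor_error:
  assumes Y: "Y \<in> carrier_mat n n" and Y_sym: "Y\<^sup>T = Y"
  shows "\<bar>mtrace (p.N * Y) - mtrace (N * Y) + mtrace (N * (H * (N * Y)))\<bar>
    \<le> (fnorm (W * H * W))\<^sup>2 * fnorm (W' * Y * W')"
proof -
  define D where "D = W * H * W"
  define Y' where "Y' = W' * Y * W'"
  define M where "M = N * (H * (N * H))"
  define Q where "Q = p.T * (M * W')"
  have D [simp]: "D \<in> carrier_mat n n" by (simp add: D_def)
  have M [simp]: "M \<in> carrier_mat n n" by (simp add: M_def)
  have Q [simp]: "Q \<in> carrier_mat n n" by (simp add: Q_def)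
  have Y' [simp]: "Y' \<in> carrier_mat n n" using Y by (simp add: Y'_def)
  \<comment> \<open>Resolvent identity \<open>N = p.N + N * H * p.N\<close>, in a form with a
    trailing factor.\<close>
  have res: "N * Z = p.N * Z + N * (H * (p.N * Z))" if Z: "Z \<in> carrier_mat n n" for Z
  proof -
    have "N * Z = N * ((X + H) * (p.N * Z))" using Z by (simp add: p.cancel)
    also have "\<dots> = p.N * Z + N * (H * (p.N * Z))"
      using Z by (simp add: add_mult_distrib_mat[of _ n n _ _ n] mult_add_distrib_mat[of _ n n _ n] cancel)
    finally show ?thesis .
  qed
  \<comment> \<open>Using the identity twice leaves exactly \<open>N * H * N * H * p.N * Y\<close>,
    an exact remainder with two explicit factors \<open>H\<close>.\<close>
  have "N * (H * (N * Y)) = N * (H * (p.N * Y)) + N * (H * (N * (H * (p.N * Y))))"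
    by (subst res[OF Y]) (use Y in \<open>simp add: mult_add_distrib_mat[of _ n n _ n]\<close>)
  then have "mtrace (p.N * Y) - mtrace (N * Y) + mtrace (N * (H * (N * Y)))
      = mtrace (M * (p.N * Y))"
    using Y by (subst res[OF Y]) (simp add: mtrace_add[of _ n] M_def)
  also have "M * (p.N * Y) = (M * (W' * Y')) * p.T"
    using Y by (simp add: Y'_def p.W_T p.cancel right_mult_one_mat[of _ n n])
  also have "mtrace \<dots> = mtrace (Q * Y')"
    by (subst mtrace_cyclic) (simp_all add: Q_def)
  also have "\<bar>mtrace (Q * Y')\<bar> \<le> fnorm Q * fnorm Y'"
    by (rule mtrace_mult_le_fnorm[OF Q Y'])
  also have "fnorm Q = fnorm (D * D)"
  proof -
    have Mt: "M\<^sup>T = H * (N * (H * N))"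
      by (simp add: M_def transpose_mult_sq N_sym H_sym)
    have comm: "(X + H) * M = M\<^sup>T * (X + H)"
    proof -
      have "(X + H) * M = H * (N * H) + H * (N * (H * (N * H)))"
        by (simp add: add_mult_distrib_mat[of _ n n _ _ n] M_def cancel)
      also have "\<dots> = M\<^sup>T * (X + H)"
        by (simp add: mult_add_distrib_mat[of _ n n _ n] Mt N_X right_mult_one_mat[of _ n n])
      finally show ?thesis .
    qed
    have "(fnorm Q)\<^sup>2 = mtrace (p.T * (M * (p.N * (M\<^sup>T * p.T))))"
      by (simp add: fnorm_sq[of _ n n] Q_def transpose_mult_sq p.T_sym p.W_sym p.cancel)
    also have "\<dots> = mtrace ((M * (p.N * (M\<^sup>T * p.T))) * p.T)" by (rule mtrace_cyclic) simp_all
    also have "\<dots> = mtrace ((M * (p.N * M\<^sup>T)) * (X + H))" by (simp add: p.T_T)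
    also have "\<dots> = mtrace ((X + H) * (M * (p.N * M\<^sup>T)))" by (rule mtrace_cyclic) simp_all
    also have "(X + H) * (M * (p.N * M\<^sup>T)) = ((X + H) * M) * (p.N * M\<^sup>T)"
      by (rule assoc[symmetric]) simp_all
    also have "\<dots> = M\<^sup>T * M\<^sup>T" unfolding comm by (simp add: p.cancel)
    \<comment> \<open>The product consists of four factors \<open>H * N\<close>; one
      \<open>W\<close> is split off at the end and moved to the front, which regroups it as the
      fourth power of \<open>D\<close>.\<close>
    also have "mtrace \<dots> = mtrace ((H * (N * (H * (N * (H * (N * (H * W))))))) * W)"
      by (simp add: Mt N_def)
    also have "\<dots> = mtrace (W * (H * (N * (H * (N * (H * (N * (H * W))))))))"
      by (rule mtrace_cyclic) simp_all
    also have "\<dots> = (fnorm (D * D))\<^sup>2"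
      by (simp add: fnorm_sq[of _ n n] D_def transpose_mult_sq H_sym W_sym N_def)
    finally show ?thesis by simp
  qed
  also have "fnorm (D * D) * fnorm Y' \<le> (fnorm D)\<^sup>2 * fnorm Y'"
    unfolding power2_eq_square by (intro mult_right_mono fnorm_mult_le[OF D D]) simp_all
  finally show ?thesis by (simp add: D_def Y'_def)
qed

end

section \<open>The log-determinant barrier\<close>

text \<open>Only the identity permutation contributes to the linear term of the Leibniz expansion,
  since every other permutation moves at least two points.\<close>

lemma has_real_derivative_det_one_plus:
  fixes A :: rmat
  assumes A: "A \<in> carrier_mat n n"
  shows "((\<lambda>t. Determinant.det (1\<^sub>m n + t \<cdot>\<^sub>m A)) has_real_derivative mtrace A) (at 0)"
proof -
  let ?S = "{p. p permutes {0..<n}}"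
  let ?d = "\<lambda>i j. if i = j then 1 else 0 :: real"
  let ?D = "\<lambda>p. \<Sum>i\<in>{0..<n}. A $$ (i, p i) * (\<Prod>j\<in>{0..<n} - {i}. ?d j (p j))"
  have perm: "p i < n" if "p \<in> ?S" "i \<in> {0..<n}" for p i
    using that permutes_in_image[of p "{0..<n}" i] by simp
  have eq: "Determinant.det (1\<^sub>m n + t \<cdot>\<^sub>m A)
    = (\<Sum>p\<in>?S. signof p * (\<Prod>i\<in>{0..<n}. ?d i (p i) + t * A $$ (i, p i)))" for t
  proof -
    have "1\<^sub>m n + t \<cdot>\<^sub>m A \<in> carrier_mat n n" using A by simp
    from det_def'[OF this] show ?thesis
      using A perm by (auto intro!: sum.cong prod.cong arg_cong2[of _ _ _ _ "(*)"])
  qed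
  have "((\<lambda>t. \<Sum>p\<in>?S. signof p * (\<Prod>i\<in>{0..<n}. ?d i (p i) + t * A $$ (i, p i)))
      has_real_derivative (\<Sum>p\<in>?S. signof p * (\<Sum>i\<in>{0..<n}. A $$ (i, p i) *
        (\<Prod>j\<in>{0..<n} - {i}. ?d j (p j) + 0 * A $$ (j, p j))))) (at 0)"
    by (intro DERIV_sum DERIV_cmult has_field_derivative_prod) (auto intro!: derivative_eq_intros)
  also have "(\<Sum>p\<in>?S. signof p * (\<Sum>i\<in>{0..<n}. A $$ (i, p i) *
        (\<Prod>j\<in>{0..<n} - {i}. ?d j (p j) + 0 * A $$ (j, p j)))) = (\<Sum>p\<in>?S. signof p * ?D p)"
    by simp
  also have "\<dots> = (\<Sum>p\<in>{id}. signof p * ?D p)"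
  proof (rule sum.mono_neutral_right)
    show "finite ?S" by (simp add: finite_permutations)
    show "{id} \<subseteq> ?S" by (simp add: permutes_id)
    show "\<forall>p\<in>?S - {id}. signof p * ?D p = 0"
    proof
      fix p assume p: "p \<in> ?S - {id}"
      then obtain a where a: "p a \<noteq> a" by fastforce
      have pp: "p permutes {0..<n}" using p by simp
      have an: "a < n" using a pp by (metis atLeastLessThan_iff permutes_not_in zero_le)
      have b: "p (p a) \<noteq> p a" using a pp by (metis permutes_inverses(2))
      have bn: "p a < n" using perm[of p a] p an by simp
      have "(\<Prod>j\<in>{0..<n} - {i}. ?d j (p j)) = 0" for i
      proof (cases "i = a")
        case True
        with a b bn show ?thesis by (intro prod_zero bexI[of _ "p a"]) auto
      next
        case False
        with a an show ?thesis by (intro prod_zero bexI[of _ a]) auto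
      qed
      then show "signof p * ?D p = 0" by simp
    qed
  qed
  also have "\<dots> = mtrace A"
    using A by (simp add: mtrace_def lessThan_atLeast0)
  finally show ?thesis by (simp add: eq)
qed

text \<open>Turns a Taylor estimate into a derivative. The Hessian is obtained in this way from
  \<open>mtrace_Linv_taylor\<close>, so that the matrix inverse itself is never
  differentiated.\<close>

lemma has_real_derivative_quadratic_error:
  fixes g :: "real \<Rightarrow> real"
  assumes "r > 0" and err: "\<And>t. \<bar>t\<bar> < r \<Longrightarrow> \<bar>g t - g 0 - t * d\<bar> \<le> C * t\<^sup>2"
  shows "(g has_real_derivative d) (at 0)"
  unfolding has_field_derivative_iff
proof -
  have "((\<lambda>t. (g t - g 0) / (t - 0) - d) \<longlongrightarrow> 0) (at 0)"
  proof (rule Lim_null_comparison)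
    have "eventually (\<lambda>t. \<bar>t\<bar> < r \<and> t \<noteq> 0) (at 0)"
      unfolding eventually_at using \<open>r > 0\<close> by (auto intro!: exI[of _ r])
    then show "eventually (\<lambda>t. norm ((g t - g 0) / (t - 0) - d) \<le> C * \<bar>t\<bar>) (at 0)"
    proof eventually_elim
      case (elim t)
      then have "(g t - g 0) / (t - 0) - d = (g t - g 0 - t * d) / t" by (simp add: field_simps)
      also have "\<bar>\<dots>\<bar> \<le> C * t\<^sup>2 / \<bar>t\<bar>"
        unfolding abs_divide using err[of t] elim by (intro divide_right_mono) auto
      also have "\<dots> = C * \<bar>t\<bar>" using elim by (simp add: power2_eq_square field_simps)
      finally show ?case by simp
    qed
    show "((\<lambda>t. C * \<bar>t\<bar>) \<longlongrightarrow> 0) (at 0)"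
      by (auto intro!: tendsto_eq_intros)
  qed
  then show "((\<lambda>y. (g y - g 0) / (y - 0)) \<longlongrightarrow> d) (at 0)"
    by (rule LIM_zero_cancel)
qed

definition pencil :: "nat \<Rightarrow> nat \<Rightarrow> (nat \<Rightarrow> rmat) \<Rightarrow> rvec \<Rightarrow> rmat" where
  "pencil m M E x = Matrix.mat M M (\<lambda>ij. \<Sum>u<m. x $ u * E u $$ ij)"

text \<open>The setting without polynomials: a linear symmetric pencil and minus the logarithm of
  its determinant. \<open>pencil_inj\<close> makes the Hessian definite. The formula for
  \<open>f\<close> is prescribed only where the pencil is positive definite, because elsewhere a sum
  of two logarithms, such as the one in \<open>barrier_ext\<close>, need not agree with the
  logarithm of the product.\<close>

locale logdet_barrier =
  fixes m M :: nat and E :: "nat \<Rightarrow> rmat" and f :: "rvec \<Rightarrow> real"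
  assumes E_sym: "u < m \<Longrightarrow> i < M \<Longrightarrow> j < M \<Longrightarrow> E u $$ (j, i) = E u $$ (i, j)"
    and pencil_inj: "x \<in> carrier_vec m \<Longrightarrow> pencil m M E x = 0\<^sub>m M M \<Longrightarrow> x = 0\<^sub>v m"
    and f_eq: "x \<in> carrier_vec m \<Longrightarrow> positive_definite M (pencil m M E x) \<Longrightarrow>
      f x = - ln (Determinant.det (pencil m M E x))"
begin

abbreviation "L \<equiv> pencil m M E"

lemma L [simp]: "L x \<in> carrier_mat M M"
  by (simp add: pencil_def)

lemma dim_L_mat [simp]: "dim_row (L x) = M" "dim_col (L x) = M"
  by (simp_all add: pencil_def)

lemma L_sym: "(L x)\<^sup>T = L x"
  by (rule eq_matI) (simp_all add: pencil_def E_sym)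

lemma L_add: "x \<in> carrier_vec m \<Longrightarrow> y \<in> carrier_vec m \<Longrightarrow> L (x + y) = L x + L y"
  by (rule eq_matI) (simp_all add: pencil_def sum.distrib distrib_right)

lemma L_smult: "x \<in> carrier_vec m \<Longrightarrow> L (c \<cdot>\<^sub>v x) = c \<cdot>\<^sub>m L x"
  by (rule eq_matI) (simp_all add: pencil_def sum_distrib_left mult.assoc)

text \<open>Linearity in \<open>y\<close>, written in coordinates: it passes from the entries of
  gradient and Hessian, which belong to unit vectors, to arbitrary directions.\<close>

lemma mtrace_mult_L:
  assumes A: "A \<in> carrier_mat M M" and y: "y \<in> carrier_vec m"
  shows "mtrace (A * L y) = (\<Sum>u<m. y $ u * mtrace (A * L (unit_vec m u)))"
proof -
  have unit: "L (unit_vec m u) $$ (j, i) = E u $$ (j, i)" if "u < m" "i < M" "j < M" for u i j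
  proof -
    have "L (unit_vec m u) $$ (j, i) = (\<Sum>v<m. unit_vec m u $ v * E v $$ (j, i))"
      using that by (simp add: pencil_def)
    also have "\<dots> = (\<Sum>v<m. if v = u then E v $$ (j, i) else 0)"
      using that by (intro sum.cong) auto
    finally show ?thesis using that by simp
  qed
  have "mtrace (A * L y) = (\<Sum>i<M. \<Sum>j<M. \<Sum>u<m. y $ u * (A $$ (i, j) * E u $$ (j, i)))"
    by (simp add: mtrace_mult[OF A L]) (simp add: pencil_def sum_distrib_left mult.left_commute)
  also have "\<dots> = (\<Sum>i<M. \<Sum>u<m. \<Sum>j<M. y $ u * (A $$ (i, j) * E u $$ (j, i)))"
    by (intro sum.cong[OF refl] sum.swap)
  also have "\<dots> = (\<Sum>u<m. \<Sum>i<M. \<Sum>j<M. y $ u * (A $$ (i, j) * E u $$ (j, i)))"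
    by (rule sum.swap)
  also have "\<dots> = (\<Sum>u<m. y $ u * mtrace (A * L (unit_vec m u)))"
    by (intro sum.cong refl) (simp add: mtrace_mult[OF A L] sum_distrib_left unit)
  finally show ?thesis .
qed

definition dom :: "rvec set" where
  "dom = {x \<in> carrier_vec m. positive_definite M (L x)}"

text \<open>On \<open>dom\<close>, \<open>Lroot x\<close> and \<open>Linv x\<close> are the powers
  -1/2 and -1 of \<open>L x\<close>, and \<open>nrm x\<close> is the local norm at \<open>x\<close>;
  its agreement with the norm of the Hessian is \<open>H_quadratic\<close>.\<close>

definition Lroot :: "rvec \<Rightarrow> rmat" where "Lroot x = inv_sqrt_mat (L x)"
definition Linv :: "rvec \<Rightarrow> rmat" where "Linv x = Lroot x * Lroot x"
definition nrm :: "rvec \<Rightarrow> rvec \<Rightarrow> real" where "nrm x y = fnorm (Lroot x * L y * Lroot x)"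
definition g :: "rvec \<Rightarrow> rvec" where "g = gradient m f"
definition H :: "rvec \<Rightarrow> rmat" where "H = hessian m f"

section \<open>Domain of the barrier and change of the base point\<close>

lemma domD: "x \<in> dom \<Longrightarrow> x \<in> carrier_vec m" "x \<in> dom \<Longrightarrow> positive_definite M (L x)"
  by (auto simp: dom_def)

lemma root_mat: "x \<in> dom \<Longrightarrow> root_mat M (L x) (Lroot x)"
proof -
  assume "x \<in> dom"
  note i = inv_sqrt_mat[OF domD(2)[OF this], folded Lroot_def]
  have "Lroot x * (Lroot x * L x) = Lroot x * Lroot x * L x" by (rule assoc_mult_mat[symmetric, OF i(1) i(1) L])
  with i show ?thesis by unfold_locales (simp_all add: L_sym)
qed

lemma Linv_eq: "x \<in> dom \<Longrightarrow> Linv x = root_mat.N (Lroot x)"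
  by (simp add: Linv_def root_mat.N_def[OF root_mat])

lemma Linv_carrier: "x \<in> dom \<Longrightarrow> Linv x \<in> carrier_mat M M"
  using root_mat.N[OF root_mat] by (simp add: Linv_eq)

lemma nrm_nonneg [simp]: "nrm x y \<ge> 0" by (simp add: nrm_def)

lemma nrm_smult:
  assumes x: "x \<in> dom" and y: "y \<in> carrier_vec m"
  shows "nrm x (c \<cdot>\<^sub>v y) = \<bar>c\<bar> * nrm x y"
proof -
  interpret root_mat M "L x" "Lroot x" by (rule root_mat[OF x])
  have "Lroot x * (c \<cdot>\<^sub>m L y) * Lroot x = c \<cdot>\<^sub>m (Lroot x * L y * Lroot x)"
    by (simp add: mult_smult_distrib[of _ M M _ M] smult_smult_assoc mult_smult_assoc_mat[of _ M M _ M])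
  moreover have "fnorm (c \<cdot>\<^sub>m A) = \<bar>c\<bar> * fnorm A" for A
    by (simp add: fnorm_def power_mult_distrib real_sqrt_mult flip: sum_distrib_left)
  ultimately show ?thesis by (simp add: nrm_def L_smult[OF y])
qed

lemma dom_add:
  assumes x: "x \<in> dom" and h: "h \<in> carrier_vec m" and "nrm x h < 1"
  shows "x + h \<in> dom"
  using root_mat.positive_definite_perturb[OF root_mat[OF x] L L_sym, of h] assms domD(1)[OF x]
  by (simp add: dom_def L_add nrm_def)

lemma two_root_mats:
  assumes x: "x \<in> dom" and h: "h \<in> carrier_vec m" and xh: "x + h \<in> dom"
  shows "two_root_mats M (L x) (Lroot x) (L h) (Lroot (x + h))"
proof -
  interpret a: root_mat M "L x" "Lroot x" by (rule root_mat[OF x])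
  interpret b: root_mat M "L x + L h" "Lroot (x + h)"
    using root_mat[OF xh] by (simp add: L_add domD(1)[OF x] h)
  show ?thesis by unfold_locales (simp_all add: L_sym)
qed

lemma nrm_le:
  assumes "x \<in> dom" "h \<in> carrier_vec m" "x + h \<in> dom"
  shows "nrm x y \<le> (1 + nrm x h) * nrm (x + h) y"
  unfolding nrm_def by (rule two_root_mats.scaled_norm_le[OF two_root_mats[OF assms] L L_sym])

lemma mtrace_Linv_taylor:
  assumes "x \<in> dom" "h \<in> carrier_vec m" "x + h \<in> dom"
  shows "\<bar>mtrace (Linv (x + h) * L y) - mtrace (Linv x * L y) + mtrace (Linv x * (L h * (Linv x * L y)))\<bar>
    \<le> (nrm x h)\<^sup>2 * nrm (x + h) y"
proof -
  interpret two_root_mats M "L x" "Lroot x" "L h" "Lroot (x + h)" by (rule two_root_mats[OF assms])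
  show ?thesis using inverse_taylor_error[OF L L_sym] by (simp add: Linv_eq assms nrm_def)
qed

text \<open>The converse of \<open>nrm_le\<close>: apply it at \<open>x + h\<close> with the step \<open>- h\<close>, whose length at \<open>x + h\<close> is
  first bounded by the same inequality for \<open>y = h\<close>.\<close>

lemma nrm_ge:
  assumes x: "x \<in> dom" and h: "h \<in> carrier_vec m" and small: "nrm x h \<le> 1 / 2"
  shows "nrm (x + h) y \<le> 2 * nrm x y"
proof -
  have xh: "x + h \<in> dom" using assms by (intro dom_add) auto
  have undo: "x + h + (- 1) \<cdot>\<^sub>v h = x" using domD(1)[OF x] h by auto
  have n: "nrm (x + h) ((- 1) \<cdot>\<^sub>v h) = nrm (x + h) h" using xh h by (simp add: nrm_smult)
  have le: "nrm (x + h) z \<le> (1 + nrm (x + h) h) * nrm x z" for z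
    using nrm_le[OF xh, of "(- 1) \<cdot>\<^sub>v h" z] x h unfolding undo n by simp
  have "nrm (x + h) h \<le> (1 + nrm (x + h) h) * (1 / 2)"
    using le[of h] small by (smt (verit) mult_left_mono nrm_nonneg)
  then have "nrm (x + h) h \<le> 1" by simp
  then have "(1 + nrm (x + h) h) * nrm x y \<le> 2 * nrm x y" by (intro mult_right_mono) auto
  with le[of y] show ?thesis by linarith
qed

section \<open>Gradient and Hessian of the barrier\<close>

lemma small_step:
  assumes x: "x \<in> dom" and e: "e \<in> carrier_vec m"
  obtains r where "r > 0" "\<And>t. \<bar>t\<bar> < r \<Longrightarrow> nrm x (t \<cdot>\<^sub>v e) \<le> 1 / 2"
    "\<And>t. \<bar>t\<bar> < r \<Longrightarrow> x + t \<cdot>\<^sub>v e \<in> dom"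
proof -
  \<comment> \<open>The inner summand 1 keeps the denominator positive when \<open>nrm x e\<close>
    vanishes.\<close>
  define r where "r = 1 / (2 * (nrm x e + 1))"
  have pos: "nrm x e + 1 > 0" using nrm_nonneg[of x e] by linarith
  have r: "r > 0" using pos by (simp add: r_def)
  have le: "nrm x (t \<cdot>\<^sub>v e) \<le> 1 / 2" if "\<bar>t\<bar> < r" for t
  proof -
    have "nrm x (t \<cdot>\<^sub>v e) \<le> r * (nrm x e + 1)"
      unfolding nrm_smult[OF x e] using that by (intro mult_mono) auto
    also have "\<dots> = 1 / 2" using pos by (simp add: r_def)
    finally show ?thesis .
  qed
  with r that[of r] dom_add[OF x] e show thesis by (smt (verit) field_sum_of_halves smult_carrier_vec)
qed

text \<open>\<open>L (x + t e)\<close> factors as \<open>L x * (1 + t * Linv x * L e)\<close>, so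
  the derivative of its determinant at 0 is \<open>det (L x)\<close> times a trace, by
  \<open>has_real_derivative_det_one_plus\<close>.\<close>

lemma gradient_eq:
  assumes x: "x \<in> dom" and i: "i < m"
  shows "g x $ i = - mtrace (Linv x * L (unit_vec m i))"
proof -
  interpret root_mat M "L x" "Lroot x" by (rule root_mat[OF x])
  let ?e = "unit_vec m i :: rvec"
  have Nx: "Linv x * L x = 1\<^sub>m M" "L x * Linv x = 1\<^sub>m M" "Linv x \<in> carrier_mat M M"
    using N_X X_N Linv_carrier[OF x] by (simp_all add: Linv_eq x)
  have pos: "Determinant.det (L x) > 0"
    by (rule positive_definite_det_pos[OF domD(2)[OF x]])
  obtain r where r: "r > 0" "\<And>t. \<bar>t\<bar> < r \<Longrightarrow> x + t \<cdot>\<^sub>v ?e \<in> dom"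
    using small_step[OF x unit_vec_carrier] by blast
  have f: "f (x + t \<cdot>\<^sub>v ?e) = - ln (Determinant.det (L x) *
      Determinant.det (1\<^sub>m M + t \<cdot>\<^sub>m (Linv x * L ?e)))" if "\<bar>t\<bar> < r" for t
  proof -
    have "L (x + t \<cdot>\<^sub>v ?e) = L x + t \<cdot>\<^sub>m L ?e"
      using domD(1)[OF x] by (simp add: L_add L_smult)
    also have "\<dots> = L x * (1\<^sub>m M + t \<cdot>\<^sub>m (Linv x * L ?e))"
      using Nx by (simp add: mult_add_distrib_mat[of _ M M _ M] right_mult_one_mat[of _ M M]
          mult_smult_distrib[of _ M M _ M] left_mult_one_mat[of _ M M] flip: assoc)
    finally have eq: "L (x + t \<cdot>\<^sub>v ?e) = L x * (1\<^sub>m M + t \<cdot>\<^sub>m (Linv x * L ?e))" .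
    have "Determinant.det (L (x + t \<cdot>\<^sub>v ?e)) =
        Determinant.det (L x) * Determinant.det (1\<^sub>m M + t \<cdot>\<^sub>m (Linv x * L ?e))"
      unfolding eq using Nx by (intro det_mult[of _ M]) simp_all
    then show ?thesis using r(2)[OF that] f_eq by (simp add: dom_def)
  qed
  have d: "((\<lambda>t. Determinant.det (1\<^sub>m M + t \<cdot>\<^sub>m (Linv x * L ?e))) has_real_derivative
      mtrace (Linv x * L ?e)) (at 0)"
    using Nx by (intro has_real_derivative_det_one_plus) simp
  have one: "1\<^sub>m M + 0 \<cdot>\<^sub>m (Linv x * L ?e) = 1\<^sub>m M"
    by (intro eq_matI) (auto simp: carrier_matD[OF Nx(3)])
  have "((\<lambda>t. - ln (Determinant.det (L x) * Determinant.det (1\<^sub>m M + t \<cdot>\<^sub>m (Linv x * L ?e))))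
      has_real_derivative - mtrace (Linv x * L ?e)) (at 0)"
    using pos by (auto intro!: derivative_eq_intros d simp: one)
  \<comment> \<open>The formula for \<open>f\<close> is available only within radius
    \<open>r\<close>, which suffices for the derivative at 0.\<close>
  then have "((\<lambda>t. f (x + t \<cdot>\<^sub>v ?e)) has_real_derivative - mtrace (Linv x * L ?e)) (at 0)"
    by (rule has_field_derivative_transform_within[OF _ r(1)]) (simp_all add: f dist_real_def)
  then show ?thesis using i by (simp add: g_def gradient_def DERIV_imp_deriv)
qed

lemma g_carrier [simp]: "g x \<in> carrier_vec m"
  by (simp add: g_def gradient_def)

lemma H_carrier [simp]: "H x \<in> carrier_mat m m"
  by (simp add: H_def hessian_def)

lemma dim_g [simp]: "dim_vec (g x) = m"
  by (simp add: g_def gradient_def)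

lemma dim_H [simp]: "dim_row (H x) = m" "dim_col (H x) = m"
  by (simp_all add: H_def hessian_def)

lemma hessian_eq:
  assumes x: "x \<in> dom" and i: "i < m" and j: "j < m"
  shows "H x $$ (i, j) = mtrace (Linv x * (L (unit_vec m j) * (Linv x * L (unit_vec m i))))"
proof -
  interpret root_mat M "L x" "Lroot x" by (rule root_mat[OF x])
  let ?e = "unit_vec m j :: rvec" and ?y = "unit_vec m i :: rvec"
  define d where "d = mtrace (Linv x * (L ?e * (Linv x * L ?y)))"
  have Nx: "Linv x \<in> carrier_mat M M" using Linv_carrier[OF x] .
  obtain r where r: "r > 0" "\<And>t. \<bar>t\<bar> < r \<Longrightarrow> nrm x (t \<cdot>\<^sub>v ?e) \<le> 1 / 2"
      "\<And>t. \<bar>t\<bar> < r \<Longrightarrow> x + t \<cdot>\<^sub>v ?e \<in> dom"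
    using small_step[OF x unit_vec_carrier] by blast
  have x0: "x + 0 \<cdot>\<^sub>v ?e = x" using domD(1)[OF x] by auto
  \<comment> \<open>The Taylor remainder is measured with the norm at the moving point
    \<open>x + t e\<close>; \<open>nrm_ge\<close> replaces it by twice the norm at \<open>x\<close>,
    which gives a constant \<open>C\<close> independent of \<open>t\<close>.\<close>
  have "((\<lambda>t. g (x + t \<cdot>\<^sub>v ?e) $ i) has_real_derivative d) (at 0)"
  proof (rule has_real_derivative_quadratic_error[OF r(1), where C = "(nrm x ?e)\<^sup>2 * (2 * nrm x ?y)"])
    fix t :: real assume t: "\<bar>t\<bar> < r"
    let ?x = "x + t \<cdot>\<^sub>v ?e"
    have "mtrace (Linv x * (L (t \<cdot>\<^sub>v ?e) * (Linv x * L ?y))) = mtrace (t \<cdot>\<^sub>m (Linv x * (L ?e * (Linv x * L ?y))))"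
      using Nx by (simp add: L_smult mult_smult_distrib[of _ M M _ M] mult_smult_assoc_mat[of _ M M _ M])
    also have "\<dots> = t * d" unfolding d_def using Nx by (intro mtrace_smult[of _ M]) simp
    finally have td: "mtrace (Linv x * (L (t \<cdot>\<^sub>v ?e) * (Linv x * L ?y))) = t * d" .
    have "\<bar>g ?x $ i - g (x + 0 \<cdot>\<^sub>v ?e) $ i - t * d\<bar>
      = \<bar>mtrace (Linv ?x * L ?y) - mtrace (Linv x * L ?y) + t * d\<bar>"
      unfolding x0 using gradient_eq[OF r(3)[OF t] i] gradient_eq[OF x i] by linarith
    also have "\<dots> \<le> (nrm x (t \<cdot>\<^sub>v ?e))\<^sup>2 * nrm ?x ?y"
      using mtrace_Linv_taylor[OF x _ r(3)[OF t], of ?y] unfolding td by simp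
    also have "\<dots> \<le> (nrm x (t \<cdot>\<^sub>v ?e))\<^sup>2 * (2 * nrm x ?y)"
      using nrm_ge[OF x _ r(2)[OF t], of ?y] by (intro mult_left_mono) auto
    also have "\<dots> = (nrm x ?e)\<^sup>2 * (2 * nrm x ?y) * t\<^sup>2"
      by (simp add: nrm_smult[OF x] power_mult_distrib)
    finally show "\<bar>g ?x $ i - g (x + 0 \<cdot>\<^sub>v ?e) $ i - t * d\<bar>
      \<le> (nrm x ?e)\<^sup>2 * (2 * nrm x ?y) * t\<^sup>2" .
  qed
  then show ?thesis using i j by (simp add: H_def g_def hessian_def DERIV_imp_deriv d_def)
qed

lemma g_scalar_prod:
  assumes x: "x \<in> dom" and y: "y \<in> carrier_vec m"
  shows "g x \<bullet> y = - mtrace (Linv x * L y)"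
proof -
  have "g x \<bullet> y = (\<Sum>u<m. g x $ u * y $ u)" using y by (simp add: scalar_prod_def lessThan_atLeast0)
  also have "\<dots> = - (\<Sum>u<m. y $ u * mtrace (Linv x * L (unit_vec m u)))"
    unfolding sum_negf[symmetric] by (intro sum.cong refl) (simp add: gradient_eq[OF x])
  finally show ?thesis by (simp add: mtrace_mult_L[OF Linv_carrier[OF x] y])
qed

lemma H_scalar_prod:
  assumes x: "x \<in> dom" and z: "z \<in> carrier_vec m" and y: "y \<in> carrier_vec m"
  shows "z \<bullet> (H x *\<^sub>v y) = mtrace (Linv x * (L y * (Linv x * L z)))"
proof -
  interpret root_mat M "L x" "Lroot x" by (rule root_mat[OF x])
  have Nx [simp]: "Linv x \<in> carrier_mat M M" using Linv_carrier[OF x] .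
  have row: "(H x *\<^sub>v y) $ i = mtrace (Linv x * (L y * (Linv x * L (unit_vec m i))))" if i: "i < m" for i
  proof -
    let ?A = "Linv x * (L (unit_vec m i) * Linv x)"
    \<comment> \<open>The left side is the trace of a product of two blocks; exchanging them moves
      \<open>L w\<close> to the end, where \<open>mtrace_mult_L\<close> applies.\<close>
    have c: "mtrace (Linv x * (L w * (Linv x * L (unit_vec m i)))) = mtrace (?A * L w)" for w
    proof -
      have "mtrace ((Linv x * L w) * (Linv x * L (unit_vec m i))) = mtrace ((Linv x * L (unit_vec m i)) * (Linv x * L w))"
        by (rule mtrace_cyclic) simp_all
      then show ?thesis by simp
    qed
    have "(H x *\<^sub>v y) $ i = (\<Sum>u<m. H x $$ (i, u) * y $ u)"
      using i y carrier_matD[OF H_carrier[of x]] by (simp add: scalar_prod_def lessThan_atLeast0)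
    also have "\<dots> = (\<Sum>u<m. y $ u * mtrace (?A * L (unit_vec m u)))"
      by (intro sum.cong refl) (simp add: hessian_eq[OF x i] c del: assoc)
    also have "\<dots> = mtrace (?A * L y)" by (rule mtrace_mult_L[symmetric]) (simp_all add: y)
    finally show ?thesis by (simp only: c)
  qed
  have "z \<bullet> (H x *\<^sub>v y) = (\<Sum>u<m. z $ u * (H x *\<^sub>v y) $ u)"
    using carrier_matD[OF H_carrier[of x]] by (simp add: scalar_prod_def lessThan_atLeast0)
  also have "\<dots> = (\<Sum>u<m. z $ u * mtrace ((Linv x * (L y * Linv x)) * L (unit_vec m u)))"
    by (intro sum.cong refl) (simp add: row del: index_mult_mat_vec)
  also have "\<dots> = mtrace ((Linv x * (L y * Linv x)) * L z)"
    by (rule mtrace_mult_L[symmetric]) (simp_all add: z)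
  finally show ?thesis by simp
qed

lemma H_quadratic:
  assumes x: "x \<in> dom" and y: "y \<in> carrier_vec m"
  shows "y \<bullet> (H x *\<^sub>v y) = (nrm x y)\<^sup>2"
  using root_mat.fnorm_scaled_sq[OF root_mat[OF x] L L_sym]
  by (simp add: H_scalar_prod[OF x y y] nrm_def Linv_eq[OF x])

lemma H_Cauchy_Schwarz:
  assumes x: "x \<in> dom" and y: "y \<in> carrier_vec m" and z: "z \<in> carrier_vec m"
  shows "\<bar>z \<bullet> (H x *\<^sub>v y)\<bar> \<le> nrm x y * nrm x z"
  using root_mat.abs_mtrace_le_scaled[OF root_mat[OF x] L L_sym L L_sym]
  by (simp add: H_scalar_prod[OF x z y] nrm_def Linv_eq[OF x])

lemma nrm_0_iff:
  assumes x: "x \<in> dom" and y: "y \<in> carrier_vec m"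
  shows "nrm x y = 0 \<longleftrightarrow> y = 0\<^sub>v m"
proof
  interpret root_mat M "L x" "Lroot x" by (rule root_mat[OF x])
  assume "nrm x y = 0"
  then have "Lroot x * L y * Lroot x = 0\<^sub>m M M" unfolding nrm_def by (simp add: fnorm_0_iff[of _ M M])
  then have "T * ((Lroot x * L y * Lroot x) * T) = T * (0\<^sub>m M M * T)" by simp
  then have "L y = 0\<^sub>m M M"
    by (simp add: cancel W_T right_mult_one_mat[of _ M M] left_mult_zero_mat[of _ M M] right_mult_zero_mat[of _ M M])
  then show "y = 0\<^sub>v m" by (rule pencil_inj[OF y])
next
  assume "y = 0\<^sub>v m"
  then have "y = 0 \<cdot>\<^sub>v 0\<^sub>v m" by auto
  then show "nrm x y = 0" using nrm_smult[OF x, of "0\<^sub>v m" 0] by simp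
qed

lemma H_sym:
  assumes x: "x \<in> dom"
  shows "(H x)\<^sup>T = H x"
proof (rule eq_matI)
  interpret root_mat M "L x" "Lroot x" by (rule root_mat[OF x])
  have Nx [simp]: "Linv x \<in> carrier_mat M M" using Linv_carrier[OF x] .
  fix i j assume "i < dim_row (H x)" "j < dim_col (H x)"
  then have ij: "i < m" "j < m" using carrier_matD[OF H_carrier[of x]] by auto
  have "mtrace ((Linv x * L (unit_vec m i)) * (Linv x * L (unit_vec m j)))
      = mtrace ((Linv x * L (unit_vec m j)) * (Linv x * L (unit_vec m i)))"
    by (rule mtrace_cyclic) simp_all
  then show "(H x)\<^sup>T $$ (i, j) = H x $$ (i, j)"
    using ij carrier_matD[OF H_carrier[of x]] by (simp add: hessian_eq[OF x])
qed (use carrier_matD[OF H_carrier[of x]] in simp_all)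

lemma positive_definite_H:
  assumes x: "x \<in> dom"
  shows "positive_definite m (H x)"
  unfolding positive_definite_def using H_sym[OF x] H_quadratic[OF x] nrm_0_iff[OF x] by simp

text \<open>\<open>L x\<close> cancels one of the two inverses in the Hessian form. This and
  \<open>g_self\<close> are the identities of logarithmic homogeneity, with \<open>M\<close> as
  barrier parameter.\<close>

lemma H_self:
  assumes x: "x \<in> dom"
  shows "H x *\<^sub>v x = - g x"
proof (rule eq_vecI)
  interpret root_mat M "L x" "Lroot x" by (rule root_mat[OF x])
  have Nx [simp]: "Linv x \<in> carrier_mat M M" using Linv_carrier[OF x] .
  fix i assume "i < dim_vec (- g x)"
  then have i: "i < m" using carrier_vecD[OF g_carrier[of x]] by simp
  have "(H x *\<^sub>v x) $ i = unit_vec m i \<bullet> (H x *\<^sub>v x)"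
    using i domD(1)[OF x] by (simp add: scalar_prod_left_unit[OF mult_mat_vec_carrier[OF H_carrier]])
  also have "\<dots> = mtrace (Linv x * L (unit_vec m i))"
    unfolding H_scalar_prod[OF x unit_vec_carrier domD(1)[OF x]]
    using cancel(3,4)[of "Linv x * L (unit_vec m i)"] cancel(3,4)[of "L (unit_vec m i)"] by (simp add: Linv_eq[OF x])
  also have "\<dots> = (- g x) $ i" using i by (simp add: gradient_eq[OF x])
  finally show "(H x *\<^sub>v x) $ i = (- g x) $ i" .
qed (use carrier_matD[OF H_carrier[of x]] carrier_vecD[OF g_carrier[of x]] in simp)

lemma g_self:
  assumes x: "x \<in> dom"
  shows "g x \<bullet> x = - real M"
  using root_mat.N_X[OF root_mat[OF x]] by (simp add: g_scalar_prod[OF x domD(1)[OF x]] Linv_eq[OF x])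

text \<open>Source of the factor \<open>sqrt (L + 1)\<close> in the complexity: through
  Cauchy-Schwarz it bounds the dual norm of the gradient, and with it the predictor
  direction.\<close>

lemma nrm_self:
  assumes x: "x \<in> dom"
  shows "nrm x x = sqrt (real M)"
proof -
  have "(nrm x x)\<^sup>2 = x \<bullet> (- g x)" using H_quadratic[OF x domD(1)[OF x]] H_self[OF x] by simp
  also have "\<dots> = - (g x \<bullet> x)" using domD(1)[OF x] g_carrier[of x]
    by (metis comm_scalar_prod scalar_prod_uminus_right carrier_vecD)
  finally have "(nrm x x)\<^sup>2 = real M" by (simp add: g_self[OF x])
  then show ?thesis by (metis nrm_nonneg real_sqrt_unique)
qed

lemma nrm_le_minus_g:
  assumes x: "x \<in> dom" and y: "y \<in> carrier_vec m" and psd: "positive_semidefinite M (L y)"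
  shows "nrm x y \<le> - (g x \<bullet> y)"
  using root_mat.scaled_norm_le_mtrace[OF root_mat[OF x] psd]
  by (simp add: g_scalar_prod[OF x y] nrm_def Linv_eq[OF x])

lemma gradient_taylor:
  assumes x: "x \<in> dom" and h: "h \<in> carrier_vec m" and xh: "x + h \<in> dom" and y: "y \<in> carrier_vec m"
  shows "\<bar>(g (x + h) - g x - H x *\<^sub>v h) \<bullet> y\<bar> \<le> (nrm x h)\<^sup>2 * nrm (x + h) y"
proof -
  have Hh: "H x *\<^sub>v h \<in> carrier_vec m" by (rule mult_mat_vec_carrier[OF H_carrier h])
  have "(g (x + h) - g x - H x *\<^sub>v h) \<bullet> y = g (x + h) \<bullet> y - g x \<bullet> y - (H x *\<^sub>v h) \<bullet> y"
    using Hh y by (simp add: minus_scalar_prod_distrib[of _ m])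
  also have "(H x *\<^sub>v h) \<bullet> y = mtrace (Linv x * (L h * (Linv x * L y)))"
    using H_scalar_prod[OF x y h] comm_scalar_prod[OF Hh y] by simp
  finally show ?thesis
    using mtrace_Linv_taylor[OF x h xh, of y] by (simp add: g_scalar_prod x xh y)
qed

text \<open>Bounds the dual local norm of \<open>s\<close> at \<open>x\<close> by \<open>t\<close>.
  As a family of inequalities in \<open>y\<close> it mentions no root of the inverse Hessian, and
  the estimates for both steps can treat one \<open>y\<close> at a time.\<close>

definition dual_le :: "rvec \<Rightarrow> rvec \<Rightarrow> real \<Rightarrow> bool" where
  "dual_le x s t \<longleftrightarrow> (\<forall>y\<in>carrier_vec m. \<bar>s \<bullet> y\<bar> \<le> t * nrm x y)"

lemma dual_le_iff:
  assumes x: "x \<in> dom" and s: "s \<in> carrier_vec m" and t: "t \<ge> 0"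
  shows "vnorm (inv_sqrt_mat (H x) *\<^sub>v s) \<le> t \<longleftrightarrow> dual_le x s t"
proof -
  define R where "R = inv_sqrt_mat (H x)"
  note i = inv_sqrt_mat[OF positive_definite_H[OF x], folded R_def]
  have "R * (R * H x) = R * R * H x" by (rule assoc_mult_mat[symmetric, OF i(1) i(1) H_carrier])
  with i interpret r: root_mat m "H x" R by unfold_locales (simp_all add: H_sym[OF x])
  have a_def: "vnorm (R *\<^sub>v s) = sqrt ((R *\<^sub>v s) \<bullet> (R *\<^sub>v s))" by (simp add: vnorm_def)
  have "\<bar>s \<bullet> y\<bar> \<le> vnorm (R *\<^sub>v s) * nrm x y" if y: "y \<in> carrier_vec m" for y
  proof (rule power2_le_imp_le)
    have "s \<bullet> y = s \<bullet> (R *\<^sub>v (r.T *\<^sub>v y))" using y by (simp add: r.W_T flip: r.assocv)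
    also have "\<dots> = (R *\<^sub>v s) \<bullet> (r.T *\<^sub>v y)"
      using transpose_swap_scalar_prod[OF r.W, of "r.T *\<^sub>v y" s] s y by (simp add: r.W_sym)
    finally have "\<bar>s \<bullet> y\<bar>\<^sup>2 \<le> (R *\<^sub>v s) \<bullet> (R *\<^sub>v s) * ((r.T *\<^sub>v y) \<bullet> (r.T *\<^sub>v y))"
      using Cauchy_Schwarz_scalar_prod[of "R *\<^sub>v s" m "r.T *\<^sub>v y"] s y by simp
    also have "(r.T *\<^sub>v y) \<bullet> (r.T *\<^sub>v y) = y \<bullet> (r.T *\<^sub>v (r.T *\<^sub>v y))"
      using transpose_swap_scalar_prod[OF r.T, of "r.T *\<^sub>v y" y] y by (simp add: r.T_sym)
    also have "r.T *\<^sub>v (r.T *\<^sub>v y) = H x *\<^sub>v y"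
      using r.assocv[OF r.T r.T y] unfolding r.T_T ..
    finally show "\<bar>s \<bullet> y\<bar>\<^sup>2 \<le> (vnorm (R *\<^sub>v s) * nrm x y)\<^sup>2"
      by (simp add: H_quadratic[OF x y] vnorm_def power_mult_distrib)
  qed (simp add: vnorm_def)
  moreover have "vnorm (R *\<^sub>v s) \<le> t" if le: "dual_le x s t"
  proof -
    \<comment> \<open>\<open>y\<close> is the inverse Hessian applied to \<open>s\<close>, the
      vector for which Cauchy-Schwarz is an equality: \<open>s \<bullet> y\<close> and the square of
      \<open>nrm x y\<close> are both \<open>a\<close>.\<close>
    define y where "y = R *\<^sub>v (R *\<^sub>v s)"
    define a where "a = (R *\<^sub>v s) \<bullet> (R *\<^sub>v s)"
    have y: "y \<in> carrier_vec m" using s by (simp add: y_def)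
    have sy: "s \<bullet> y = a"
      using transpose_swap_scalar_prod[OF r.W, of "R *\<^sub>v s" s] s by (simp add: r.W_sym y_def a_def)
    have "H x *\<^sub>v y = (H x * (R * R)) *\<^sub>v s" using s by (simp add: y_def)
    also have "\<dots> = s" using r.X_N s by (simp add: r.N_def)
    finally have "(nrm x y)\<^sup>2 = a"
      using H_quadratic[OF x y] sy comm_scalar_prod[OF y s] by simp
    then have nrm: "nrm x y = sqrt a" by (metis nrm_nonneg real_sqrt_unique)
    have "a \<ge> 0" by (simp add: a_def)
    have "sqrt a * sqrt a \<le> t * sqrt a"
      using le y \<open>a \<ge> 0\<close> unfolding dual_le_def by (metis abs_of_nonneg nrm real_sqrt_mult_self sy)
    then have "sqrt a \<le> t" using t \<open>a \<ge> 0\<close> mult_right_le_imp_le[of "sqrt a" "sqrt a" t]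
      by (cases "a = 0") auto
    then show ?thesis by (simp add: vnorm_def a_def)
  qed
  ultimately show ?thesis
    unfolding dual_le_def R_def by (meson mult_right_mono nrm_nonneg order_trans)
qed

end

section \<open>Solvability of linear systems\<close>

text \<open>Gram-Schmidt with explicit coefficients. The residuals of \<open>b\<close> and of
  \<open>c k\<close> against the first \<open>k\<close> vectors are orthogonal to these; removing
  from the first its component along the second makes it orthogonal to \<open>c k\<close> as well.
  The vectors may be linearly dependent.\<close>

lemma ex_orthogonal_residual:
  fixes c :: "nat \<Rightarrow> rvec" and b :: rvec
  assumes "\<And>j. j < k \<Longrightarrow> c j \<in> carrier_vec n" "b \<in> carrier_vec n"
  shows "\<exists>w. \<forall>j<k. c j \<bullet> Matrix.vec n (\<lambda>i. b $ i - (\<Sum>l<k. w l * c l $ i)) = 0"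
  using assms
proof (induction k arbitrary: b)
  case 0
  then show ?case by simp
next
  case (Suc k)
  define r where "r = (\<lambda>b w. Matrix.vec n (\<lambda>i. b $ i - (\<Sum>l<k. w l * c l $ i)) :: rvec)"
  have r [simp]: "r b w \<in> carrier_vec n" for b w by (simp add: r_def)
  have c: "c j \<in> carrier_vec n" if "j \<le> k" for j using Suc.prems that by simp
  obtain w1 where w1: "\<And>j. j < k \<Longrightarrow> c j \<bullet> r b w1 = 0"
    using Suc.IH[of b] Suc.prems c unfolding r_def by (meson less_imp_le)
  obtain w2 where w2: "\<And>j. j < k \<Longrightarrow> c j \<bullet> r (c k) w2 = 0"
    using Suc.IH[of "c k"] Suc.prems c unfolding r_def by (meson less_imp_le order_refl)
  define r1 where "r1 = r b w1"
  define r2 where "r2 = r (c k) w2"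
  have r1 [simp]: "r1 \<in> carrier_vec n" and r2 [simp]: "r2 \<in> carrier_vec n" by (simp_all add: r1_def r2_def)
  \<comment> \<open>If \<open>c k\<close> lies in the span of the earlier vectors, \<open>r2\<close>
    vanishes and the division by zero yields \<open>l = 0\<close>.\<close>
  define l where "l = (r2 \<bullet> r1) / (r2 \<bullet> r2)"
  define w where "w = (\<lambda>j. if j < k then w1 j - l * w2 j else l)"
  define v where "v = r1 - l \<cdot>\<^sub>v r2"
  have v [simp]: "v \<in> carrier_vec n" by (simp add: v_def)
  have dim_v [simp]: "dim_vec v = n" by (rule carrier_vecD) simp
  have v_eq: "Matrix.vec n (\<lambda>i. b $ i - (\<Sum>j<Suc k. w j * c j $ i)) = v"
    using c Suc.prems
    by (intro eq_vecI) (simp_all add: v_def r1_def r2_def r_def w_def sum_subtractf left_diff_distrib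
        right_diff_distrib sum_distrib_left mult.assoc)
  have orth: "c j \<bullet> v = 0" if "j < k" for j
    using w1[OF that] w2[OF that] c[of j] that
    by (simp add: v_def scalar_prod_minus_distrib[of _ n] r1_def r2_def)
  have "r2 \<bullet> v = r2 \<bullet> r1 - l * (r2 \<bullet> r2)"
    by (simp add: v_def scalar_prod_minus_distrib[of _ n])
  also have "\<dots> = 0"
    using scalar_prod_self_eq_0[OF r2] by (cases "r2 \<bullet> r2 = 0") (simp_all add: l_def)
  finally have r2v: "r2 \<bullet> v = 0" .
  have "c k \<bullet> v = (\<Sum>i<n. (r2 $ i + (\<Sum>j<k. w2 j * c j $ i)) * v $ i)"
    by (simp add: scalar_prod_def lessThan_atLeast0 r2_def r_def)
  also have "\<dots> = r2 \<bullet> v + (\<Sum>i<n. \<Sum>j<k. w2 j * (c j $ i * v $ i))"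
    by (simp add: scalar_prod_def lessThan_atLeast0 distrib_right sum.distrib sum_distrib_right mult.assoc)
  also have "(\<Sum>i<n. \<Sum>j<k. w2 j * (c j $ i * v $ i)) = (\<Sum>j<k. w2 j * (c j \<bullet> v))"
    by (subst sum.swap) (simp add: scalar_prod_def lessThan_atLeast0 sum_distrib_left)
  also have "\<dots> = 0" using orth by simp
  finally have "c k \<bullet> v = 0" using r2v by simp
  with orth have "\<forall>j<Suc k. c j \<bullet> v = 0" by (simp add: less_Suc_eq)
  then show ?case unfolding v_eq[symmetric] by blast
qed

text \<open>The residual \<open>v = b - A w\<close> of the projection is orthogonal to the columns
  of \<open>A\<close>, so by hypothesis also to \<open>b\<close>; hence
  \<open>v \<bullet> v = 0\<close>.\<close>

lemma Fredholm_alternative: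
  fixes A :: rmat
  assumes A: "A \<in> carrier_mat n k" and b: "b \<in> carrier_vec n"
    and orth: "\<And>v. v \<in> carrier_vec n \<Longrightarrow> A\<^sup>T *\<^sub>v v = 0\<^sub>v k \<Longrightarrow> v \<bullet> b = 0"
  obtains w where "w \<in> carrier_vec k" "A *\<^sub>v w = b"
proof -
  obtain f where f: "\<forall>j<k. col A j \<bullet> Matrix.vec n (\<lambda>i. b $ i - (\<Sum>l<k. f l * col A l $ i)) = 0"
    using ex_orthogonal_residual[of k "col A" n b] A b by auto
  define w where "w = Matrix.vec k f"
  have w: "w \<in> carrier_vec k" by (simp add: w_def)
  have Aw: "A *\<^sub>v w \<in> carrier_vec n" using A w by simp
  define v where "v = b - A *\<^sub>v w"
  have v: "v \<in> carrier_vec n" using b Aw by (simp add: v_def)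
  have "Matrix.vec n (\<lambda>i. b $ i - (\<Sum>l<k. f l * col A l $ i)) = v"
    using A b by (intro eq_vecI) (auto simp: v_def w_def scalar_prod_def lessThan_atLeast0 mult.commute)
  with f have "A\<^sup>T *\<^sub>v v = 0\<^sub>v k" using A by (intro eq_vecI) auto
  then have "v \<bullet> b = 0" "(A\<^sup>T *\<^sub>v v) \<bullet> w = 0" using orth[OF v] w by auto
  then have "v \<bullet> v = 0"
    using transpose_swap_scalar_prod[OF A w v] v b Aw
    by (simp add: v_def scalar_prod_minus_distrib[of _ n])
  then have "v = 0\<^sub>v n" using scalar_prod_self_eq_0[OF v] by simp
  then have "A *\<^sub>v w = b" using b Aw unfolding v_def by (auto simp: vec_eq_iff)
  with w that show thesis by blast
qed

section \<open>Predictor and corrector steps\<close>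

context logdet_barrier
begin

lemma H_mult [simp]: "u \<in> carrier_vec m \<Longrightarrow> H x *\<^sub>v u \<in> carrier_vec m"
  by (rule mult_mat_vec_carrier[OF H_carrier])

lemma H_scalar_prod_self:
  assumes x: "x \<in> dom" and u: "u \<in> carrier_vec m"
  shows "(H x *\<^sub>v u) \<bullet> x = - (g x \<bullet> u)"
proof -
  have "(H x *\<^sub>v u) \<bullet> x = u \<bullet> (H x *\<^sub>v x)"
    using transpose_swap_scalar_prod[OF H_carrier domD(1)[OF x] u] H_sym[OF x] by simp
  then show ?thesis using H_self[OF x] u comm_scalar_prod[OF g_carrier u] by simp
qed

lemma H_scalar_prod_le:
  assumes x: "x \<in> dom" and u: "u \<in> carrier_vec m" and y: "y \<in> carrier_vec m"
  shows "\<bar>(H x *\<^sub>v u) \<bullet> y\<bar> \<le> nrm x u * nrm x y"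
  using H_Cauchy_Schwarz[OF x u y] comm_scalar_prod[OF y H_mult[OF u]] by simp

lemma H_scalar_prod_quadratic:
  assumes x: "x \<in> dom" and u: "u \<in> carrier_vec m"
  shows "(H x *\<^sub>v u) \<bullet> u = (nrm x u)\<^sup>2"
  using H_quadratic[OF x u] comm_scalar_prod[OF u H_mult[OF u]] by simp

lemma g_scalar_prod_le:
  assumes x: "x \<in> dom" and y: "y \<in> carrier_vec m"
  shows "\<bar>g x \<bullet> y\<bar> \<le> sqrt (real M) * nrm x y"
  using H_scalar_prod_le[OF x y domD(1)[OF x]] H_scalar_prod_self[OF x y] nrm_self[OF x]
  by (simp add: mult.commute)

text \<open>Testing the Newton equation with \<open>x\<close> and \<open>u\<close> turns
  \<open>orth\<close> into \<open>g x \<bullet> u = n\<^sup>2\<close>, and the gradient has dual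
  norm at most \<open>sqrt M\<close>, so \<open>n \<le> sqrt M\<close>. The step length is chosen to
  make \<open>\<alpha> * n\<close> at most 1/10; the remaining numbers follow from this and from the
  width 1/10 of the starting neighbourhood.\<close>

lemma predictor_estimate:
  fixes \<mu> \<alpha> :: real
  assumes x: "x \<in> dom" and s: "s \<in> carrier_vec m" and u: "u \<in> carrier_vec m" and v: "v \<in> carrier_vec m"
    and M: "M > 0" and \<mu>: "\<mu> > 0" "x \<bullet> s = real M * \<mu>"
    and eq: "v + \<mu> \<cdot>\<^sub>v (H x *\<^sub>v u) = - s" and orth: "(x + u) \<bullet> (s + v) = 0"
    and near: "dual_le x (s + \<mu> \<cdot>\<^sub>v g x) (1 / 10 * \<mu>)"
    and \<alpha>: "\<alpha> = 1 / (10 * sqrt (real M))"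
  defines "x' \<equiv> x + \<alpha> \<cdot>\<^sub>v u" and "s' \<equiv> s + \<alpha> \<cdot>\<^sub>v v"
  defines "\<mu>' \<equiv> (x' \<bullet> s') / real M"
  shows "x' \<in> dom" "\<mu>' > 0" "\<mu>' \<le> (1 - \<alpha>) * (1 + \<alpha> / 10) * \<mu>"
    "dual_le x' (s' + \<mu>' \<cdot>\<^sub>v g x') (1 / 5 * \<mu>')"
proof -
  note xc [simp] = domD(1)[OF x] and s [simp] and u [simp] and v [simp]
  define n where "n = nrm x u"
  define \<psi> where "\<psi> y = s \<bullet> y + \<mu> * (g x \<bullet> y)" for y
  have M1: "real M \<ge> 1" using M by simp
  then have sM: "sqrt (real M) \<ge> 1" by simp
  have \<alpha>_pos: "\<alpha> > 0" and \<alpha>M: "\<alpha> * sqrt (real M) = 1 / 10" using sM by (simp_all add: \<alpha>)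
  have "\<alpha> * 1 \<le> \<alpha> * sqrt (real M)" using sM \<alpha>_pos by (intro mult_left_mono) auto
  then have \<alpha>_le: "\<alpha> \<le> 1 / 10" using \<alpha>M by linarith
  have vy: "v \<bullet> y = - (s \<bullet> y) - \<mu> * ((H x *\<^sub>v u) \<bullet> y)" if y: "y \<in> carrier_vec m" for y
  proof -
    have "(v + \<mu> \<cdot>\<^sub>v (H x *\<^sub>v u)) \<bullet> y = v \<bullet> y + \<mu> * ((H x *\<^sub>v u) \<bullet> y)"
      using y by (simp add: add_scalar_prod_distrib[of _ m])
    moreover have "(- s) \<bullet> y = - (s \<bullet> y)" using y s by simp
    ultimately show ?thesis unfolding eq by simp
  qed
  have \<psi>_le: "\<bar>\<psi> y\<bar> \<le> 1 / 10 * \<mu> * nrm x y" if y: "y \<in> carrier_vec m" for y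
    using near y unfolding dual_le_def \<psi>_def by (simp add: add_scalar_prod_distrib[of _ m])
  have Hu: "(H x *\<^sub>v u) \<bullet> x = - (g x \<bullet> u)" "(H x *\<^sub>v u) \<bullet> u = n\<^sup>2"
    using H_scalar_prod_self[OF x u] H_scalar_prod_quadratic[OF x u] by (simp_all add: n_def)
  have "(x + u) \<bullet> (s + v) = (s \<bullet> x + s \<bullet> u) + (v \<bullet> x + v \<bullet> u)"
    by (simp add: add_scalar_prod_distrib[of _ m] scalar_prod_add_distrib[of _ m]
        comm_scalar_prod[of x m] comm_scalar_prod[of u m])
  also have "\<dots> = \<mu> * (g x \<bullet> u - n\<^sup>2)" by (simp add: vy Hu algebra_simps)
  finally have n2: "g x \<bullet> u = n\<^sup>2" using orth \<mu>(1) by simp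
  have n0: "n \<ge> 0" by (simp add: n_def)
  have "n * n \<le> sqrt (real M) * n"
    using g_scalar_prod_le[OF x u] unfolding n2 by (simp add: n_def power2_eq_square)
  then have n_le: "n \<le> sqrt (real M)"
    using n0 sM mult_right_le_imp_le[of n n "sqrt (real M)"] by (cases "n = 0") auto
  have \<alpha>n: "\<alpha> * n \<le> 1 / 10" using mult_left_mono[OF n_le, of \<alpha>] \<alpha>_pos \<alpha>M by simp
  have h: "\<alpha> \<cdot>\<^sub>v u \<in> carrier_vec m" by simp
  have nh: "nrm x (\<alpha> \<cdot>\<^sub>v u) = \<alpha> * n" using \<alpha>_pos by (simp add: nrm_smult[OF x u] n_def)
  show x': "x' \<in> dom"
    unfolding x'_def using \<alpha>n by (intro dom_add[OF x h]) (simp add: nh)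
  have x'c [simp]: "x' \<in> carrier_vec m" by (rule domD(1)[OF x'])
  have s'c [simp]: "s' \<in> carrier_vec m" by (simp add: s'_def)
  have s'y: "s' \<bullet> y = (1 - \<alpha>) * (s \<bullet> y) - \<alpha> * \<mu> * ((H x *\<^sub>v u) \<bullet> y)" if y: "y \<in> carrier_vec m" for y
    using y by (simp add: s'_def add_scalar_prod_distrib[of _ m] vy algebra_simps)
  have "x' \<bullet> s' = s' \<bullet> x'" by (rule comm_scalar_prod[OF x'c s'c])
  also have "\<dots> = s' \<bullet> x + \<alpha> * (s' \<bullet> u)"
    unfolding x'_def by (simp add: scalar_prod_add_distrib[of _ m] scalar_prod_smult_distrib[OF s'c u])
  also have "\<dots> = (1 - \<alpha>) * (s \<bullet> x + \<alpha> * (s \<bullet> u)) - \<alpha> * \<mu> * (- n\<^sup>2 + \<alpha> * n\<^sup>2)"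
    by (simp add: s'y Hu n2 algebra_simps)
  also have "s \<bullet> u = \<psi> u - \<mu> * n\<^sup>2" by (simp add: \<psi>_def n2)
  also have "s \<bullet> x = real M * \<mu>" using \<mu>(2) comm_scalar_prod[of s m x] by simp
  finally have xs: "x' \<bullet> s' = (1 - \<alpha>) * (real M * \<mu> + \<alpha> * \<psi> u)" by (simp add: algebra_simps)
  \<comment> \<open>Measures the deviation of \<open>\<mu>'\<close> from
    \<open>(1 - \<alpha>) * \<mu>\<close>. Since \<open>\<psi> u\<close> is at most of order
    \<open>sqrt M\<close>, the quotient by \<open>M\<close> stays below \<open>\<mu> / 10\<close>
    even after multiplication by \<open>sqrt M\<close>, the factor that the gradient costs
    below.\<close>
  define \<delta> where "\<delta> = \<psi> u / real M"
  have \<mu>'_eq: "\<mu>' = (1 - \<alpha>) * (\<mu> + \<alpha> * \<delta>)"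
    unfolding \<mu>'_def xs \<delta>_def using M by (simp add: field_simps)
  have "1 / 10 * \<mu> * n \<le> 1 / 10 * \<mu> * sqrt (real M)"
    using n_le \<mu>(1) by (intro mult_left_mono) auto
  then have "\<bar>\<psi> u\<bar> \<le> 1 / 10 * \<mu> * sqrt (real M)"
    using \<psi>_le[OF u] unfolding n_def by linarith
  then have "\<bar>\<psi> u\<bar> * sqrt (real M) \<le> 1 / 10 * \<mu> * sqrt (real M) * sqrt (real M)"
    by (rule mult_right_mono) simp
  then have "\<bar>\<psi> u\<bar> * sqrt (real M) \<le> \<mu> / 10 * real M" by (simp add: mult.assoc)
  then have \<delta>M: "\<bar>\<delta>\<bar> * sqrt (real M) \<le> \<mu> / 10"
    using M by (simp add: \<delta>_def pos_divide_le_eq)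
  have "\<bar>\<delta>\<bar> * 1 \<le> \<bar>\<delta>\<bar> * sqrt (real M)" using sM by (intro mult_left_mono) auto
  with \<delta>M have \<delta>: "\<bar>\<delta>\<bar> \<le> \<mu> / 10" by linarith
  have \<alpha>\<delta>: "\<bar>\<alpha> * \<delta>\<bar> \<le> \<alpha> * (\<mu> / 10)"
    using \<delta> \<alpha>_pos by (simp add: abs_mult)
  have \<alpha>\<delta>': "\<bar>\<alpha> * \<delta>\<bar> \<le> \<mu> / 100"
  proof -
    have "\<alpha> * (\<mu> / 10) \<le> 1 / 10 * (\<mu> / 10)" using \<alpha>_le \<mu>(1) by (intro mult_right_mono) auto
    with \<alpha>\<delta> show ?thesis by linarith
  qed
  have "\<mu>' \<ge> (1 - \<alpha>) * (99 / 100 * \<mu>)"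
    unfolding \<mu>'_eq using \<alpha>\<delta>' \<alpha>_le by (intro mult_left_mono) auto
  then have \<mu>'_ge: "(1 - \<alpha>) * \<mu> * (99 / 100) \<le> \<mu>'" by (simp add: algebra_simps)
  have "0 < (1 - \<alpha>) * \<mu> * (99 / 100)" using \<mu>(1) \<alpha>_le by (intro mult_pos_pos) auto
  with \<mu>'_ge show \<mu>'_pos: "\<mu>' > 0" by linarith
  have "\<mu>' \<le> (1 - \<alpha>) * (\<mu> + \<alpha> * (\<mu> / 10))"
    unfolding \<mu>'_eq using \<alpha>\<delta> \<alpha>_le by (intro mult_left_mono) auto
  then show "\<mu>' \<le> (1 - \<alpha>) * (1 + \<alpha> / 10) * \<mu>" by (simp add: algebra_simps)
  show "dual_le x' (s' + \<mu>' \<cdot>\<^sub>v g x') (1 / 5 * \<mu>')"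
    unfolding dual_le_def
  proof
    fix y :: rvec assume y: "y \<in> carrier_vec m"
    define q where "q = nrm x' y"
    define err where "err = (g x' - g x - H x *\<^sub>v (\<alpha> \<cdot>\<^sub>v u)) \<bullet> y"
    define hu where "hu = (H x *\<^sub>v u) \<bullet> y"
    have q0: "q \<ge> 0" by (simp add: q_def)
    have nq: "nrm x y \<le> 11 / 10 * q"
    proof -
      have "nrm x y \<le> (1 + \<alpha> * n) * q"
        using nrm_le[OF x h, of y] x' unfolding nh q_def x'_def by simp
      also have "\<dots> \<le> 11 / 10 * q" using \<alpha>n q0 by (intro mult_right_mono) auto
      finally show ?thesis .
    qed
    have "err = g x' \<bullet> y - g x \<bullet> y - \<alpha> * hu"
      using y mult_mat_vec[OF H_carrier u]
      by (simp add: err_def minus_scalar_prod_distrib[of _ m] hu_def)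
    then have gy: "g x \<bullet> y = g x' \<bullet> y - \<alpha> * hu - err" by simp
    have "(s' + \<mu>' \<cdot>\<^sub>v g x') \<bullet> y = s' \<bullet> y + \<mu>' * (g x' \<bullet> y)"
      using y by (simp add: add_scalar_prod_distrib[of _ m])
    also have "\<dots> = (1 - \<alpha>) * (\<psi> y - \<mu> * (g x \<bullet> y)) - \<alpha> * \<mu> * hu + \<mu>' * (g x' \<bullet> y)"
      using y by (simp add: s'y \<psi>_def hu_def)
    \<comment> \<open>The four sources of error: the old deviation from the central path, the Taylor
      remainder of the gradient, the change of \<open>\<mu>\<close>, and the second-order term left
      when the linear terms in \<open>hu\<close> cancel.\<close>
    also have "\<dots> = (1 - \<alpha>) * \<psi> y + (1 - \<alpha>) * (\<mu> * err) + (1 - \<alpha>) * (\<alpha> * (\<delta> * (g x' \<bullet> y)))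
        - \<alpha> * \<alpha> * \<mu> * hu"
      unfolding gy \<mu>'_eq by (simp add: algebra_simps)
    finally have dec: "(s' + \<mu>' \<cdot>\<^sub>v g x') \<bullet> y = (1 - \<alpha>) * \<psi> y + (1 - \<alpha>) * (\<mu> * err)
        + (1 - \<alpha>) * (\<alpha> * (\<delta> * (g x' \<bullet> y))) - \<alpha> * \<alpha> * \<mu> * hu" .
    have b1: "\<bar>\<psi> y\<bar> \<le> 11 / 100 * (\<mu> * q)"
    proof -
      have "1 / 10 * \<mu> * nrm x y \<le> 1 / 10 * \<mu> * (11 / 10 * q)"
        using nq \<mu>(1) by (intro mult_left_mono) auto
      with \<psi>_le[OF y] show ?thesis by simp
    qed
    have "\<bar>err\<bar> \<le> (\<alpha> * n)\<^sup>2 * q"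
      using gradient_taylor[OF x h _ y] x' unfolding err_def q_def x'_def nh by simp
    also have "\<dots> \<le> (1 / 10)\<^sup>2 * q"
      using \<alpha>n \<alpha>_pos n0 q0 by (intro mult_right_mono power_mono) simp_all
    finally have b2: "\<bar>\<mu> * err\<bar> \<le> 1 / 100 * (\<mu> * q)"
      using \<mu>(1) by (simp add: abs_mult power2_eq_square)
    have b3: "\<bar>\<alpha> * (\<delta> * (g x' \<bullet> y))\<bar> \<le> 1 / 100 * (\<mu> * q)"
    proof -
      have "\<bar>\<alpha> * (\<delta> * (g x' \<bullet> y))\<bar> \<le> \<alpha> * (\<bar>\<delta>\<bar> * (sqrt (real M) * q))"
        using g_scalar_prod_le[OF x' y] \<alpha>_pos by (simp add: abs_mult q_def mult_left_mono)
      also have "\<dots> = \<alpha> * (\<bar>\<delta>\<bar> * sqrt (real M)) * q" by simp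
      also have "\<dots> \<le> 1 / 10 * (\<mu> / 10) * q"
        using \<alpha>_pos \<alpha>_le \<delta>M \<mu>(1) q0 by (intro mult_right_mono mult_mono) auto
      finally show ?thesis by simp
    qed
    have b4: "\<bar>\<alpha> * \<alpha> * \<mu> * hu\<bar> \<le> 11 / 1000 * (\<mu> * q)"
    proof -
      have "\<bar>\<alpha> * \<alpha> * \<mu> * hu\<bar> \<le> \<alpha> * \<alpha> * \<mu> * (n * (11 / 10 * q))"
        using H_scalar_prod_le[OF x u y] mult_left_mono[OF nq n0] \<alpha>_pos \<mu>(1)
        by (simp add: abs_mult hu_def n_def mult_left_mono order_trans)
      also have "\<dots> = \<alpha> * (\<alpha> * n) * (11 / 10 * (\<mu> * q))" by simp
      also have "\<dots> \<le> 1 / 10 * (1 / 10) * (11 / 10 * (\<mu> * q))"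
        using \<alpha>_pos \<alpha>_le \<alpha>n n0 \<mu>(1) q0 by (intro mult_right_mono mult_mono) auto
      finally show ?thesis by simp
    qed
    have "\<bar>(s' + \<mu>' \<cdot>\<^sub>v g x') \<bullet> y\<bar> \<le> (1 - \<alpha>) * \<bar>\<psi> y\<bar> + (1 - \<alpha>) * \<bar>\<mu> * err\<bar>
        + (1 - \<alpha>) * \<bar>\<alpha> * (\<delta> * (g x' \<bullet> y))\<bar> + \<bar>\<alpha> * \<alpha> * \<mu> * hu\<bar>"
    proof -
      have e: "(1 - \<alpha>) * \<bar>t\<bar> = \<bar>(1 - \<alpha>) * t\<bar>" for t using \<alpha>_le by (simp add: abs_mult)
      show ?thesis unfolding dec e by linarith
    qed
    also have "\<dots> \<le> (1 - \<alpha>) * (11 / 100 * (\<mu> * q)) + (1 - \<alpha>) * (1 / 100 * (\<mu> * q))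
        + (1 - \<alpha>) * (1 / 100 * (\<mu> * q)) + 11 / 1000 * (\<mu> * q)"
      using b1 b2 b3 b4 \<alpha>_le by (intro add_mono mult_left_mono) auto
    \<comment> \<open>As \<open>\<alpha> \<le> 1 / 10\<close>, the last term fits under the factor
      \<open>1 - \<alpha>\<close>. The number 198/1000 is 1/5 times 99/100, the latter being the
      loss in the lower bound for \<open>\<mu>'\<close>.\<close>
    also have "\<dots> \<le> 198 / 1000 * ((1 - \<alpha>) * (\<mu> * q))"
    proof -
      have "0 \<le> \<mu> * q" using \<mu>(1) q0 by simp
      then have "9 / 10 * (\<mu> * q) \<le> (1 - \<alpha>) * (\<mu> * q)" using \<alpha>_le by (intro mult_right_mono) auto
      then show ?thesis using \<open>0 \<le> \<mu> * q\<close> by linarith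
    qed
    also have "\<dots> = 1 / 5 * ((1 - \<alpha>) * \<mu> * (99 / 100)) * q" by simp
    also have "\<dots> \<le> 1 / 5 * \<mu>' * q" by (intro mult_right_mono mult_left_mono \<mu>'_ge q0) simp
    finally show "\<bar>(s' + \<mu>' \<cdot>\<^sub>v g x') \<bullet> y\<bar> \<le> 1 / 5 * \<mu>' * nrm x' y" by (simp add: q_def)
  qed
qed

text \<open>Testing the Newton equation with \<open>u\<close>, where
  \<open>u \<bullet> v = 0\<close>, gives \<open>\<mu> * n\<^sup>2 \<le> 1 / 5 * \<mu> * n\<close>,
  so \<open>n \<le> 1 / 5\<close>. The full step cancels the deviation to first order; the Taylor
  remainder and the change of \<open>\<mu>\<close> each contribute at most
  \<open>\<mu> * n\<^sup>2\<close> in the new dual norm.\<close>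

lemma corrector_estimate:
  fixes \<mu> :: real
  assumes x: "x \<in> dom" and s: "s \<in> carrier_vec m" and u: "u \<in> carrier_vec m" and v: "v \<in> carrier_vec m"
    and M: "M > 0" and \<mu>: "\<mu> > 0" "x \<bullet> s = real M * \<mu>"
    and eq: "v + \<mu> \<cdot>\<^sub>v (H x *\<^sub>v u) = - (s + \<mu> \<cdot>\<^sub>v g x)" and orth: "u \<bullet> v = 0"
    and near: "dual_le x (s + \<mu> \<cdot>\<^sub>v g x) (1 / 5 * \<mu>)"
  defines "x' \<equiv> x + u" and "s' \<equiv> s + v"
  defines "\<mu>' \<equiv> (x' \<bullet> s') / real M"
  shows "x' \<in> dom" "\<mu>' > 0" "\<mu>' \<le> \<mu>" "dual_le x' (s' + \<mu>' \<cdot>\<^sub>v g x') (1 / 10 * \<mu>')"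
proof -
  note xc [simp] = domD(1)[OF x] and s [simp] and u [simp] and v [simp]
  define n where "n = nrm x u"
  have M1: "real M \<ge> 1" using M by simp
  then have sM: "sqrt (real M) \<ge> 1" by simp
  have vy: "v \<bullet> y = - (s \<bullet> y) - \<mu> * (g x \<bullet> y) - \<mu> * ((H x *\<^sub>v u) \<bullet> y)" if y: "y \<in> carrier_vec m" for y
  proof -
    have "(v + \<mu> \<cdot>\<^sub>v (H x *\<^sub>v u)) \<bullet> y = v \<bullet> y + \<mu> * ((H x *\<^sub>v u) \<bullet> y)"
      using y by (simp add: add_scalar_prod_distrib[of _ m])
    moreover have "(- (s + \<mu> \<cdot>\<^sub>v g x)) \<bullet> y = - (s \<bullet> y) - \<mu> * (g x \<bullet> y)"
      using y s by (simp add: add_scalar_prod_distrib[of _ m])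
    ultimately show ?thesis unfolding eq by simp
  qed
  have near_u: "\<bar>s \<bullet> u + \<mu> * (g x \<bullet> u)\<bar> \<le> 1 / 5 * \<mu> * n"
    using near u unfolding dual_le_def n_def by (simp add: add_scalar_prod_distrib[of _ m])
  have Hu: "(H x *\<^sub>v u) \<bullet> x = - (g x \<bullet> u)" "(H x *\<^sub>v u) \<bullet> u = n\<^sup>2"
    using H_scalar_prod_self[OF x u] H_scalar_prod_quadratic[OF x u] by (simp_all add: n_def)
  have n0: "n \<ge> 0" by (simp add: n_def)
  have "v \<bullet> u = 0" using orth comm_scalar_prod[of u m v] by simp
  then have "\<mu> * n\<^sup>2 = - (s \<bullet> u + \<mu> * (g x \<bullet> u))" by (simp add: vy Hu)
  with near_u have "\<mu> * n\<^sup>2 \<le> 1 / 5 * \<mu> * n" by linarith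
  then have "n * n \<le> 1 / 5 * n" using \<mu>(1) by (simp add: power2_eq_square)
  then have n_le: "n \<le> 1 / 5" using n0 mult_right_le_imp_le[of n n "1 / 5"] by (cases "n = 0") auto
  have n2: "n\<^sup>2 \<le> 1 / 25" using power_mono[OF n_le n0, of 2] by (simp add: power2_eq_square)
  show x': "x' \<in> dom"
    unfolding x'_def using n_le by (intro dom_add[OF x u]) (simp add: n_def)
  have x'c [simp]: "x' \<in> carrier_vec m" by (rule domD(1)[OF x'])
  have s'c [simp]: "s' \<in> carrier_vec m" by (simp add: s'_def)
  have s'y: "s' \<bullet> y = - \<mu> * (g x \<bullet> y + (H x *\<^sub>v u) \<bullet> y)" if y: "y \<in> carrier_vec m" for y
    using y by (simp add: s'_def add_scalar_prod_distrib[of _ m] vy algebra_simps)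
  have "x' \<bullet> s' = s' \<bullet> x'" by (rule comm_scalar_prod[OF x'c s'c])
  also have "\<dots> = s' \<bullet> x + s' \<bullet> u"
    unfolding x'_def by (simp add: scalar_prod_add_distrib[of _ m] scalar_prod_smult_distrib[OF s'c u])
  also have "\<dots> = \<mu> * (real M - n\<^sup>2)" by (simp add: s'y Hu g_self[OF x] algebra_simps)
  finally have xs: "x' \<bullet> s' = \<mu> * (real M - n\<^sup>2)" .
  define \<delta> where "\<delta> = n\<^sup>2 / real M"
  have \<delta>0: "\<delta> \<ge> 0" by (simp add: \<delta>_def)
  have \<delta>_le: "\<delta> \<le> n\<^sup>2" using M1 mult_left_mono[OF M1, of "n\<^sup>2"] M by (simp add: \<delta>_def field_simps)
  have \<mu>'_eq: "\<mu>' = \<mu> * (1 - \<delta>)"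
    unfolding \<mu>'_def xs \<delta>_def using M by (simp add: field_simps)
  have \<mu>'_ge: "\<mu>' \<ge> 24 / 25 * \<mu>"
    unfolding \<mu>'_eq using \<delta>_le n2 \<mu>(1) mult_left_mono[of "24 / 25" "1 - \<delta>" \<mu>] by simp
  then show "\<mu>' > 0" using \<mu>(1) by linarith
  show "\<mu>' \<le> \<mu>" unfolding \<mu>'_eq using \<delta>0 \<mu>(1) by (simp add: mult_le_cancel_left1)
  have \<delta>M: "\<delta> * sqrt (real M) \<le> n\<^sup>2"
  proof -
    have "\<delta> * sqrt (real M) * sqrt (real M) = n\<^sup>2" using M by (simp add: \<delta>_def mult.assoc)
    then show ?thesis using mult_left_mono[OF sM, of "\<delta> * sqrt (real M)"] \<delta>0 by simp
  qed
  show "dual_le x' (s' + \<mu>' \<cdot>\<^sub>v g x') (1 / 10 * \<mu>')"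
    unfolding dual_le_def
  proof
    fix y :: rvec assume y: "y \<in> carrier_vec m"
    define q where "q = nrm x' y"
    define err where "err = (g x' - g x - H x *\<^sub>v u) \<bullet> y"
    have q0: "q \<ge> 0" by (simp add: q_def)
    have err: "err = g x' \<bullet> y - g x \<bullet> y - (H x *\<^sub>v u) \<bullet> y"
      using y by (simp add: err_def minus_scalar_prod_distrib[of _ m])
    have "(s' + \<mu>' \<cdot>\<^sub>v g x') \<bullet> y = s' \<bullet> y + \<mu>' * (g x' \<bullet> y)"
      using y by (simp add: add_scalar_prod_distrib[of _ m])
    also have "\<dots> = \<mu> * err - \<mu> * (\<delta> * (g x' \<bullet> y))"
      unfolding \<mu>'_eq using y by (simp add: s'y err algebra_simps)
    finally have dec: "(s' + \<mu>' \<cdot>\<^sub>v g x') \<bullet> y = \<mu> * err - \<mu> * (\<delta> * (g x' \<bullet> y))" .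
    have b1: "\<bar>err\<bar> \<le> n\<^sup>2 * q"
      using gradient_taylor[OF x u _ y] x' unfolding err_def q_def x'_def n_def by simp
    have "\<bar>\<delta> * (g x' \<bullet> y)\<bar> \<le> \<delta> * (sqrt (real M) * q)"
      using g_scalar_prod_le[OF x' y] \<delta>0 by (simp add: abs_mult q_def mult_left_mono)
    also have "\<dots> \<le> n\<^sup>2 * q" using mult_right_mono[OF \<delta>M q0] by (simp add: mult.assoc)
    finally have b2: "\<bar>\<delta> * (g x' \<bullet> y)\<bar> \<le> n\<^sup>2 * q" .
    have n2q: "n\<^sup>2 * q \<le> 1 / 25 * q" using n2 q0 by (rule mult_right_mono)
    have "\<bar>(s' + \<mu>' \<cdot>\<^sub>v g x') \<bullet> y\<bar> = \<mu> * \<bar>err - \<delta> * (g x' \<bullet> y)\<bar>"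
      unfolding dec using \<mu>(1) by (simp add: abs_mult flip: right_diff_distrib)
    also have "\<dots> \<le> \<mu> * (2 / 25 * q)"
      using b1 b2 n2q \<mu>(1) by (intro mult_left_mono) linarith+
    \<comment> \<open>2/25 = 0.08 lies below 24/250 = 0.096, where 24/25 comes from
      \<open>\<mu>'_ge\<close>.\<close>
    also have "\<dots> \<le> 1 / 10 * (24 / 25 * \<mu>) * q" using \<mu>(1) q0 by simp
    also have "\<dots> \<le> 1 / 10 * \<mu>' * q" by (intro mult_right_mono mult_left_mono \<mu>'_ge q0) simp
    finally show "\<bar>(s' + \<mu>' \<cdot>\<^sub>v g x') \<bullet> y\<bar> \<le> 1 / 10 * \<mu>' * nrm x' y" by (simp add: q_def)
  qed
qed

section \<open>Comparison of the local with the Euclidean norm\<close>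

lemma nrm_le_vnorm:
  assumes x: "x \<in> dom" and y: "y \<in> carrier_vec m"
  shows "nrm x y \<le> sqrt (fnorm (H x)) * vnorm y"
proof (rule power2_le_imp_le)
  have "(nrm x y)\<^sup>2 \<le> fnorm (H x) * (y \<bullet> y)"
    using H_quadratic[OF x y] scalar_prod_mult_mat_le_fnorm[OF H_carrier[of x] y] by linarith
  then show "(nrm x y)\<^sup>2 \<le> (sqrt (fnorm (H x)) * vnorm y)\<^sup>2"
    by (simp add: power_mult_distrib vnorm_def)
qed (simp add: vnorm_def)

text \<open>\<open>y\<close> is \<open>R\<close> applied to \<open>r.T y\<close>, and the length of
  \<open>r.T y\<close> is \<open>nrm x y\<close>. The two comparisons translate between local balls
  and the Euclidean ones in \<open>feasible_interior\<close>.\<close>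

lemma ex_vnorm_le_nrm:
  assumes x: "x \<in> dom"
  obtains C where "C \<ge> 0" "\<And>y. y \<in> carrier_vec m \<Longrightarrow> vnorm y \<le> C * nrm x y"
proof -
  define R where "R = inv_sqrt_mat (H x)"
  note i = inv_sqrt_mat[OF positive_definite_H[OF x], folded R_def]
  have "R * (R * H x) = R * R * H x" by (rule assoc_mult_mat[symmetric, OF i(1) i(1) H_carrier])
  with i interpret r: root_mat m "H x" R by unfold_locales (simp_all add: H_sym[OF x])
  have "vnorm y \<le> fnorm R * nrm x y" if y: "y \<in> carrier_vec m" for y
  proof (rule power2_le_imp_le)
    have "(vnorm y)\<^sup>2 = (R *\<^sub>v (r.T *\<^sub>v y)) \<bullet> (R *\<^sub>v (r.T *\<^sub>v y))"
      using y by (simp add: vnorm_def r.W_T flip: r.assocv)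
    also have "\<dots> \<le> (fnorm R)\<^sup>2 * ((r.T *\<^sub>v y) \<bullet> (r.T *\<^sub>v y))"
      using y by (intro vec_sq_mult_le_fnorm[of _ m m]) simp_all
    also have "(r.T *\<^sub>v y) \<bullet> (r.T *\<^sub>v y) = y \<bullet> (r.T *\<^sub>v (r.T *\<^sub>v y))"
      using transpose_swap_scalar_prod[OF r.T, of "r.T *\<^sub>v y" y] y by (simp add: r.T_sym)
    also have "r.T *\<^sub>v (r.T *\<^sub>v y) = H x *\<^sub>v y"
      using r.assocv[OF r.T r.T y] unfolding r.T_T ..
    finally show "(vnorm y)\<^sup>2 \<le> (fnorm R * nrm x y)\<^sup>2"
      by (simp add: H_quadratic[OF x y] power_mult_distrib)
  qed simp
  then show thesis using that[of "fnorm R"] by simp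
qed

end

section \<open>The algorithm on a log-determinant barrier\<close>

lemma vnorm_nonneg [simp]: "vnorm v \<ge> 0"
  by (simp add: vnorm_def)

lemma vnorm_smult: "vnorm (c \<cdot>\<^sub>v v) = \<bar>c\<bar> * vnorm v"
  by (simp add: vnorm_def real_sqrt_mult mult.assoc[symmetric])

lemma vnorm_zero [simp]: "vnorm (0\<^sub>v n) = 0"
  by (simp add: vnorm_def)

lemma scalar_prod_le_vnorm:
  assumes "v \<in> carrier_vec n" "w \<in> carrier_vec n"
  shows "\<bar>v \<bullet> w\<bar> \<le> vnorm v * vnorm w"
proof (rule power2_le_imp_le)
  show "\<bar>v \<bullet> w\<bar>\<^sup>2 \<le> (vnorm v * vnorm w)\<^sup>2"
    using Cauchy_Schwarz_scalar_prod[OF assms] by (simp add: vnorm_def power_mult_distrib)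
qed simp

lemma skew_scalar_prod:
  fixes A :: rmat
  assumes A: "A \<in> carrier_mat n n" and skew: "\<And>i j. i < n \<Longrightarrow> j < n \<Longrightarrow> A $$ (j, i) = - A $$ (i, j)"
    and v: "v \<in> carrier_vec n" and w: "w \<in> carrier_vec n"
  shows "v \<bullet> (A *\<^sub>v w) = - (w \<bullet> (A *\<^sub>v v))"
proof -
  have e: "p \<bullet> (A *\<^sub>v r) = (\<Sum>i<n. \<Sum>j<n. p $ i * (A $$ (i, j) * r $ j))"
    if "p \<in> carrier_vec n" "r \<in> carrier_vec n" for p r
    using A that by (simp add: scalar_prod_def lessThan_atLeast0 sum_distrib_left)
  have "v \<bullet> (A *\<^sub>v w) = (\<Sum>j<n. \<Sum>i<n. v $ i * (A $$ (i, j) * w $ j))"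
    unfolding e[OF v w] by (rule sum.swap)
  also have "\<dots> = - (w \<bullet> (A *\<^sub>v v))"
    unfolding e[OF w v] sum_negf[symmetric] by (intro sum.cong refl) (subst skew, simp_all)
  finally show ?thesis .
qed

text \<open>The residual shrinks by \<open>1 - a\<close> and \<open>mu\<close> at least by the
  factor \<open>(1 - a) * (1 + a / 10)\<close>; the larger of the two serves for both, so a single
  geometric sequence controls the stopping test.\<close>

lemma contraction_factor_bounds:
  fixes a :: real
  assumes "0 < a" "a \<le> 1 / 10"
  shows "1 - a \<le> (1 - a) * (1 + a / 10)" "(1 - a) * (1 + a / 10) \<le> 1 - 9 / 10 * a"
    "0 \<le> (1 - a) * (1 + a / 10)"
proof -
  show "1 - a \<le> (1 - a) * (1 + a / 10)"
    using mult_left_mono[of 1 "1 + a / 10" "1 - a"] assms by simp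
  have "(1 - a) * (1 + a / 10) = 1 - 9 / 10 * a - a * a / 10" by (simp add: field_simps)
  then show "(1 - a) * (1 + a / 10) \<le> 1 - 9 / 10 * a" by simp
  show "0 \<le> (1 - a) * (1 + a / 10)" using assms by simp
qed

text \<open>What the convergence proof needs to know about a cone: its extension by
  \<open>\<tau>\<close> is the cone of semidefinite pencils, the dual part of the feasible set is
  the dual of that cone, and Euclidean interior points have a positive definite pencil.
  \<open>M\<close> is the barrier parameter of the extended cone.\<close>

locale conic_barrier = logdet_barrier m M E "barrier_ext P" for m M E and P :: conic_problem +
  assumes m_eq: "m = dim_x P + 1" and M_eq: "real M = barrier_param P + 1" and M_pos: "M > 0"
    and matA: "matA P \<in> carrier_mat (dim_y P) (dim_x P)"
    and vecb: "vecb P \<in> carrier_vec (dim_y P)" and vecc: "vecc P \<in> carrier_vec (dim_x P)"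
    and feasible_set_eq: "feasible_set P =
      {x \<in> carrier_vec m. positive_semidefinite M (L x)} \<times> carrier_vec (dim_y P) \<times>
      dual_cone m {x \<in> carrier_vec m. positive_semidefinite M (L x)}"
    and interior_imp_dom: "(x, y, s) \<in> feasible_interior P \<Longrightarrow> x \<in> dom"
begin

abbreviation "k \<equiv> dim_y P"
abbreviation "G \<equiv> Gmat P"

lemma gbar_eq: "gbar P = g"
  unfolding gbar_def g_def m_eq[symmetric] ..

lemma Hbar_eq: "Hbar P = H"
  unfolding Hbar_def H_def m_eq[symmetric] ..

lemma iterate_space_eq: "iterate_space P = carrier_vec m \<times> carrier_vec k \<times> carrier_vec m"
  by (simp add: iterate_space_def m_eq)

lemma mu_eq: "mu P (x, y, s) = (x \<bullet> s) / real M"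
  by (simp add: mu_def M_eq)

lemma psi_eq: "psi P (x, y, s) = s + mu P (x, y, s) \<cdot>\<^sub>v g x"
  by (simp add: psi_def gbar_eq)

lemma G [simp]: "G \<in> carrier_mat (k + m) (k + m)"
proof -
  have "four_block_mat (0\<^sub>m k k) (matA P) (- (matA P)\<^sup>T) (0\<^sub>m (dim_x P) (dim_x P))
      \<in> carrier_mat (k + dim_x P) (k + dim_x P)"
    by (rule four_block_carrier_mat) simp_all
  then have "G \<in> carrier_mat (k + dim_x P + 1) (k + dim_x P + 1)"
    unfolding Gmat_def Let_def by (rule four_block_carrier_mat) simp
  then show ?thesis by (simp add: m_eq)
qed

lemma G_skew:
  assumes "i < k + m" "j < k + m"
  shows "G $$ (j, i) = - G $$ (i, j)"
proof -
  \<comment> \<open>The last row and column have index \<open>k + dim_x P\<close>; the truncated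
    differences state that the index inside the border blocks is 0.\<close>
  have d: "i - (k + dim_x P) = 0" "j - (k + dim_x P) = 0" "dim_vec (vecb P) = k" "dim_vec (vecc P) = dim_x P"
    "dim_row (matA P) = k" "dim_col (matA P) = dim_x P"
    using assms vecb vecc matA by (auto simp: m_eq)
  show ?thesis
    using assms d unfolding Gmat_def Let_def
    by (auto simp: m_eq mat_of_cols_index mat_of_rows_index)
qed

lemma G_orthogonal:
  assumes "w \<in> carrier_vec (k + m)"
  shows "w \<bullet> (G *\<^sub>v w) = 0"
  using skew_scalar_prod[OF G G_skew assms assms] by simp

lemma G_mult [simp]: "w \<in> carrier_vec (k + m) \<Longrightarrow> G *\<^sub>v w \<in> carrier_vec (k + m)"
  by (rule mult_mat_vec_carrier[OF G])

lemma residual_eq: "residual P (x, y, s) = G *\<^sub>v (y @\<^sub>v x) - (0\<^sub>v k @\<^sub>v s)"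
  by (simp add: residual_def)

lemma residual_carrier [simp]:
  assumes "x \<in> carrier_vec m" "y \<in> carrier_vec k" "s \<in> carrier_vec m"
  shows "residual P (x, y, s) \<in> carrier_vec (k + m)"
  unfolding residual_eq using assms by simp

lemma residual_add_smult:
  assumes "x \<in> carrier_vec m" "y \<in> carrier_vec k" "s \<in> carrier_vec m"
    and "dx \<in> carrier_vec m" "dy \<in> carrier_vec k" "ds \<in> carrier_vec m"
  shows "residual P (x + \<alpha> \<cdot>\<^sub>v dx, y + \<alpha> \<cdot>\<^sub>v dy, s + \<alpha> \<cdot>\<^sub>v ds) =
    residual P (x, y, s) + \<alpha> \<cdot>\<^sub>v residual P (dx, dy, ds)"
proof -
  have yx: "(y + \<alpha> \<cdot>\<^sub>v dy) @\<^sub>v (x + \<alpha> \<cdot>\<^sub>v dx) = (y @\<^sub>v x) + \<alpha> \<cdot>\<^sub>v (dy @\<^sub>v dx)"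
    using assms by (intro eq_vecI) auto
  have s: "0\<^sub>v k @\<^sub>v (s + \<alpha> \<cdot>\<^sub>v ds) = (0\<^sub>v k @\<^sub>v s) + \<alpha> \<cdot>\<^sub>v (0\<^sub>v k @\<^sub>v ds)"
    using assms by (intro eq_vecI) auto
  have c: "y @\<^sub>v x \<in> carrier_vec (k + m)" "dy @\<^sub>v dx \<in> carrier_vec (k + m)"
    "0\<^sub>v k @\<^sub>v s \<in> carrier_vec (k + m)" "0\<^sub>v k @\<^sub>v ds \<in> carrier_vec (k + m)"
    using assms by simp_all
  have lin: "G *\<^sub>v ((y @\<^sub>v x) + \<alpha> \<cdot>\<^sub>v (dy @\<^sub>v dx)) = G *\<^sub>v (y @\<^sub>v x) + \<alpha> \<cdot>\<^sub>v (G *\<^sub>v (dy @\<^sub>v dx))"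
    using mult_add_distrib_mat_vec[OF G c(1), of "\<alpha> \<cdot>\<^sub>v (dy @\<^sub>v dx)"] mult_mat_vec[OF G c(2)] c(2) by simp
  have gen: "(p + \<alpha> \<cdot>\<^sub>v p') - (r + \<alpha> \<cdot>\<^sub>v r') = (p - r) + \<alpha> \<cdot>\<^sub>v (p' - r')"
    if "p \<in> carrier_vec n" "p' \<in> carrier_vec n" "r \<in> carrier_vec n" "r' \<in> carrier_vec n" for p p' r r' :: rvec and n
    using that by (intro eq_vecI) (auto simp: algebra_simps)
  show ?thesis
    unfolding residual_eq yx s lin by (rule gen[OF G_mult[OF c(1)] G_mult[OF c(2)] c(3,4)])
qed

text \<open>Zero residual means that \<open>G\<close> maps the pair (y, x) to (0, s), and
  skew-symmetry kills the pairing. It is applied to the corrector direction itself and to the end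
  point of the full predictor step.\<close>

lemma residual_0_orthogonal:
  assumes x: "x \<in> carrier_vec m" and y: "y \<in> carrier_vec k" and s: "s \<in> carrier_vec m"
    and res: "residual P (x, y, s) = 0\<^sub>v (k + m)"
  shows "x \<bullet> s = 0"
proof -
  have c: "y @\<^sub>v x \<in> carrier_vec (k + m)" "0\<^sub>v k @\<^sub>v s \<in> carrier_vec (k + m)" using assms by simp_all
  have "G *\<^sub>v (y @\<^sub>v x) = 0\<^sub>v k @\<^sub>v s"
  proof (rule eq_vecI)
    fix i assume "i < dim_vec (0\<^sub>v k @\<^sub>v s)"
    then have i: "i < k + m" using s by simp
    have "(G *\<^sub>v (y @\<^sub>v x) - (0\<^sub>v k @\<^sub>v s)) $ i = 0" using res i unfolding residual_eq by simp
    then show "(G *\<^sub>v (y @\<^sub>v x)) $ i = (0\<^sub>v k @\<^sub>v s) $ i"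
      using i carrier_vecD[OF c(2)] by simp
  qed (use carrier_vecD[OF c(2)] carrier_vecD[OF G_mult[OF c(1)]] in simp)
  then have "0 = (y @\<^sub>v x) \<bullet> (0\<^sub>v k @\<^sub>v s)" using G_orthogonal[OF c(1)] by simp
  also have "\<dots> = y \<bullet> 0\<^sub>v k + x \<bullet> s" by (rule scalar_prod_append[OF y x zero_carrier_vec s])
  finally show ?thesis using y by simp
qed

text \<open>The kernel of the transposed Newton matrix consists of vectors \<open>(v, 0)\<close> in the kernel of
  \<open>G\<close>, which are orthogonal to both right-hand sides.\<close>

lemma ex_Newton_solution:
  assumes x: "x \<in> dom" and \<mu>: "\<mu> > 0" and r: "r \<in> carrier_vec (k + m)"
    and orth: "\<And>v. v \<in> carrier_vec k \<Longrightarrow> G *\<^sub>v (v @\<^sub>v 0\<^sub>v m) = 0\<^sub>v (k + m) \<Longrightarrow> (v @\<^sub>v 0\<^sub>v m) \<bullet> r = 0"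
  obtains dy dx where "dy \<in> carrier_vec k" "dx \<in> carrier_vec m"
    "G *\<^sub>v (dy @\<^sub>v dx) + (0\<^sub>v k @\<^sub>v \<mu> \<cdot>\<^sub>v (H x *\<^sub>v dx)) = r"
proof -
  \<comment> \<open>Eliminating \<open>ds\<close> leaves a square system with matrix
    \<open>G + D\<close> for \<open>dy\<close> and \<open>dx\<close> together.\<close>
  define D where "D = four_block_mat (0\<^sub>m k k) (0\<^sub>m k m) (0\<^sub>m m k) (\<mu> \<cdot>\<^sub>m H x)"
  define B where "B = G + D"
  have Hx: "\<mu> \<cdot>\<^sub>m H x \<in> carrier_mat m m" by simp
  have D [simp]: "D \<in> carrier_mat (k + m) (k + m)"
    unfolding D_def by (rule four_block_carrier_mat) simp_all
  have B [simp]: "B \<in> carrier_mat (k + m) (k + m)" by (simp add: B_def)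
  have Dv: "D *\<^sub>v (y @\<^sub>v u) = 0\<^sub>v k @\<^sub>v \<mu> \<cdot>\<^sub>v (H x *\<^sub>v u)" if "y \<in> carrier_vec k" "u \<in> carrier_vec m" for y u
  proof -
    have "D *\<^sub>v (y @\<^sub>v u) = 0\<^sub>m k k *\<^sub>v y @\<^sub>v (\<mu> \<cdot>\<^sub>m H x) *\<^sub>v u"
      unfolding D_def by (rule mult_mat_vec_split[OF zero_carrier_mat Hx that])
    also have "0\<^sub>m k k *\<^sub>v y = 0\<^sub>v k" using that by (intro eq_vecI) simp_all
    also have "(\<mu> \<cdot>\<^sub>m H x) *\<^sub>v u = \<mu> \<cdot>\<^sub>v (H x *\<^sub>v u)"
      using that by (intro eq_vecI) (simp_all add: row_carrier_vec[OF _ H_carrier])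
    finally show ?thesis .
  qed
  have Bw: "B *\<^sub>v (y @\<^sub>v u) = G *\<^sub>v (y @\<^sub>v u) + (0\<^sub>v k @\<^sub>v \<mu> \<cdot>\<^sub>v (H x *\<^sub>v u))"
    if "y \<in> carrier_vec k" "u \<in> carrier_vec m" for y u
    unfolding B_def using add_mult_distrib_mat_vec[OF G D, of "y @\<^sub>v u"] Dv[OF that] that by simp
  have Gt: "G\<^sup>T *\<^sub>v w = - (G *\<^sub>v w)" if w: "w \<in> carrier_vec (k + m)" for w
  proof (rule eq_vecI)
    fix i assume "i < dim_vec (- (G *\<^sub>v w))"
    then have i: "i < k + m" using carrier_matD[OF G] by simp
    have "(G\<^sup>T *\<^sub>v w) $ i = (\<Sum>j<k + m. G $$ (j, i) * w $ j)"
      using i w carrier_matD[OF G] by (simp add: scalar_prod_def lessThan_atLeast0)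
    also have "\<dots> = - (\<Sum>j<k + m. G $$ (i, j) * w $ j)"
      unfolding sum_negf[symmetric] using i by (intro sum.cong refl) (simp add: G_skew[of i])
    also have "\<dots> = (- (G *\<^sub>v w)) $ i"
      using i w carrier_matD[OF G] by (simp add: scalar_prod_def lessThan_atLeast0)
    finally show "(G\<^sup>T *\<^sub>v w) $ i = (- (G *\<^sub>v w)) $ i" .
  qed (use carrier_matD[OF G] in simp)
  have "H x $$ (j, i) = H x $$ (i, j)" if "i < m" "j < m" for i j
    using arg_cong[OF H_sym[OF x], of "\<lambda>A. A $$ (i, j)"] that by simp
  then have Ht: "(\<mu> \<cdot>\<^sub>m H x)\<^sup>T = \<mu> \<cdot>\<^sub>m H x" by (intro eq_matI) simp_all
  have Dt: "D\<^sup>T = D"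
    unfolding D_def
    by (subst transpose_four_block_mat[OF zero_carrier_mat zero_carrier_mat zero_carrier_mat Hx])
      (simp add: Ht)
  have Bt: "B\<^sup>T *\<^sub>v w = - (G *\<^sub>v w) + D *\<^sub>v w" if w: "w \<in> carrier_vec (k + m)" for w
    unfolding B_def transpose_add[OF G D] Dt
    using add_mult_distrib_mat_vec[of "G\<^sup>T" "k + m" "k + m" D w] w Gt[OF w] by simp
  have "w \<bullet> r = 0" if w: "w \<in> carrier_vec (k + m)" and ker: "B\<^sup>T *\<^sub>v w = 0\<^sub>v (k + m)" for w
  proof -
    define y where "y = vec_first w k"
    define u where "u = vec_last w m"
    have yu: "y \<in> carrier_vec k" "u \<in> carrier_vec m" "w = y @\<^sub>v u"
      using w by (simp_all add: y_def u_def)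
    have cD: "D *\<^sub>v w \<in> carrier_vec (k + m)" using w by (rule mult_mat_vec_carrier[OF D])
    \<comment> \<open>Pairing with \<open>w\<close> removes the skew part and leaves
      \<open>\<mu>\<close> times the squared local norm of \<open>u\<close>.\<close>
    have "0 = w \<bullet> (B\<^sup>T *\<^sub>v w)" using ker w by simp
    also have "\<dots> = - (w \<bullet> (G *\<^sub>v w)) + w \<bullet> (D *\<^sub>v w)"
      unfolding Bt[OF w] using w cD
      by (simp add: scalar_prod_add_distrib[of _ "k + m"] scalar_prod_uminus_right carrier_matD[OF G])
    also have "\<dots> = w \<bullet> (D *\<^sub>v w)" using G_orthogonal[OF w] by simp
    also have "\<dots> = (y @\<^sub>v u) \<bullet> (0\<^sub>v k @\<^sub>v \<mu> \<cdot>\<^sub>v (H x *\<^sub>v u))" unfolding yu(3) Dv[OF yu(1,2)] ..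
    also have "\<dots> = y \<bullet> 0\<^sub>v k + u \<bullet> (\<mu> \<cdot>\<^sub>v (H x *\<^sub>v u))"
      by (rule scalar_prod_append[OF yu(1,2) zero_carrier_vec]) (simp add: yu)
    also have "\<dots> = \<mu> * (nrm x u)\<^sup>2" using yu H_quadratic[OF x yu(2)] by simp
    finally have "nrm x u = 0" using \<mu> by simp
    then have u0: "u = 0\<^sub>v m" using nrm_0_iff[OF x yu(2)] by simp
    have "H x *\<^sub>v 0\<^sub>v m = 0\<^sub>v m" by (intro eq_vecI) (simp_all add: row_carrier_vec[OF _ H_carrier])
    then have "0\<^sub>v k @\<^sub>v \<mu> \<cdot>\<^sub>v (H x *\<^sub>v u) = 0\<^sub>v (k + m)" unfolding u0 by (intro eq_vecI) auto
    then have "D *\<^sub>v w = 0\<^sub>v (k + m)" unfolding yu(3) Dv[OF yu(1,2)] .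
    then have "- (G *\<^sub>v w) = 0\<^sub>v (k + m)" using ker Bt[OF w] w by simp
    then have "G *\<^sub>v w = 0\<^sub>v (k + m)" by (metis uminus_uminus_vec uminus_zero_vec)
    then show ?thesis using orth[OF yu(1)] by (simp add: yu(3) u0)
  qed
  then obtain w where w: "w \<in> carrier_vec (k + m)" "B *\<^sub>v w = r"
    using Fredholm_alternative[OF B r] by blast
  have "w = vec_first w k @\<^sub>v vec_last w m" using w by simp
  with w Bw[of "vec_first w k" "vec_last w m"] show thesis
    by (intro that[of "vec_first w k" "vec_last w m"]) simp_all
qed

section \<open>Interior points and the neighbourhood of the central path\<close>

lemma interior_iterate:
  assumes "(x, y, s) \<in> feasible_interior P"
  shows "x \<in> carrier_vec m" "y \<in> carrier_vec k" "s \<in> carrier_vec m"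
  using assms by (auto simp: feasible_interior_def iterate_space_eq)

lemma interior_subset: "feasible_interior P \<subseteq> feasible_set P"
proof
  fix z assume z: "z \<in> feasible_interior P"
  obtain x y s where zz: "z = (x, y, s)" by (cases z)
  note c = interior_iterate[OF z[unfolded zz]]
  then have d: "x - x = 0\<^sub>v m" "y - y = 0\<^sub>v k" "s - s = 0\<^sub>v m" by auto
  show "z \<in> feasible_set P"
    using z c unfolding zz feasible_interior_def iterate_space_eq by (auto simp: d)
qed

text \<open>An interior \<open>s\<close> stays in the dual cone after subtraction of a small
  multiple \<open>t\<close> of \<open>x\<close>; pairing with the cone element \<open>x\<close>
  gives \<open>x \<bullet> s \<ge> t * (x \<bullet> x)\<close>.\<close>

lemma mu_pos:
  assumes z: "(x, y, s) \<in> feasible_interior P"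
  shows "mu P (x, y, s) > 0"
proof -
  note c = interior_iterate[OF z]
  have x: "x \<in> dom" by (rule interior_imp_dom[OF z])
  have x0: "x \<noteq> 0\<^sub>v m" using nrm_self[OF x] nrm_0_iff[OF x c(1)] M_pos by auto
  obtain e where e: "e > 0" "\<And>x' y' s'. (x', y', s') \<in> iterate_space P \<Longrightarrow> vnorm (x' - x) < e \<Longrightarrow>
      vnorm (y' - y) < e \<Longrightarrow> vnorm (s' - s) < e \<Longrightarrow> (x', y', s') \<in> feasible_set P"
    using z unfolding feasible_interior_def by blast
  define t where "t = e / (vnorm x + 1)"
  have v1: "vnorm x + 1 > 0" using vnorm_nonneg[of x] by linarith
  have t: "t > 0" using e(1) v1 by (simp add: t_def)
  have "t * (vnorm x + 1) = e" using v1 by (simp add: t_def)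
  then have tv: "t * vnorm x < e" using t by (simp add: distrib_left)
  have s': "(s - t \<cdot>\<^sub>v x) - s = (- t) \<cdot>\<^sub>v x" using c by (intro eq_vecI) auto
  have d: "x - x = 0\<^sub>v m" "y - y = 0\<^sub>v k" using c by auto
  have "(x, y, s - t \<cdot>\<^sub>v x) \<in> feasible_set P"
    using c e(1) t tv by (intro e(2)) (simp_all add: iterate_space_eq s' vnorm_smult d)
  then have "x \<bullet> (s - t \<cdot>\<^sub>v x) \<ge> 0" by (auto simp: feasible_set_eq dual_cone_def)
  then have "x \<bullet> s \<ge> t * (x \<bullet> x)" using c by (simp add: scalar_prod_minus_distrib[of _ m])
  moreover have "t * (x \<bullet> x) > 0" using t scalar_prod_self_pos[OF c(1) x0] by simp
  ultimately show ?thesis using M_pos by (simp add: mu_eq)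
qed

text \<open>By \<open>nrm_le_minus_g\<close>, a deviation of \<open>s\<close> from
  \<open>- \<mu> g x\<close> of at most \<open>\<theta> * \<mu>\<close> with
  \<open>\<theta> < 1\<close> still leaves
  \<open>s \<bullet> w \<ge> (1 - \<theta>) * \<mu> * nrm x w\<close> for all \<open>w\<close> in
  the cone. This margin absorbs every small perturbation of \<open>s\<close>.\<close>

lemma interiorI:
  assumes x: "x \<in> dom" and y: "y \<in> carrier_vec k" and s: "s \<in> carrier_vec m"
    and \<mu>: "\<mu> > 0" and \<theta>: "\<theta> < 1" and near: "dual_le x (s + \<mu> \<cdot>\<^sub>v g x) (\<theta> * \<mu>)"
  shows "(x, y, s) \<in> feasible_interior P"
proof -
  note xc [simp] = domD(1)[OF x]
  obtain C where C: "C \<ge> 0" "\<And>y. y \<in> carrier_vec m \<Longrightarrow> vnorm y \<le> C * nrm x y"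
    using ex_vnorm_le_nrm[OF x] by blast
  define B where "B = sqrt (fnorm (H x))"
  have B: "B \<ge> 0" by (simp add: B_def)
  \<comment> \<open>The first entry keeps \<open>x'\<close> in the local unit ball around
    \<open>x\<close>, the second keeps the change of \<open>s\<close> below the margin. Adding 1 to
    \<open>B\<close> and \<open>C\<close> avoids zero denominators.\<close>
  define e where "e = min (1 / (B + 1)) ((1 - \<theta>) * \<mu> / (C + 1))"
  have e: "e > 0" using B C(1) \<mu> \<theta> by (simp add: e_def)
  have sw: "s \<bullet> w \<ge> (1 - \<theta>) * \<mu> * nrm x w" if w: "w \<in> carrier_vec m" "positive_semidefinite M (L w)" for w
  proof -
    have "\<bar>s \<bullet> w + \<mu> * (g x \<bullet> w)\<bar> \<le> \<theta> * \<mu> * nrm x w"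
      using near w s unfolding dual_le_def by (simp add: add_scalar_prod_distrib[of _ m])
    moreover have "\<mu> * nrm x w \<le> - (\<mu> * (g x \<bullet> w))"
      using mult_left_mono[OF nrm_le_minus_g[OF x w], of \<mu>] \<mu> by simp
    ultimately show ?thesis by (simp add: algebra_simps)
  qed
  have "(x', y', s') \<in> feasible_set P"
    if c: "x' \<in> carrier_vec m" "y' \<in> carrier_vec k" "s' \<in> carrier_vec m"
      and near': "vnorm (x' - x) < e" "vnorm (s' - s) < e" for x' y' s'
  proof -
    have "nrm x (x' - x) \<le> B * vnorm (x' - x)"
      unfolding B_def using c by (intro nrm_le_vnorm[OF x]) simp
    also have "\<dots> \<le> B * (1 / (B + 1))" using near' B by (intro mult_left_mono) (auto simp: e_def)
    also have "\<dots> < 1" using B by (simp add: field_simps)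
    finally have "x + (x' - x) \<in> dom" using c by (intro dom_add[OF x]) simp_all
    also have "x + (x' - x) = x'" by (intro eq_vecI) (simp_all add: carrier_vecD[OF xc] carrier_vecD[OF c(1)])
    finally have x': "positive_semidefinite M (L x')"
      using domD positive_definite_imp_semidefinite by blast
    have "w \<bullet> s' \<ge> 0" if w: "w \<in> carrier_vec m" "positive_semidefinite M (L w)" for w
    proof -
      have "s' = s + (s' - s)" using c s by (intro eq_vecI) auto
      then have "s' \<bullet> w = s \<bullet> w + (s' - s) \<bullet> w"
        using c s w add_scalar_prod_distrib[of s m "s' - s" w] by simp
      moreover have "\<bar>(s' - s) \<bullet> w\<bar> \<le> (1 - \<theta>) * \<mu> * nrm x w"
      proof -
        have "\<bar>(s' - s) \<bullet> w\<bar> \<le> vnorm (s' - s) * vnorm w"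
          using c s w by (intro scalar_prod_le_vnorm[of _ m]) simp_all
        also have "\<dots> \<le> (1 - \<theta>) * \<mu> / (C + 1) * (C * nrm x w)"
          using near'(2) C w \<mu> \<theta> by (intro mult_mono) (auto simp: e_def)
        also have "\<dots> = (1 - \<theta>) * \<mu> * nrm x w * (C / (C + 1))" by simp
        also have "\<dots> \<le> (1 - \<theta>) * \<mu> * nrm x w * 1"
          using C(1) \<mu> \<theta> by (intro mult_left_mono) auto
        finally show ?thesis by simp
      qed
      ultimately have "s' \<bullet> w \<ge> 0" using sw[OF w] by linarith
      then show ?thesis using comm_scalar_prod[OF c(3) w(1)] by simp
    qed
    then show ?thesis using c x' by (auto simp: feasible_set_eq dual_cone_def)
  qed
  then show ?thesis
    unfolding feasible_interior_def iterate_space_eq using e y s by (auto intro!: exI[of _ e])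
qed

lemma neighborhood_iff:
  assumes "\<theta> \<ge> 0"
  shows "(x, y, s) \<in> neighborhood P \<theta> \<longleftrightarrow> (x, y, s) \<in> feasible_interior P \<and>
    dual_le x (s + mu P (x, y, s) \<cdot>\<^sub>v g x) (\<theta> * mu P (x, y, s))"
proof (cases "(x, y, s) \<in> feasible_interior P")
  case True
  note c = interior_iterate[OF True]
  have "0 \<le> \<theta> * mu P (x, y, s)" using mu_pos[OF True] assms by simp
  with dual_le_iff[OF interior_imp_dom[OF True] _ this, of "s + mu P (x, y, s) \<cdot>\<^sub>v g x"] True c
  show ?thesis by (simp add: neighborhood_def Hbar_eq psi_eq)
qed (simp add: neighborhood_def)

text \<open>Bookkeeping for the elimination of \<open>ds\<close>: with \<open>ds = - s - h\<close>,
  where \<open>h\<close> stands for \<open>\<mu> H dx\<close>, the reduced equation becomes the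
  residual equation of a step.\<close>

lemma shift_residual:
  assumes "p \<in> carrier_vec (k + m)" "r \<in> carrier_vec (k + m)" "h \<in> carrier_vec m" "s \<in> carrier_vec m"
    and eq: "p + (0\<^sub>v k @\<^sub>v h) = - (r :: rvec)"
  shows "p - (0\<^sub>v k @\<^sub>v (- s - h)) = - (r - (0\<^sub>v k @\<^sub>v s))"
proof (rule eq_vecI)
  have d: "dim_vec p = k + m" "dim_vec r = k + m" "dim_vec h = m" "dim_vec s = m" using assms by simp_all
  fix i assume "i < dim_vec (- (r - (0\<^sub>v k @\<^sub>v s)))"
  then have i: "i < k + m" by (simp add: d)
  have "(p + (0\<^sub>v k @\<^sub>v h)) $ i = (- r) $ i" unfolding eq ..
  then show "(p - (0\<^sub>v k @\<^sub>v (- s - h))) $ i = (- (r - (0\<^sub>v k @\<^sub>v s))) $ i"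
    using i by (auto simp: d)
qed (use assms in simp)

section \<open>One iteration of the algorithm and its repetition\<close>

abbreviation (input) \<alpha> :: real where "\<alpha> \<equiv> 1 / (10 * sqrt (real M))"

lemma \<alpha>_bounds: "0 < \<alpha>" "\<alpha> \<le> 1 / 10"
  using M_pos by (simp_all add: field_simps)

lemma prediction_step_iff:
  "prediction_step P a (x, y, s) z' \<longleftrightarrow> (x, y, s) \<in> feasible_interior P \<and>
    (\<exists>dx dy ds. dx \<in> carrier_vec m \<and> dy \<in> carrier_vec k \<and> ds \<in> carrier_vec m \<and>
      residual P (dx, dy, ds) = - residual P (x, y, s) \<and>
      ds + mu P (x, y, s) \<cdot>\<^sub>v (H x *\<^sub>v dx) = - s \<and>
      z' = (x + a \<cdot>\<^sub>v dx, y + a \<cdot>\<^sub>v dy, s + a \<cdot>\<^sub>v ds))"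
  by (simp add: prediction_step_def iterate_space_eq Hbar_eq move_def)

lemma correction_step_iff:
  "correction_step P a (x, y, s) z' \<longleftrightarrow> (x, y, s) \<in> feasible_interior P \<and>
    (\<exists>dx dy ds. dx \<in> carrier_vec m \<and> dy \<in> carrier_vec k \<and> ds \<in> carrier_vec m \<and>
      residual P (dx, dy, ds) = 0\<^sub>v (k + m) \<and>
      ds + mu P (x, y, s) \<cdot>\<^sub>v (H x *\<^sub>v dx) = - (s + mu P (x, y, s) \<cdot>\<^sub>v g x) \<and>
      z' = (x + a \<cdot>\<^sub>v dx, y + a \<cdot>\<^sub>v dy, s + a \<cdot>\<^sub>v ds))"
proof -
  have e: "dim_y P + dim_x P + 1 = k + m" by (simp add: m_eq)
  show ?thesis
    unfolding correction_step_def prod.case e iterate_space_eq Hbar_eq psi_eq by (simp add: move_def)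
qed

lemma surely_prediction:
  assumes z: "z \<in> neighborhood P (1 / 10)"
  shows "surely (prediction_step P \<alpha>) (\<lambda>z'. z' \<in> neighborhood P (1 / 5) \<and>
    mu P z' \<le> (1 - \<alpha>) * (1 + \<alpha> / 10) * mu P z \<and>
    vnorm (residual P z') = (1 - \<alpha>) * vnorm (residual P z)) z"
proof -
  obtain x y s where zz: "z = (x, y, s)" by (cases z)
  have int: "(x, y, s) \<in> feasible_interior P"
    and near: "dual_le x (s + mu P (x, y, s) \<cdot>\<^sub>v g x) (1 / 10 * mu P (x, y, s))"
    using z unfolding zz by (simp_all add: neighborhood_iff)
  note c [simp] = interior_iterate[OF int]
  have x: "x \<in> dom" by (rule interior_imp_dom[OF int])
  define \<mu> where "\<mu> = mu P (x, y, s)"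
  have \<mu>: "\<mu> > 0" unfolding \<mu>_def by (rule mu_pos[OF int])
  have xs: "x \<bullet> s = real M * \<mu>" using M_pos by (simp add: \<mu>_def mu_eq)
  have yx: "y @\<^sub>v x \<in> carrier_vec (k + m)" by simp
  \<comment> \<open>After elimination of \<open>ds\<close> the vector \<open>s\<close> drops out.
    The right-hand side lies in the range of \<open>G\<close> and is therefore orthogonal to every
    kernel vector of this skew matrix.\<close>
  obtain dy dx where d: "dy \<in> carrier_vec k" "dx \<in> carrier_vec m"
    "G *\<^sub>v (dy @\<^sub>v dx) + (0\<^sub>v k @\<^sub>v \<mu> \<cdot>\<^sub>v (H x *\<^sub>v dx)) = - (G *\<^sub>v (y @\<^sub>v x))"
  proof (rule ex_Newton_solution[OF x \<mu>])
    show "- (G *\<^sub>v (y @\<^sub>v x)) \<in> carrier_vec (k + m)" using yx by simp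
    fix v assume v: "v \<in> carrier_vec k" and "G *\<^sub>v (v @\<^sub>v 0\<^sub>v m) = 0\<^sub>v (k + m)"
    then have "(v @\<^sub>v 0\<^sub>v m) \<bullet> (G *\<^sub>v (y @\<^sub>v x)) = 0"
      using skew_scalar_prod[OF G G_skew _ yx, of "v @\<^sub>v 0\<^sub>v m"] yx by simp
    then show "(v @\<^sub>v 0\<^sub>v m) \<bullet> - (G *\<^sub>v (y @\<^sub>v x)) = 0"
      using v by (simp add: scalar_prod_uminus_right carrier_matD[OF G])
  qed
  define ds where "ds = - s - \<mu> \<cdot>\<^sub>v (H x *\<^sub>v dx)"
  have ds: "ds \<in> carrier_vec m" using d by (simp add: ds_def)
  have "residual P (dx, dy, ds) = - residual P (x, y, s)"
    unfolding residual_eq ds_def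
    by (rule shift_residual[OF _ _ _ _ d(3)]) (use d yx in simp_all)
  moreover have "ds + \<mu> \<cdot>\<^sub>v (H x *\<^sub>v dx) = - s"
    by (intro eq_vecI) (simp_all add: ds_def carrier_vecD[OF c(3)])
  ultimately have ex: "\<exists>z'. prediction_step P \<alpha> z z'"
    unfolding zz prediction_step_iff using int d ds unfolding \<mu>_def by blast
  have "z' \<in> neighborhood P (1 / 5) \<and> mu P z' \<le> (1 - \<alpha>) * (1 + \<alpha> / 10) * mu P z \<and>
    vnorm (residual P z') = (1 - \<alpha>) * vnorm (residual P z)" if step: "prediction_step P \<alpha> z z'" for z'
  proof -
    obtain dx dy ds where d: "dx \<in> carrier_vec m" "dy \<in> carrier_vec k" "ds \<in> carrier_vec m"
      and res: "residual P (dx, dy, ds) = - residual P (x, y, s)"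
      and eq: "ds + \<mu> \<cdot>\<^sub>v (H x *\<^sub>v dx) = - s"
      and z': "z' = (x + \<alpha> \<cdot>\<^sub>v dx, y + \<alpha> \<cdot>\<^sub>v dy, s + \<alpha> \<cdot>\<^sub>v ds)"
      using step unfolding zz prediction_step_iff \<mu>_def by blast
    \<comment> \<open>Needed for two values: \<open>t = 1\<close> gives the orthogonality of
      \<open>x + dx\<close> and \<open>s + ds\<close>, and \<open>t = \<alpha>\<close> the decrease
      of the residual.\<close>
    have r: "residual P (x + t \<cdot>\<^sub>v dx, y + t \<cdot>\<^sub>v dy, s + t \<cdot>\<^sub>v ds) = (1 - t) \<cdot>\<^sub>v residual P (x, y, s)" for t
      unfolding residual_add_smult[OF c d] res
      by (intro eq_vecI) (auto simp: left_diff_distrib)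
    have "residual P (x + dx, y + dy, s + ds) = 0\<^sub>v (k + m)"
      using r[of 1] carrier_vecD[OF residual_carrier[OF c]] by (auto simp: vec_eq_iff)
    then have orth: "(x + dx) \<bullet> (s + ds) = 0"
      using d by (intro residual_0_orthogonal) simp_all
    \<comment> \<open>\<open>mu\<close> ignores the second component, so \<open>mu_eq\<close> may be
      folded with any \<open>y\<close>; the one of the new iterate is inserted.\<close>
    note est = predictor_estimate[OF x c(3) d(1,3) M_pos \<mu> xs eq orth near[folded \<mu>_def] refl,
        folded mu_eq[of _ "y + \<alpha> \<cdot>\<^sub>v dy"]]
    have "z' \<in> feasible_interior P"
      unfolding z' using d by (intro interiorI[OF est(1) _ _ est(2) _ est(4)]) simp_all
    then have "z' \<in> neighborhood P (1 / 5)" unfolding z' using est(4) by (simp add: neighborhood_iff)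
    moreover have "vnorm (residual P z') = (1 - \<alpha>) * vnorm (residual P z)"
    proof -
      have "\<bar>1 - \<alpha>\<bar> = 1 - \<alpha>" using \<alpha>_bounds by linarith
      then show ?thesis unfolding z' zz r vnorm_smult by simp
    qed
    ultimately show ?thesis using est(3) unfolding z' zz \<mu>_def by blast
  qed
  with ex show ?thesis unfolding surely_def by blast
qed

lemma surely_correction:
  assumes z: "z \<in> neighborhood P (1 / 5)"
  shows "surely (correction_step P 1) (\<lambda>z'. z' \<in> neighborhood P (1 / 10) \<and>
    mu P z' \<le> mu P z \<and> residual P z' = residual P z) z"
proof -
  obtain x y s where zz: "z = (x, y, s)" by (cases z)
  have int: "(x, y, s) \<in> feasible_interior P"
    and near: "dual_le x (s + mu P (x, y, s) \<cdot>\<^sub>v g x) (1 / 5 * mu P (x, y, s))"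
    using z unfolding zz by (simp_all add: neighborhood_iff)
  note c [simp] = interior_iterate[OF int]
  have x: "x \<in> dom" by (rule interior_imp_dom[OF int])
  define \<mu> where "\<mu> = mu P (x, y, s)"
  define \<psi> where "\<psi> = s + \<mu> \<cdot>\<^sub>v g x"
  have \<psi> [simp]: "\<psi> \<in> carrier_vec m" by (simp add: \<psi>_def)
  have \<mu>: "\<mu> > 0" unfolding \<mu>_def by (rule mu_pos[OF int])
  have xs: "x \<bullet> s = real M * \<mu>" using M_pos by (simp add: \<mu>_def mu_eq)
  obtain dy dx where d: "dy \<in> carrier_vec k" "dx \<in> carrier_vec m"
    "G *\<^sub>v (dy @\<^sub>v dx) + (0\<^sub>v k @\<^sub>v \<mu> \<cdot>\<^sub>v (H x *\<^sub>v dx)) = 0\<^sub>v k @\<^sub>v - \<psi>"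
  proof (rule ex_Newton_solution[OF x \<mu>])
    show "0\<^sub>v k @\<^sub>v - \<psi> \<in> carrier_vec (k + m)" by simp
    fix v :: rvec assume v: "v \<in> carrier_vec k"
    then have "(v @\<^sub>v 0\<^sub>v m) \<bullet> (0\<^sub>v k @\<^sub>v - \<psi>) = v \<bullet> 0\<^sub>v k + 0\<^sub>v m \<bullet> - \<psi>"
      by (intro scalar_prod_append[OF v zero_carrier_vec[of m] zero_carrier_vec[of k]]) simp
    then show "(v @\<^sub>v 0\<^sub>v m) \<bullet> (0\<^sub>v k @\<^sub>v - \<psi>) = 0" using v by simp
  qed
  define ds where "ds = - \<psi> - \<mu> \<cdot>\<^sub>v (H x *\<^sub>v dx)"
  have ds: "ds \<in> carrier_vec m" using d by (simp add: ds_def)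
  have "residual P (dx, dy, ds) = 0\<^sub>v (k + m)"
  proof -
    \<comment> \<open>\<open>shift_residual\<close> is used with \<open>\<psi>\<close> in the place
      of \<open>s\<close> and the padded \<open>\<psi>\<close> in the place of \<open>r\<close>, so
      that its right-hand side is zero.\<close>
    have "G *\<^sub>v (dy @\<^sub>v dx) - (0\<^sub>v k @\<^sub>v (- \<psi> - \<mu> \<cdot>\<^sub>v (H x *\<^sub>v dx))) = - ((0\<^sub>v k @\<^sub>v \<psi>) - (0\<^sub>v k @\<^sub>v \<psi>))"
    proof (rule shift_residual)
      show "G *\<^sub>v (dy @\<^sub>v dx) + (0\<^sub>v k @\<^sub>v \<mu> \<cdot>\<^sub>v (H x *\<^sub>v dx)) = - (0\<^sub>v k @\<^sub>v \<psi>)"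
        unfolding d(3) by (intro eq_vecI) (auto simp: carrier_vecD[OF \<psi>])
    qed (use d in simp_all)
    also have "\<dots> = 0\<^sub>v (k + m)" by (intro eq_vecI) (auto simp: carrier_vecD[OF \<psi>])
    finally show ?thesis unfolding residual_eq ds_def .
  qed
  moreover have "ds + \<mu> \<cdot>\<^sub>v (H x *\<^sub>v dx) = - \<psi>"
    by (intro eq_vecI) (simp_all add: ds_def carrier_vecD[OF \<psi>])
  ultimately have ex: "\<exists>z'. correction_step P 1 z z'"
    unfolding zz correction_step_iff using int d ds unfolding \<psi>_def \<mu>_def by blast
  have "z' \<in> neighborhood P (1 / 10) \<and> mu P z' \<le> mu P z \<and> residual P z' = residual P z"
    if step: "correction_step P 1 z z'" for z'
  proof -
    obtain dx dy ds where d: "dx \<in> carrier_vec m" "dy \<in> carrier_vec k" "ds \<in> carrier_vec m"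
      and res: "residual P (dx, dy, ds) = 0\<^sub>v (k + m)"
      and eq: "ds + \<mu> \<cdot>\<^sub>v (H x *\<^sub>v dx) = - \<psi>"
      and "z' = (x + 1 \<cdot>\<^sub>v dx, y + 1 \<cdot>\<^sub>v dy, s + 1 \<cdot>\<^sub>v ds)"
      using step unfolding zz correction_step_iff \<psi>_def \<mu>_def by blast
    then have z': "z' = (x + dx, y + dy, s + ds)" by simp
    have orth: "dx \<bullet> ds = 0" by (rule residual_0_orthogonal[OF d res])
    note est = corrector_estimate[OF x c(3) d(1,3) M_pos \<mu> xs eq[unfolded \<psi>_def] orth
        near[folded \<mu>_def], folded mu_eq[of _ "y + dy"]]
    have "z' \<in> feasible_interior P"
      unfolding z' using d by (intro interiorI[OF est(1) _ _ est(2) _ est(4)]) simp_all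
    then have "z' \<in> neighborhood P (1 / 10)" unfolding z' using est(4) by (simp add: neighborhood_iff)
    moreover have "residual P z' = residual P z"
      unfolding z' zz using residual_add_smult[OF c d, of 1] res residual_carrier[OF c] by simp
    ultimately show ?thesis using est(3) unfolding z' zz \<mu>_def by blast
  qed
  with ex show ?thesis unfolding surely_def by blast
qed

lemma surely_mono: "surely R Q z \<Longrightarrow> (\<And>z'. Q z' \<Longrightarrow> Q' z') \<Longrightarrow> surely R Q' z"
  unfolding surely_def by blast

text \<open>The hypotheses say that \<open>r\<close> further contractions by \<open>q\<close> would
  meet both tolerances, measured against the fixed \<open>z0\<close>; one iteration trades one power
  of \<open>q\<close> for an actual decrease. An earlier stop is covered because the stopping test
  contains the two inequalities.\<close>

lemma terminates_within_geometric:
  defines "q \<equiv> (1 - \<alpha>) * (1 + \<alpha> / 10)"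
  assumes "z \<in> neighborhood P (1 / 10)" "mu P z * q ^ r \<le> \<epsilon> * mu P z0"
    "vnorm (residual P z) * q ^ r \<le> \<epsilon> * vnorm (residual P z0)"
  shows "terminates_within P \<alpha> 1 1 (stopping P \<epsilon> z0)
    (\<lambda>z. z \<in> feasible_set P \<and> mu P z \<le> \<epsilon> * mu P z0 \<and>
      vnorm (residual P z) \<le> \<epsilon> * vnorm (residual P z0)) r z"
  using assms(2-)
proof (induction r arbitrary: z)
  case 0
  then have "z \<in> feasible_set P" using interior_subset by (auto simp: neighborhood_def)
  with 0 show ?case by (simp add: stopping_def)
next
  case (Suc r)
  have feas: "z \<in> feasible_set P" using Suc.prems interior_subset by (auto simp: neighborhood_def)
  have q: "1 - \<alpha> \<le> q" "q \<ge> 0"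
    unfolding q_def by (rule contraction_factor_bounds[OF \<alpha>_bounds])+
  let ?T = "terminates_within P \<alpha> 1 1 (stopping P \<epsilon> z0)
    (\<lambda>z. z \<in> feasible_set P \<and> mu P z \<le> \<epsilon> * mu P z0 \<and>
      vnorm (residual P z) \<le> \<epsilon> * vnorm (residual P z0)) r"
  have "surely (prediction_step P \<alpha>) (surely (correction_step P 1) ?T) z"
  proof (rule surely_mono[OF surely_prediction[OF Suc.prems(1)]], elim conjE)
    fix z1 assume z1: "z1 \<in> neighborhood P (1 / 5)" "mu P z1 \<le> (1 - \<alpha>) * (1 + \<alpha> / 10) * mu P z"
      "vnorm (residual P z1) = (1 - \<alpha>) * vnorm (residual P z)"
    show "surely (correction_step P 1) ?T z1"
    proof (rule surely_mono[OF surely_correction[OF z1(1)]], elim conjE)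
      fix z2 assume z2: "z2 \<in> neighborhood P (1 / 10)" "mu P z2 \<le> mu P z1" "residual P z2 = residual P z1"
      have "mu P z2 * q ^ r \<le> (q * mu P z) * q ^ r"
        using z1(2) z2(2) q(2) by (intro mult_right_mono) (auto simp: q_def)
      also have "\<dots> = mu P z * q ^ Suc r" by simp
      also have "\<dots> \<le> \<epsilon> * mu P z0" by (rule Suc.prems)
      finally have a: "mu P z2 * q ^ r \<le> \<epsilon> * mu P z0" .
      have "vnorm (residual P z2) * q ^ r \<le> (q * vnorm (residual P z)) * q ^ r"
        unfolding z2(3) z1(3) using q by (intro mult_right_mono) auto
      also have "\<dots> = vnorm (residual P z) * q ^ Suc r" by simp
      also have "\<dots> \<le> \<epsilon> * vnorm (residual P z0)" by (rule Suc.prems)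
      finally show "?T z2" using a z2(1) by (intro Suc.IH)
    qed
  qed
  then show ?case using feas by (simp add: stopping_def[of P \<epsilon> z0 z])
qed

lemma complexity:
  fixes \<epsilon> :: real
  assumes \<epsilon>: "\<epsilon> > 0" and z0: "z0 \<in> neighborhood P (1 / 10)"
  shows "\<exists>r. terminates_within P \<alpha> 1 1 (stopping P \<epsilon> z0)
    (\<lambda>z. z \<in> feasible_set P \<and> mu P z \<le> \<epsilon> * mu P z0 \<and>
      vnorm (residual P z) \<le> \<epsilon> * vnorm (residual P z0)) r z0 \<and>
    (\<epsilon> \<le> 1 / 3 \<longrightarrow> real r \<le> 13 * sqrt (real M) * ln (1 / \<epsilon>))"
proof -
  define \<rho> where "\<rho> = 9 / 10 * \<alpha>"
  define q where "q = (1 - \<alpha>) * (1 + \<alpha> / 10)"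
  \<comment> \<open>Smallest natural number with
    \<open>r * \<rho> \<ge> ln (1 / \<epsilon>)\<close>; for \<open>\<epsilon> \<ge> 1\<close> the
    logarithm is at most 0 and \<open>nat\<close> yields \<open>r = 0\<close>.\<close>
  define r where "r = nat \<lceil>ln (1 / \<epsilon>) / \<rho>\<rceil>"
  have \<rho>: "\<rho> > 0" using \<alpha>_bounds by (simp add: \<rho>_def)
  have "q \<le> 1 - \<rho>" unfolding q_def \<rho>_def by (rule contraction_factor_bounds(2)[OF \<alpha>_bounds])
  also have "\<dots> \<le> exp (- \<rho>)" using exp_ge_add_one_self[of "- \<rho>"] by simp
  finally have q_exp: "q \<le> exp (- \<rho>)" .
  have q0: "q \<ge> 0" unfolding q_def by (rule contraction_factor_bounds(3)[OF \<alpha>_bounds])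
  have "ln (1 / \<epsilon>) / \<rho> \<le> real r" unfolding r_def by linarith
  then have "ln (1 / \<epsilon>) \<le> real r * \<rho>" using \<rho> by (simp add: field_simps)
  then have r_ln: "- (real r * \<rho>) \<le> ln \<epsilon>" using \<epsilon> by (simp add: ln_div)
  have "q ^ r \<le> exp (- \<rho>) ^ r" using q_exp q0 by (rule power_mono)
  also have "\<dots> = exp (- (real r * \<rho>))" by (simp flip: exp_of_nat_mult)
  also have "\<dots> \<le> \<epsilon>" using r_ln \<epsilon> by (metis exp_le_cancel_iff exp_ln)
  finally have qr: "q ^ r \<le> \<epsilon>" .
  obtain x y s where zz: "z0 = (x, y, s)" by (cases z0)
  have "mu P z0 > 0" using z0 mu_pos unfolding zz by (simp add: neighborhood_iff)
  then have a: "mu P z0 * q ^ r \<le> \<epsilon> * mu P z0"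
    unfolding mult.commute[of \<epsilon>] using qr by (intro mult_left_mono) auto
  have b: "vnorm (residual P z0) * q ^ r \<le> \<epsilon> * vnorm (residual P z0)"
    unfolding mult.commute[of \<epsilon>] using qr by (intro mult_left_mono) auto
  note terminates_within_geometric[OF z0 a[unfolded q_def] b[unfolded q_def]]
  moreover have "real r \<le> 13 * sqrt (real M) * ln (1 / \<epsilon>)" if small: "\<epsilon> \<le> 1 / 3"
  proof -
    \<comment> \<open>The threshold 1/3 ensures \<open>ln (1 / \<epsilon>) \<ge> 1\<close>, so the
      rounding of the ceiling is absorbed: \<open>1 / \<rho>\<close> is 100/9 times
      \<open>sqrt M\<close>, and 100/9 + 1 = 109/9 is below 13.\<close>
    have "exp 1 \<le> (3 :: real)" by (rule exp_le)
    also have "3 \<le> 1 / \<epsilon>" using small \<epsilon> by (simp add: field_simps)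
    finally have "exp 1 \<le> 1 / \<epsilon>" .
    then have ln1: "1 \<le> ln (1 / \<epsilon>)" using \<epsilon> by (subst ln_ge_iff) auto
    have sM: "sqrt (real M) \<ge> 1" using M_pos by simp
    have "real r \<le> ln (1 / \<epsilon>) / \<rho> + 1"
      using ln1 \<rho> unfolding r_def by (smt (verit) divide_nonneg_pos of_nat_nat of_int_ceiling_le_add_one zero_le_ceiling)
    also have "\<dots> = 100 / 9 * sqrt (real M) * ln (1 / \<epsilon>) + 1" using M_pos by (simp add: \<rho>_def field_simps)
    also have "\<dots> \<le> 100 / 9 * sqrt (real M) * ln (1 / \<epsilon>) + sqrt (real M) * ln (1 / \<epsilon>)"
      using mult_mono[OF sM ln1] sM by simp
    also have "\<dots> = 109 / 9 * (sqrt (real M) * ln (1 / \<epsilon>))" by simp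
    also have "\<dots> \<le> 13 * (sqrt (real M) * ln (1 / \<epsilon>))"
      using sM ln1 by (intro mult_right_mono) auto
    finally show ?thesis by simp
  qed
  ultimately show ?thesis by blast
qed

end

section \<open>Polynomials of bounded degree\<close>

definition monomial_degree :: "(nat \<Rightarrow>\<^sub>0 nat) \<Rightarrow> nat" where
  "monomial_degree a = (\<Sum>i\<in>Poly_Mapping.keys a. Poly_Mapping.lookup a i)"

lemma monomial_degree_add: "monomial_degree (a + b) = monomial_degree a + monomial_degree b"
  unfolding monomial_degree_def by (rule setsum_keys_plus_distrib) simp_all

lemma poly_space_iff:
  "f \<in> poly_space n r \<longleftrightarrow>
    (\<forall>a\<in>Poly_Mapping.keys f. Poly_Mapping.keys a \<subseteq> {..<n} \<and> monomial_degree a \<le> r)"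
  by (simp add: poly_space_def monomial_degree_def)

lemma poly_space_mult:
  assumes "f \<in> poly_space n r" "g \<in> poly_space n r'"
  shows "f * g \<in> poly_space n (r + r')"
  unfolding poly_space_iff
proof
  fix c assume "c \<in> Poly_Mapping.keys (f * g)"
  then obtain a b where c: "c = a + b" "a \<in> Poly_Mapping.keys f" "b \<in> Poly_Mapping.keys g"
    using keys_mult[of f g] by blast
  with assms have "Poly_Mapping.keys a \<subseteq> {..<n}" "Poly_Mapping.keys b \<subseteq> {..<n}"
    "monomial_degree a \<le> r" "monomial_degree b \<le> r'"
    by (auto simp: poly_space_iff)
  then show "Poly_Mapping.keys c \<subseteq> {..<n} \<and> monomial_degree c \<le> r + r'"
    unfolding c(1) monomial_degree_add using Poly_Mapping.keys_add[of a b] by auto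
qed

text \<open>One variable at a time is moved from the second factor to the first.\<close>

lemma split_monomial:
  assumes "t \<le> monomial_degree c"
  shows "\<exists>a b. c = a + b \<and> monomial_degree a = t"
  using assms
proof (induction t)
  case 0
  show ?case by (intro exI[of _ 0] exI[of _ c]) (simp add: monomial_degree_def)
next
  case (Suc t)
  then obtain a b where ab: "c = a + b" "monomial_degree a = t" by auto
  with Suc.prems have "monomial_degree b > 0" by (simp add: monomial_degree_add)
  then have "Poly_Mapping.keys b \<noteq> {}" by (auto simp: monomial_degree_def)
  then obtain i where i: "i \<in> Poly_Mapping.keys b" by blast
  let ?e = "Poly_Mapping.single i 1 :: nat \<Rightarrow>\<^sub>0 nat"
  have "b = ?e + (b - ?e)"
    using i by (intro poly_mapping_eqI) (auto simp: lookup_add lookup_minus lookup_single when_def in_keys_iff)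
  then have "c = (a + ?e) + (b - ?e)" using ab(1) by (simp add: add.assoc)
  moreover have "monomial_degree (a + ?e) = Suc t"
    by (simp add: monomial_degree_add ab(2)) (simp add: monomial_degree_def)
  ultimately show ?case by blast
qed

lemma lookup_poly_scale: "Poly_Mapping.lookup (poly_scale c f) a = c * Poly_Mapping.lookup f a"
proof -
  have "poly_scale c f = Poly_Mapping.map ((*) c) f" by (simp add: poly_scale_def mult_map_scale_conv_mult)
  then show ?thesis by (simp add: Poly_Mapping.map.rep_eq when_def)
qed

lemma poly_eq_sum_monomials:
  fixes f :: mpoly
  shows "f = (\<Sum>a\<in>Poly_Mapping.keys f. poly_scale (Poly_Mapping.lookup f a) (Poly_Mapping.single a 1))"
  by (rule poly_mapping_eqI)
    (auto simp: lookup_sum lookup_poly_scale lookup_single when_def in_keys_iff if_distrib cong: if_cong)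

locale sos_setup =
  fixes n d :: nat and p q :: "nat \<Rightarrow> mpoly"
  assumes p_basis: "ordered_basis (poly_space n d) (dim_L n d) p"
    and q_basis: "ordered_basis (poly_space n (2 * d)) (dim_U n d) q"
begin

definition "l = dim_L n d"
definition "U = dim_U n d"
definition "Q = q ` {..<U}"

lemma p: "inj_on p {..<l}" "mpoly.independent (p ` {..<l})" "mpoly.span (p ` {..<l}) = poly_space n d"
  using p_basis by (auto simp: ordered_basis_def l_def)

lemma q: "inj_on q {..<U}" "mpoly.independent Q" "mpoly.span Q = poly_space n (2 * d)"
  using q_basis by (auto simp: ordered_basis_def U_def Q_def)

lemma l_pos: "l > 0"
  by (simp add: l_def dim_L_def)

text \<open>Coordinates in the basis \<open>q\<close>. Throughout, a vector \<open>x\<close> acts as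
  a linear functional on polynomials of degree at most \<open>2 * d\<close>, its value at
  \<open>f\<close> being \<open>coord f \<bullet> x\<close>.\<close>

definition coord :: "mpoly \<Rightarrow> rvec" where
  "coord f = Matrix.vec U (\<lambda>u. mpoly.representation Q f (q u))"

definition comb_p :: "rvec \<Rightarrow> mpoly" where
  "comb_p v = (\<Sum>i<l. poly_scale (v $ i) (p i))"

definition comb_q :: "rvec \<Rightarrow> mpoly" where
  "comb_q s = (\<Sum>u<U. poly_scale (s $ u) (q u))"

abbreviation "Lam \<equiv> Lambda_op n d p q"

lemma coord_carrier [simp]: "coord f \<in> carrier_vec U"
  by (simp add: coord_def)

text \<open>The polynomials have to lie in the span of \<open>Q\<close>: outside it
  \<open>representation\<close> is zero, which would break additivity.\<close>

lemma coord_sum: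
  assumes "\<And>i. i \<in> I \<Longrightarrow> f i \<in> poly_space n (2 * d)" and x: "x \<in> carrier_vec U"
  shows "coord (\<Sum>i\<in>I. poly_scale (c i) (f i)) \<bullet> x = (\<Sum>i\<in>I. c i * (coord (f i) \<bullet> x))"
proof -
  have f: "f i \<in> mpoly.span Q" if "i \<in> I" for i using assms(1)[OF that] q(3) by simp
  have "mpoly.representation Q (\<Sum>i\<in>I. poly_scale (c i) (f i)) b
      = (\<Sum>i\<in>I. c i * mpoly.representation Q (f i) b)" for b
    using f by (simp add: mpoly.representation_sum[OF q(2)] mpoly.span_scale mpoly.representation_scale[OF q(2)])
  then have "coord (\<Sum>i\<in>I. poly_scale (c i) (f i)) \<bullet> x
      = (\<Sum>u<U. \<Sum>i\<in>I. c i * (mpoly.representation Q (f i) (q u) * x $ u))"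
    using x by (simp add: coord_def scalar_prod_def lessThan_atLeast0 sum_distrib_right mult.assoc)
  also have "\<dots> = (\<Sum>i\<in>I. c i * (coord (f i) \<bullet> x))"
    using x by (subst sum.swap) (simp add: coord_def scalar_prod_def lessThan_atLeast0 sum_distrib_left)
  finally show ?thesis .
qed

lemma coord_q:
  assumes "u < U"
  shows "coord (q u) = unit_vec U u"
proof (rule eq_vecI)
  fix i assume "i < dim_vec (unit_vec U u)"
  then have i: "i < U" by simp
  have "q i = q u \<longleftrightarrow> i = u" using q(1) i assms by (auto dest: inj_onD)
  then show "coord (q u) $ i = unit_vec U u $ i"
    using i assms mpoly.representation_basis[OF q(2), of "q u"] by (simp add: coord_def Q_def)
qed (simp add: coord_def)

lemma q_in: "u < U \<Longrightarrow> q u \<in> poly_space n (2 * d)"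
  using mpoly.span_base[of "q u" Q] q(3) by (auto simp: Q_def)

lemma coord_comb_q:
  assumes "s \<in> carrier_vec U" "x \<in> carrier_vec U"
  shows "coord (comb_q s) \<bullet> x = s \<bullet> x"
  unfolding comb_q_def using assms q_in coord_q
  by (subst coord_sum) (simp_all add: scalar_prod_def[of s] lessThan_atLeast0)

lemma comb_q_coord:
  assumes "f \<in> poly_space n (2 * d)"
  shows "comb_q (coord f) = f"
proof -
  have "comb_q (coord f) = (\<Sum>b\<in>Q. poly_scale (mpoly.representation Q f b) b)"
    unfolding comb_q_def Q_def using q(1) by (subst sum.reindex) (simp_all add: coord_def Q_def)
  also have "\<dots> = f" using assms q by (intro mpoly.sum_representation_eq) (simp_all add: Q_def)
  finally show ?thesis .
qed

lemma p_in: "i < l \<Longrightarrow> p i \<in> poly_space n d"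
  using mpoly.span_base[of "p i" "p ` {..<l}"] p(3) by auto

lemma comb_p_in: "comb_p v \<in> poly_space n d"
  unfolding comb_p_def p(3)[symmetric]
  by (intro mpoly.span_sum mpoly.span_scale mpoly.span_base) auto

lemma ex_comb_p:
  assumes "f \<in> poly_space n d"
  obtains v where "v \<in> carrier_vec l" "comb_p v = f"
proof -
  obtain c where "f = (\<Sum>b\<in>p ` {..<l}. poly_scale (c b) b)"
    using assms unfolding p(3)[symmetric] by (subst (asm) mpoly.span_finite) auto
  also have "\<dots> = (\<Sum>i<l. poly_scale (c (p i)) (p i))"
    using p(1) by (subst sum.reindex) simp_all
  finally have "comb_p (Matrix.vec l (\<lambda>i. c (p i))) = f" by (simp add: comb_p_def)
  then show thesis using that[of "Matrix.vec l (\<lambda>i. c (p i))"] by simp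
qed

lemma comb_p_eq_0:
  assumes v: "v \<in> carrier_vec l" and "comb_p v = 0"
  shows "v = 0\<^sub>v l"
proof (rule eq_vecI)
  fix i assume "i < dim_vec (0\<^sub>v l :: rvec)"
  then have i: "i < l" by simp
  define c where "c b = v $ (the_inv_into {..<l} p b)" for b
  have c: "c (p j) = v $ j" if "j < l" for j
    using the_inv_into_f_f[OF p(1)] that by (simp add: c_def)
  have "(\<Sum>b\<in>p ` {..<l}. poly_scale (c b) b) = comb_p v"
    unfolding comb_p_def using p(1) by (subst sum.reindex) (simp_all add: c)
  then have "c (p i) = 0"
    using mpoly.independentD[OF p(2), of "p ` {..<l}" c "p i"] assms i by simp
  then show "v $ i = 0\<^sub>v l $ i" using c i by simp
qed (use v in simp)

section \<open>The moment matrix and the dual of the sum-of-squares cone\<close>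

lemma Lam_index:
  assumes "i < l" "j < l" and x: "x \<in> carrier_vec U"
  shows "Lam x $$ (i, j) = coord (p i * p j) \<bullet> x"
  using assms by (simp add: Lambda_op_def Emat_def l_def[symmetric] U_def[symmetric] Q_def
      coord_def scalar_prod_def lessThan_atLeast0 mult.commute)

lemma Lam_carrier [simp]: "Lam x \<in> carrier_mat l l"
  by (simp add: Lambda_op_def l_def)

lemma Lam_sym: "x \<in> carrier_vec U \<Longrightarrow> (Lam x)\<^sup>T = Lam x"
  by (rule eq_matI) (simp_all add: carrier_matD[OF Lam_carrier] Lam_index mult.commute)

lemma double: "d + d = 2 * d" by simp

text \<open>\<open>Lam x\<close> is the moment matrix of the functional \<open>x\<close>: the Gram
  matrix, in the basis \<open>p\<close>, of the bilinear form that sends \<open>f\<close> and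
  \<open>g\<close> to the value of \<open>x\<close> at \<open>f * g\<close>.\<close>

lemma Lam_bilinear:
  assumes v: "v \<in> carrier_vec l" and w: "w \<in> carrier_vec l" and x: "x \<in> carrier_vec U"
  shows "v \<bullet> (Lam x *\<^sub>v w) = coord (comb_p v * comb_p w) \<bullet> x"
proof -
  have scale: "poly_scale a f * poly_scale b g = poly_scale (a * b) (f * g)" for a b f g
  proof -
    have "Poly_Mapping.single 0 (a * b) = (Poly_Mapping.single 0 a * Poly_Mapping.single 0 b :: mpoly)"
      using mult_single[of "0 :: nat \<Rightarrow>\<^sub>0 nat" a 0 b] by simp
    then show ?thesis unfolding poly_scale_def by (simp only: ac_simps)
  qed
  have "comb_p v * comb_p w = (\<Sum>i<l. \<Sum>j<l. poly_scale (v $ i * w $ j) (p i * p j))"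
    by (simp add: comb_p_def sum_product scale)
  also have "\<dots> = (\<Sum>(i, j)\<in>{..<l} \<times> {..<l}. poly_scale (v $ i * w $ j) (p i * p j))"
    by (rule sum.cartesian_product)
  also have "\<dots> = (\<Sum>ij\<in>{..<l} \<times> {..<l}. poly_scale (v $ fst ij * w $ snd ij) (p (fst ij) * p (snd ij)))"
    by (simp add: case_prod_unfold)
  also have "coord \<dots> \<bullet> x = (\<Sum>ij\<in>{..<l} \<times> {..<l}. v $ fst ij * w $ snd ij * (coord (p (fst ij) * p (snd ij)) \<bullet> x))"
    using poly_space_mult[of _ n d _ d, unfolded double] p_in x by (intro coord_sum) auto
  also have "\<dots> = (\<Sum>i<l. \<Sum>j<l. v $ i * w $ j * (coord (p i * p j) \<bullet> x))"
    by (simp add: sum.cartesian_product case_prod_unfold)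
  also have "\<dots> = (\<Sum>i<l. v $ i * (\<Sum>j<l. Lam x $$ (i, j) * w $ j))"
    by (intro sum.cong refl) (simp add: Lam_index x sum_distrib_left ac_simps)
  also have "\<dots> = v \<bullet> (Lam x *\<^sub>v w)"
    using v w carrier_matD[OF Lam_carrier[of x]] by (simp add: scalar_prod_def lessThan_atLeast0)
  finally show ?thesis ..
qed

text \<open>A linear functional on \<open>poly_space n (2 * d)\<close> vanishing on all products of two polynomials of
  degree at most \<open>d\<close> is zero, since every monomial of degree at most \<open>2 * d\<close> is such a product.\<close>

lemma Lam_inj:
  assumes x: "x \<in> carrier_vec U" and zero: "Lam x = 0\<^sub>m l l"
  shows "x = 0\<^sub>v U"
proof -
  have prod: "coord (f * g) \<bullet> x = 0" if fg: "f \<in> poly_space n d" "g \<in> poly_space n d" for f g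
  proof -
    obtain v w where vw: "v \<in> carrier_vec l" "w \<in> carrier_vec l" "comb_p v = f" "comb_p w = g"
      using ex_comb_p fg by metis
    have "0\<^sub>m l l *\<^sub>v w = 0\<^sub>v l" using vw by (intro eq_vecI) simp_all
    then show ?thesis using Lam_bilinear[OF vw(1,2) x] vw zero by simp
  qed
  have mono: "coord (Poly_Mapping.single c 1) \<bullet> x = 0"
    if c: "Poly_Mapping.keys c \<subseteq> {..<n}" "monomial_degree c \<le> 2 * d" for c
  proof -
    \<comment> \<open>\<open>a\<close> takes degree \<open>d\<close>, or all of \<open>c\<close> if
      there is less, so that the remaining \<open>b\<close> has degree at most
      \<open>d\<close>.\<close>
    obtain a b where ab: "c = a + b" "monomial_degree a = min d (monomial_degree c)"
      using split_monomial[of "min d (monomial_degree c)" c] by auto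
    have "Poly_Mapping.keys a \<subseteq> Poly_Mapping.keys c" "Poly_Mapping.keys b \<subseteq> Poly_Mapping.keys c"
      by (auto simp: ab(1) in_keys_iff lookup_add)
    moreover have "monomial_degree b \<le> d" using ab c(2) monomial_degree_add[of a b] by simp
    ultimately have "Poly_Mapping.single a 1 \<in> poly_space n d" "Poly_Mapping.single b 1 \<in> poly_space n d"
      using c ab(2) by (auto simp: poly_space_iff)
    from prod[OF this] show ?thesis by (simp add: mult_single ab(1))
  qed
  have all: "coord f \<bullet> x = 0" if f: "f \<in> poly_space n (2 * d)" for f
  proof -
    have m: "coord (Poly_Mapping.single a 1) \<bullet> x = 0" "Poly_Mapping.single a 1 \<in> poly_space n (2 * d)"
      if "a \<in> Poly_Mapping.keys f" for a
      using that f mono by (auto simp: poly_space_iff)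
    have "coord f \<bullet> x = coord (\<Sum>a\<in>Poly_Mapping.keys f.
        poly_scale (Poly_Mapping.lookup f a) (Poly_Mapping.single a 1)) \<bullet> x"
      using poly_eq_sum_monomials[of f] by simp
    also have "\<dots> = 0" by (subst coord_sum[OF m(2) x]) (simp_all add: m(1))
    finally show ?thesis .
  qed
  have "x $ u = 0" if "u < U" for u
    using all[OF q_in[OF that]] coord_q[OF that] x that by simp
  then show ?thesis using x by (intro eq_vecI) auto
qed

lemma coord_square_in_sos:
  assumes "f \<in> poly_space n d"
  shows "coord (f\<^sup>2) \<in> sos_cone n d q"
proof -
  have "f\<^sup>2 \<in> poly_space n (2 * d)"
    using poly_space_mult[OF assms assms] by (simp add: power2_eq_square double)
  from comb_q_coord[OF this] show ?thesis
    using assms unfolding sos_cone_def U_def[symmetric]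
    by (auto simp: comb_q_def intro!: exI[of _ "[f]"])
qed

text \<open>Every polynomial of degree at most \<open>d\<close> is \<open>comb_p v\<close> for some
  \<open>v\<close>, and the quadratic form of \<open>Lam x\<close> at \<open>v\<close> is the
  functional \<open>x\<close> at its square. So semidefiniteness is nonnegativity on squares, and
  sums of squares follow by linearity.\<close>

lemma dual_sos_cone_eq:
  "dual_cone U (sos_cone n d q) = {x \<in> carrier_vec U. positive_semidefinite l (Lam x)}"
proof (intro equalityI subsetI)
  fix x assume x: "x \<in> dual_cone U (sos_cone n d q)"
  then have xc: "x \<in> carrier_vec U" by (simp add: dual_cone_def)
  have "v \<bullet> (Lam x *\<^sub>v v) \<ge> 0" if v: "v \<in> carrier_vec l" for v
    using x coord_square_in_sos[OF comb_p_in[of v]]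
    unfolding Lam_bilinear[OF v v xc] by (simp add: dual_cone_def power2_eq_square)
  then show "x \<in> {x \<in> carrier_vec U. positive_semidefinite l (Lam x)}"
    using xc Lam_sym by (simp add: positive_semidefinite_def)
next
  fix x assume "x \<in> {x \<in> carrier_vec U. positive_semidefinite l (Lam x)}"
  then have x: "x \<in> carrier_vec U" and psd: "positive_semidefinite l (Lam x)" by auto
  have "s \<bullet> x \<ge> 0" if s: "s \<in> sos_cone n d q" for s
  proof -
    obtain fs where fs: "set fs \<subseteq> poly_space n d" "comb_q s = sum_list (map (\<lambda>f. f\<^sup>2) fs)"
      and sc: "s \<in> carrier_vec U"
      using s by (auto simp: sos_cone_def U_def comb_q_def)
    have sq: "coord (f\<^sup>2) \<bullet> x \<ge> 0" "f\<^sup>2 \<in> poly_space n (2 * d)" if f: "f \<in> poly_space n d" for f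
    proof -
      obtain v where v: "v \<in> carrier_vec l" "comb_p v = f" using ex_comb_p[OF f] by blast
      then show "coord (f\<^sup>2) \<bullet> x \<ge> 0"
        using psd Lam_bilinear[OF v(1) v(1) x] by (auto simp: positive_semidefinite_def power2_eq_square)
      show "f\<^sup>2 \<in> poly_space n (2 * d)"
        using poly_space_mult[OF f f] by (simp add: power2_eq_square double)
    qed
    have "sum_list (map (\<lambda>f. f\<^sup>2) fs) = (\<Sum>i<length fs. poly_scale 1 ((fs ! i)\<^sup>2))"
      by (simp add: sum_list_sum_nth lessThan_atLeast0)
    then have "s \<bullet> x = coord (\<Sum>i<length fs. poly_scale 1 ((fs ! i)\<^sup>2)) \<bullet> x"
      using coord_comb_q[OF sc x] fs(2) by simp
    also have "\<dots> = (\<Sum>i<length fs. 1 * (coord ((fs ! i)\<^sup>2) \<bullet> x))"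
      using fs(1) sq(2) x by (intro coord_sum) (auto dest: nth_mem)
    also have "\<dots> \<ge> 0" using fs(1) sq(1) by (intro sum_nonneg) (auto dest: nth_mem)
    finally show ?thesis .
  qed
  then show "x \<in> dual_cone U (sos_cone n d q)" using x by (simp add: dual_cone_def)
qed

end

section \<open>The sum-of-squares problem\<close>

definition snoc_vec :: "rvec \<Rightarrow> real \<Rightarrow> rvec" where
  "snoc_vec x t = x @\<^sub>v vec_of_list [t]"

lemma dim_snoc_vec [simp]: "dim_vec (snoc_vec x t) = Suc (dim_vec x)"
  by (simp add: snoc_vec_def)

lemma snoc_vec_index: "i \<le> dim_vec x \<Longrightarrow> snoc_vec x t $ i = (if i < dim_vec x then x $ i else t)"
  by (simp add: snoc_vec_def)

lemma snoc_vec_carrier: "snoc_vec x t \<in> carrier_vec (n + 1) \<longleftrightarrow> x \<in> carrier_vec n"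
  unfolding carrier_dim_vec by simp

lemma snoc_vec_cases:
  assumes "v \<in> carrier_vec (n + 1)"
  obtains x t where "x \<in> carrier_vec n" "v = snoc_vec x t"
proof -
  have "v = snoc_vec (vec_first v n) (v $ n)"
    using assms by (intro eq_vecI) (auto simp: vec_first_def snoc_vec_index less_Suc_eq)
  then show thesis using that[of "vec_first v n" "v $ n"] by simp
qed

lemma snoc_vec_scalar_prod:
  assumes "x \<in> carrier_vec n" "s \<in> carrier_vec n"
  shows "snoc_vec x t \<bullet> snoc_vec s r = x \<bullet> s + t * r"
  using assms by (simp add: scalar_prod_def snoc_vec_index)

lemma snoc_vec_eq_iff:
  assumes "dim_vec x = dim_vec y"
  shows "snoc_vec x t = snoc_vec y r \<longleftrightarrow> x = y \<and> t = r"
proof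
  assume e: "snoc_vec x t = snoc_vec y r"
  have "x $ i = y $ i" if "i < dim_vec y" for i
    using arg_cong[OF e, of "\<lambda>v. v $ i"] that assms by (simp add: snoc_vec_index)
  moreover have "t = r"
    using arg_cong[OF e, of "\<lambda>v. v $ dim_vec y"] assms by (simp add: snoc_vec_index)
  ultimately show "x = y \<and> t = r" using assms by (auto intro!: eq_vecI)
qed simp

lemma snoc_vec_eq_0_iff:
  assumes "x \<in> carrier_vec n"
  shows "snoc_vec x t = 0\<^sub>v (n + 1) \<longleftrightarrow> x = 0\<^sub>v n \<and> t = 0"
proof -
  have "0\<^sub>v (n + 1) = snoc_vec (0\<^sub>v n) 0"
    by (intro eq_vecI) (auto simp: snoc_vec_index less_Suc_eq)
  then show ?thesis using snoc_vec_eq_iff[of x "0\<^sub>v n" t 0] assms by simp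
qed

lemma snoc_vec_diff_smult:
  assumes "x \<in> carrier_vec n" "y \<in> carrier_vec n"
  shows "snoc_vec x t - c \<cdot>\<^sub>v snoc_vec y r = snoc_vec (x - c \<cdot>\<^sub>v y) (t - c * r)"
  using assms by (intro eq_vecI) (auto simp: snoc_vec_index less_Suc_eq)

lemma extended_cone_eq: "extended_cone C = {snoc_vec x t | x t. x \<in> C \<and> t \<ge> 0}"
  by (simp add: extended_cone_def snoc_vec_def)

locale sos_conic = sos_setup +
  fixes k :: nat and A :: rmat and b c :: rvec and P :: conic_problem
  assumes A: "A \<in> carrier_mat k (dim_U n d)" and b: "b \<in> carrier_vec k"
    and c: "c \<in> carrier_vec (dim_U n d)" and P_eq: "P = sos_problem n d p q k A b c"
begin

text \<open>For \<open>u < U\<close> the matrix is padded by a zero row and column; the additional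
  index \<open>U\<close> belongs to \<open>\<tau>\<close> and selects the last diagonal entry. The
  pencil is thus block diagonal with blocks \<open>Lam x\<close> and \<open>\<tau>\<close>.\<close>

definition E :: "nat \<Rightarrow> rmat" where
  "E u = Matrix.mat (l + 1) (l + 1) (\<lambda>(i, j).
    if u < U then if i < l \<and> j < l then Emat n d p q u $$ (i, j) else 0
    else if i = l \<and> j = l then 1 else 0)"

abbreviation "Lbar \<equiv> pencil (U + 1) (l + 1) E"

definition D :: "real \<Rightarrow> rmat" where
  "D t = Matrix.mat 1 1 (\<lambda>_. t)"

lemma D [simp]: "D t \<in> carrier_mat 1 1"
  by (simp add: D_def)

lemma P_simps [simp]: "dim_x P = U" "dim_y P = k" "barrier_param P = real l"
  "coneK P = {x \<in> carrier_vec U. positive_semidefinite l (Lam x)}"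
  "barrier P = (\<lambda>x. - ln (Determinant.det (Lam x)))" "matA P = A" "vecb P = b" "vecc P = c"
  by (simp_all add: P_eq sos_problem_def l_def U_def dual_sos_cone_eq[unfolded U_def l_def])

lemma Lbar_snoc:
  assumes x: "x \<in> carrier_vec U"
  shows "Lbar (snoc_vec x t) = four_block_mat (Lam x) (0\<^sub>m l 1) (0\<^sub>m 1 l) (D t)"
proof (rule eq_matI)
  have dim [simp]: "dim_row (Lam x) = l" "dim_col (Lam x) = l" "dim_row (D t) = 1" "dim_col (D t) = 1"
    using carrier_matD[OF Lam_carrier[of x]] by (simp_all add: D_def)
  fix i j assume "i < dim_row (four_block_mat (Lam x) (0\<^sub>m l 1) (0\<^sub>m 1 l) (D t))"
    "j < dim_col (four_block_mat (Lam x) (0\<^sub>m l 1) (0\<^sub>m 1 l) (D t))"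
  then have ij: "i < l + 1" "j < l + 1" by simp_all
  have "Lbar (snoc_vec x t) $$ (i, j) = (\<Sum>u<U. x $ u * E u $$ (i, j)) + t * E U $$ (i, j)"
    using ij x by (simp add: pencil_def snoc_vec_index)
  also have "(\<Sum>u<U. x $ u * E u $$ (i, j)) = (if i < l \<and> j < l then Lam x $$ (i, j) else 0)"
    using ij by (auto simp: E_def Lambda_op_def l_def[symmetric] U_def[symmetric] intro!: sum.neutral)
  also have "t * E U $$ (i, j) = (if i = l \<and> j = l then t else 0)"
    using ij by (simp add: E_def)
  finally show "Lbar (snoc_vec x t) $$ (i, j) = four_block_mat (Lam x) (0\<^sub>m l 1) (0\<^sub>m 1 l) (D t) $$ (i, j)"
    using ij by (auto simp: D_def less_Suc_eq)
qed (use carrier_matD[OF Lam_carrier[of x]] in \<open>simp_all add: pencil_def D_def\<close>)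

lemma Lbar_quadratic:
  assumes x: "x \<in> carrier_vec U" and v: "v \<in> carrier_vec l"
  shows "snoc_vec v r \<bullet> (Lbar (snoc_vec x t) *\<^sub>v snoc_vec v r) = v \<bullet> (Lam x *\<^sub>v v) + t * r\<^sup>2"
proof -
  have c: "vec_of_list [r] \<in> carrier_vec 1" by (rule carrier_vecI) simp
  have "Lbar (snoc_vec x t) *\<^sub>v snoc_vec v r = Lam x *\<^sub>v v @\<^sub>v D t *\<^sub>v vec_of_list [r]"
    unfolding Lbar_snoc[OF x] snoc_vec_def[of v r] by (rule mult_mat_vec_split[OF Lam_carrier D v c])
  also have "D t *\<^sub>v vec_of_list [r] = vec_of_list [t * r]"
    by (intro eq_vecI) (auto simp: D_def scalar_prod_def)
  finally have "Lbar (snoc_vec x t) *\<^sub>v snoc_vec v r = snoc_vec (Lam x *\<^sub>v v) (t * r)"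
    by (simp only: snoc_vec_def)
  then show ?thesis
    using snoc_vec_scalar_prod[OF v mult_mat_vec_carrier[OF Lam_carrier[of x] v], of r "t * r"]
    by (simp add: power2_eq_square ac_simps)
qed

lemma Lbar_sym:
  assumes "x \<in> carrier_vec U"
  shows "(Lbar (snoc_vec x t))\<^sup>T = Lbar (snoc_vec x t)"
proof -
  have "(D t)\<^sup>T = D t" by (intro eq_matI) (simp_all add: D_def)
  then show ?thesis
    unfolding Lbar_snoc[OF assms]
    by (subst transpose_four_block_mat[OF Lam_carrier zero_carrier_mat zero_carrier_mat D])
      (simp add: Lam_sym[OF assms])
qed

lemma Lbar_carrier [simp]: "Lbar x \<in> carrier_mat (l + 1) (l + 1)"
  by (simp add: pencil_def)

lemma Lam_quadratic_0: "0\<^sub>v l \<bullet> (Lam x *\<^sub>v 0\<^sub>v l) = 0"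
  by (rule scalar_prod_left_zero[OF mult_mat_vec_carrier[OF Lam_carrier zero_carrier_vec]])

lemma positive_semidefinite_Lbar_iff:
  assumes x: "x \<in> carrier_vec U"
  shows "positive_semidefinite (l + 1) (Lbar (snoc_vec x t)) \<longleftrightarrow> positive_semidefinite l (Lam x) \<and> t \<ge> 0"
proof
  assume "positive_semidefinite (l + 1) (Lbar (snoc_vec x t))"
  then have psd: "v \<bullet> (Lam x *\<^sub>v v) + t * r\<^sup>2 \<ge> 0" if "v \<in> carrier_vec l" for v r
    using Lbar_quadratic[OF x that, of r t] snoc_vec_carrier[of v r l] that
    unfolding positive_semidefinite_def by metis
  have "v \<bullet> (Lam x *\<^sub>v v) \<ge> 0" if "v \<in> carrier_vec l" for v using psd[OF that, of 0] by simp
  moreover have "t \<ge> 0" using psd[of "0\<^sub>v l" 1] Lam_quadratic_0 by simp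
  ultimately show "positive_semidefinite l (Lam x) \<and> t \<ge> 0"
    using Lam_sym[OF x] by (simp add: positive_semidefinite_def)
next
  assume R: "positive_semidefinite l (Lam x) \<and> t \<ge> 0"
  have "v \<bullet> (Lbar (snoc_vec x t) *\<^sub>v v) \<ge> 0" if v: "v \<in> carrier_vec (l + 1)" for v
    using snoc_vec_cases[OF v] Lbar_quadratic[OF x] R unfolding positive_semidefinite_def
    by (metis add_nonneg_nonneg mult_nonneg_nonneg zero_le_power2)
  then show "positive_semidefinite (l + 1) (Lbar (snoc_vec x t))"
    using Lbar_sym[OF x] Lbar_carrier unfolding positive_semidefinite_def by blast
qed

lemma positive_definite_LbarI:
  assumes x: "x \<in> carrier_vec U" and pd: "positive_definite l (Lam x)" and t: "t > 0"
  shows "positive_definite (l + 1) (Lbar (snoc_vec x t))"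
proof -
  have "v \<bullet> (Lbar (snoc_vec x t) *\<^sub>v v) > 0" if v: "v \<in> carrier_vec (l + 1)" "v \<noteq> 0\<^sub>v (l + 1)" for v
  proof -
    obtain w r where wr: "w \<in> carrier_vec l" "v = snoc_vec w r" using snoc_vec_cases[OF v(1)] .
    have nn: "w \<bullet> (Lam x *\<^sub>v w) \<ge> 0"
      using positive_definite_imp_semidefinite[OF pd] wr by (simp add: positive_semidefinite_def)
    have "w \<noteq> 0\<^sub>v l \<or> r \<noteq> 0" using v(2) snoc_vec_eq_0_iff[OF wr(1)] unfolding wr(2) by blast
    then have "w \<bullet> (Lam x *\<^sub>v w) + t * r\<^sup>2 > 0"
    proof
      assume "w \<noteq> 0\<^sub>v l"
      then have "w \<bullet> (Lam x *\<^sub>v w) > 0" using pd wr by (simp add: positive_definite_def)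
      then show ?thesis using t by (simp add: add_pos_nonneg)
    next
      assume "r \<noteq> 0"
      then show ?thesis using t nn by (simp add: add_nonneg_pos)
    qed
    then show ?thesis unfolding wr(2) Lbar_quadratic[OF x wr(1)] .
  qed
  then show ?thesis
    using Lbar_sym[OF x] Lbar_carrier unfolding positive_definite_def by blast
qed

lemma positive_definite_LbarD:
  assumes x: "x \<in> carrier_vec U" and pd: "positive_definite (l + 1) (Lbar (snoc_vec x t))"
  shows "positive_definite l (Lam x)" "t > 0"
proof -
  have pos: "v \<bullet> (Lam x *\<^sub>v v) + t * r\<^sup>2 > 0" if v: "v \<in> carrier_vec l" "v \<noteq> 0\<^sub>v l \<or> r \<noteq> 0" for v r
  proof -
    have "snoc_vec v r \<noteq> 0\<^sub>v (l + 1)" using snoc_vec_eq_0_iff[OF v(1)] v(2) by blast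
    then have "snoc_vec v r \<bullet> (Lbar (snoc_vec x t) *\<^sub>v snoc_vec v r) > 0"
      using pd v(1) snoc_vec_carrier[of v r l] unfolding positive_definite_def by blast
    then show ?thesis unfolding Lbar_quadratic[OF x v(1)] .
  qed
  show "positive_definite l (Lam x)"
    using pos[where r = 0] Lam_sym[OF x] by (simp add: positive_definite_def)
  show "t > 0" using pos[of "0\<^sub>v l" 1] Lam_quadratic_0 by simp
qed

sublocale barrier: logdet_barrier "U + 1" "l + 1" E "barrier_ext P"
proof
  fix u i j assume "u < U + 1" "i < l + 1" "j < l + 1"
  then show "E u $$ (j, i) = E u $$ (i, j)"
    by (auto simp: E_def Emat_def l_def[symmetric] mult.commute)
next
  fix xb :: rvec assume xb: "xb \<in> carrier_vec (U + 1)" and zero: "Lbar xb = 0\<^sub>m (l + 1) (l + 1)"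
  obtain x t where xt: "x \<in> carrier_vec U" "xb = snoc_vec x t" using snoc_vec_cases[OF xb] .
  have e: "four_block_mat (Lam x) (0\<^sub>m l 1) (0\<^sub>m 1 l) (D t) = 0\<^sub>m (l + 1) (l + 1)"
    using zero unfolding xt(2) Lbar_snoc[OF xt(1)] .
  have dim: "dim_row (Lam x) = l" "dim_col (Lam x) = l"
    using carrier_matD[OF Lam_carrier[of x]] by simp_all
  have "Lam x $$ (i, j) = 0" if "i < l" "j < l" for i j
    using arg_cong[OF e, of "\<lambda>B. B $$ (i, j)"] that dim by (simp add: D_def)
  then have "Lam x = 0\<^sub>m l l" using dim by (intro eq_matI) auto
  then have "x = 0\<^sub>v U" by (rule Lam_inj[OF xt(1)])
  moreover have "t = 0"
    using arg_cong[OF e, of "\<lambda>B. B $$ (l, l)"] dim by (simp add: D_def)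
  ultimately show "xb = 0\<^sub>v (U + 1)" unfolding xt(2) using snoc_vec_eq_0_iff[OF xt(1)] by blast
next
  fix xb :: rvec assume xb: "xb \<in> carrier_vec (U + 1)" and pd: "positive_definite (l + 1) (Lbar xb)"
  obtain x t where xt: "x \<in> carrier_vec U" "xb = snoc_vec x t" using snoc_vec_cases[OF xb] .
  note pd' = positive_definite_LbarD[OF xt(1) pd[unfolded xt(2)]]
  have "vec_first xb U = x"
    unfolding xt(2) using xt(1) by (intro eq_vecI) (auto simp: vec_first_def snoc_vec_index)
  then have "barrier_ext P xb = - ln (Determinant.det (Lam x)) - ln t"
    by (simp add: barrier_ext_def) (use xt(1) in \<open>simp add: xt(2) snoc_vec_index\<close>)
  also have "\<dots> = - ln (Determinant.det (Lam x) * t)"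
    using positive_definite_det_pos[OF pd'(1)] pd'(2) by (simp add: ln_mult)
  also have "Determinant.det (Lam x) * t = Determinant.det (Lbar xb)"
    unfolding xt(2) Lbar_snoc[OF xt(1)]
    by (subst det_four_block_mat_lower_left_zero[OF Lam_carrier zero_carrier_mat refl D])
      (simp only: det_single[OF D], simp add: D_def)
  finally show "barrier_ext P xb = - ln (Determinant.det (Lbar xb))" .
qed

lemma extended_coneK:
  "extended_cone (coneK P) = {x \<in> carrier_vec (U + 1). positive_semidefinite (l + 1) (Lbar x)}"
proof (intro equalityI subsetI)
  fix v assume "v \<in> extended_cone (coneK P)"
  then obtain x t where "v = snoc_vec x t" "x \<in> carrier_vec U" "positive_semidefinite l (Lam x)" "t \<ge> 0"
    by (auto simp: extended_cone_eq)
  then show "v \<in> {x \<in> carrier_vec (U + 1). positive_semidefinite (l + 1) (Lbar x)}"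
    using positive_semidefinite_Lbar_iff snoc_vec_carrier by blast
next
  fix v assume "v \<in> {x \<in> carrier_vec (U + 1). positive_semidefinite (l + 1) (Lbar x)}"
  then have v: "v \<in> carrier_vec (U + 1)" "positive_semidefinite (l + 1) (Lbar v)" by auto
  obtain x t where xt: "x \<in> carrier_vec U" "v = snoc_vec x t" using snoc_vec_cases[OF v(1)] .
  with v(2) positive_semidefinite_Lbar_iff[OF xt(1)]
  have "x \<in> coneK P" "t \<ge> 0" by auto
  then show "v \<in> extended_cone (coneK P)" unfolding extended_cone_eq xt(2) by blast
qed

text \<open>The dual of a product of cones. Testing against (x, 0) recovers the condition on
  \<open>s\<close>, and against (0, 1) the sign of the last entry, which uses that the cone contains
  0.\<close>

lemma extended_dual_cone:
  "extended_cone (dual_cone U (coneK P)) = dual_cone (U + 1) (extended_cone (coneK P))"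
proof (intro equalityI subsetI)
  fix v assume "v \<in> extended_cone (dual_cone U (coneK P))"
  then obtain s r where v: "v = snoc_vec s r" "s \<in> dual_cone U (coneK P)" "r \<ge> 0"
    unfolding extended_cone_eq by blast
  then have s: "s \<in> carrier_vec U" by (simp add: dual_cone_def)
  have "w \<bullet> v \<ge> 0" if mem: "w \<in> extended_cone (coneK P)" for w
  proof -
    obtain x t where w: "w = snoc_vec x t" "x \<in> coneK P" "t \<ge> 0"
      using mem unfolding extended_cone_eq by blast
    then have x: "x \<in> carrier_vec U" by simp
    have "x \<bullet> s \<ge> 0" using v(2) w(2) unfolding dual_cone_def by blast
    then show ?thesis
      unfolding v(1) w(1) snoc_vec_scalar_prod[OF x s] using v(3) w(3) by simp
  qed
  then show "v \<in> dual_cone (U + 1) (extended_cone (coneK P))"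
    unfolding dual_cone_def using s snoc_vec_carrier v(1) by blast
next
  fix v assume v: "v \<in> dual_cone (U + 1) (extended_cone (coneK P))"
  then have "v \<in> carrier_vec (U + 1)" by (simp add: dual_cone_def)
  then obtain s r where sr: "s \<in> carrier_vec U" "v = snoc_vec s r" using snoc_vec_cases by blast
  have pos: "x \<bullet> s + t * r \<ge> 0" if x: "x \<in> coneK P" "t \<ge> 0" for x t
  proof -
    have "snoc_vec x t \<in> extended_cone (coneK P)" unfolding extended_cone_eq using x by blast
    then have "snoc_vec x t \<bullet> v \<ge> 0" using v unfolding dual_cone_def by blast
    moreover have "x \<in> carrier_vec U" using x by simp
    ultimately show ?thesis unfolding sr(2) using snoc_vec_scalar_prod[OF _ sr(1)] by simp
  qed
  have "s \<in> dual_cone U (coneK P)" unfolding dual_cone_def using sr(1) pos[of _ 0] by simp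
  moreover have "r \<ge> 0"
  proof -
    have "Lam (0\<^sub>v U) = 0\<^sub>m l l"
      by (intro eq_matI) (simp_all add: carrier_matD[OF Lam_carrier] Lam_index)
    moreover have "0\<^sub>m l l *\<^sub>v v = 0\<^sub>v l" if "v \<in> carrier_vec l" for v :: rvec
      using that by (intro eq_vecI) simp_all
    ultimately have "0\<^sub>v U \<in> coneK P" by (auto simp: positive_semidefinite_def)
    from pos[OF this, of 1] show ?thesis using sr(1) by simp
  qed
  ultimately show "v \<in> extended_cone (dual_cone U (coneK P))"
    unfolding extended_cone_eq sr(2) by blast
qed

text \<open>At an interior point, \<open>v \<bullet> (Lam x *\<^sub>v v)\<close> stays nonnegative when \<open>x\<close> is moved a little in the
  direction opposite to the coordinates of the square of \<open>\<Sum>i. v $ i * p i\<close>.\<close>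

lemma interior_imp_dom:
  assumes z: "(xb, y, sb) \<in> feasible_interior P"
  shows "xb \<in> barrier.dom"
proof -
  have zc: "xb \<in> carrier_vec (U + 1)" "y \<in> carrier_vec k" "sb \<in> carrier_vec (U + 1)"
    using z by (auto simp: feasible_interior_def iterate_space_def)
  obtain x t where xt: "x \<in> carrier_vec U" "xb = snoc_vec x t" using snoc_vec_cases[OF zc(1)] .
  obtain e where e: "e > 0" "\<And>x' y' s'. (x', y', s') \<in> iterate_space P \<Longrightarrow> vnorm (x' - xb) < e \<Longrightarrow>
      vnorm (y' - y) < e \<Longrightarrow> vnorm (s' - sb) < e \<Longrightarrow> (x', y', s') \<in> feasible_set P"
    using z unfolding feasible_interior_def by blast
  \<comment> \<open>Only the first component is perturbed: in any direction \<open>w\<close> a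
    positive multiple stays within the ball around the interior point.\<close>
  have move: "\<exists>r>0. positive_semidefinite (l + 1) (Lbar (xb - r \<cdot>\<^sub>v w))" if w: "w \<in> carrier_vec (U + 1)" for w
  proof -
    define r where "r = e / (vnorm w + 1)"
    have w1: "vnorm w + 1 > 0" using vnorm_nonneg[of w] by linarith
    have r: "r > 0" using e(1) w1 by (simp add: r_def)
    have "r * (vnorm w + 1) = e" using w1 by (simp add: r_def)
    then have rw: "r * vnorm w < e" using r by (simp add: distrib_left)
    have x': "(xb - r \<cdot>\<^sub>v w) - xb = (- r) \<cdot>\<^sub>v w" using zc w by (intro eq_vecI) auto
    have d: "y - y = 0\<^sub>v k" "sb - sb = 0\<^sub>v (U + 1)" using zc by auto
    have "vnorm ((xb - r \<cdot>\<^sub>v w) - xb) < e" unfolding x' vnorm_smult using r rw by simp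
    then have "(xb - r \<cdot>\<^sub>v w, y, sb) \<in> feasible_set P"
      using zc e(1) w by (intro e(2)) (simp_all add: iterate_space_def d)
    then have "xb - r \<cdot>\<^sub>v w \<in> extended_cone (coneK P)" by (simp add: feasible_set_def)
    then show ?thesis unfolding extended_coneK using r by blast
  qed
  have "positive_definite l (Lam x)"
    unfolding positive_definite_def
  proof (intro conjI ballI impI)
    fix v :: rvec assume v: "v \<in> carrier_vec l" "v \<noteq> 0\<^sub>v l"
    define f where "f = comb_p v"
    define s where "s = coord (f\<^sup>2)"
    have f: "f \<in> poly_space n d" unfolding f_def by (rule comb_p_in)
    have f2: "f\<^sup>2 \<in> poly_space n (2 * d)"
      using poly_space_mult[OF f f] by (simp add: power2_eq_square double)
    have s: "s \<in> carrier_vec U" by (simp add: s_def)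
    have "f \<noteq> 0" using comb_p_eq_0[OF v(1)] v(2) by (auto simp: f_def)
    \<comment> \<open>The polynomial ring has no zero divisors, so the square of \<open>f\<close> is
      nonzero, and with it its coordinate vector \<open>s\<close>.\<close>
    then have "comb_q s \<noteq> 0" using comb_q_coord[OF f2] by (simp add: s_def)
    moreover have "comb_q (0\<^sub>v U) = 0" by (simp add: comb_q_def mpoly.scale_zero_left)
    ultimately have "s \<noteq> 0\<^sub>v U" by auto
    then have ss: "s \<bullet> s > 0" using scalar_prod_self_pos[OF s] by simp
    have quad: "v \<bullet> (Lam x' *\<^sub>v v) = s \<bullet> x'" if "x' \<in> carrier_vec U" for x'
      using Lam_bilinear[OF v(1) v(1) that] by (simp add: s_def f_def power2_eq_square)
    obtain r where r: "r > 0" "positive_semidefinite (l + 1) (Lbar (xb - r \<cdot>\<^sub>v snoc_vec s 0))"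
      using move[of "snoc_vec s 0"] s snoc_vec_carrier by blast
    have "xb - r \<cdot>\<^sub>v snoc_vec s 0 = snoc_vec (x - r \<cdot>\<^sub>v s) t"
      unfolding xt(2) snoc_vec_diff_smult[OF xt(1) s] by simp
    then have "positive_semidefinite l (Lam (x - r \<cdot>\<^sub>v s))"
      using r(2) positive_semidefinite_Lbar_iff[of "x - r \<cdot>\<^sub>v s" t] xt(1) s by simp
    then have "s \<bullet> (x - r \<cdot>\<^sub>v s) \<ge> 0"
      using quad[of "x - r \<cdot>\<^sub>v s"] v(1) xt(1) s by (auto simp: positive_semidefinite_def)
    then have "s \<bullet> x \<ge> r * (s \<bullet> s)" using xt(1) s by (simp add: scalar_prod_minus_distrib[of _ U])
    moreover have "r * (s \<bullet> s) > 0" using r(1) ss by simp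
    ultimately show "v \<bullet> (Lam x *\<^sub>v v) > 0" using quad[OF xt(1)] by linarith
  qed (simp_all add: Lam_sym[OF xt(1)])
  moreover have "t > 0"
  proof -
    obtain r where r: "r > 0" "positive_semidefinite (l + 1) (Lbar (xb - r \<cdot>\<^sub>v snoc_vec (0\<^sub>v U) 1))"
      using move[of "snoc_vec (0\<^sub>v U) 1"] snoc_vec_carrier zero_carrier_vec by blast
    moreover have "x - r \<cdot>\<^sub>v 0\<^sub>v U = x" using xt(1) by (intro eq_vecI) auto
    ultimately have "positive_semidefinite (l + 1) (Lbar (snoc_vec x (t - r)))"
      unfolding xt(2) snoc_vec_diff_smult[OF xt(1) zero_carrier_vec] by simp
    then show ?thesis using r positive_semidefinite_Lbar_iff[OF xt(1), of "t - r"] by simp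
  qed
  ultimately show ?thesis
    using positive_definite_LbarI[OF xt(1)] zc(1) unfolding barrier.dom_def xt(2) by blast
qed

sublocale conic_barrier "U + 1" "l + 1" E P
proof
  show "feasible_set P = {x \<in> carrier_vec (U + 1). positive_semidefinite (l + 1) (Lbar x)} \<times>
      carrier_vec (dim_y P) \<times>
      dual_cone (U + 1) {x \<in> carrier_vec (U + 1). positive_semidefinite (l + 1) (Lbar x)}"
    using extended_dual_cone unfolding feasible_set_def P_simps(1) extended_coneK by simp
qed (use A b c interior_imp_dom in \<open>simp_all add: U_def\<close>)

end

theorem corollary3p2:
  shows "\<exists>C>0. \<exists>\<epsilon>0>0. \<forall>(n::nat) (d::nat) (p :: nat \<Rightarrow> mpoly) (q :: nat \<Rightarrow> mpoly)
      (k::nat) (A::rmat) (b::rvec) (c::rvec) (P::conic_problem) (\<epsilon>::real).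
    ordered_basis (poly_space n d) (dim_L n d) p \<longrightarrow>
    ordered_basis (poly_space n (2 * d)) (dim_U n d) q \<longrightarrow>
    A \<in> carrier_mat k (dim_U n d) \<longrightarrow> b \<in> carrier_vec k \<longrightarrow> c \<in> carrier_vec (dim_U n d) \<longrightarrow>
    P = sos_problem n d p q k A b c \<longrightarrow> \<epsilon> > 0 \<longrightarrow>
    (\<exists>(\<eta>::real) (\<alpha>p::real) (\<alpha>c::real) (rc::nat).
       0 < \<eta> \<and> \<eta> < 1 \<and> \<alpha>p > 0 \<and> \<alpha>c > 0 \<and> rc > 0 \<and>
       (\<forall>z0 \<in> neighborhood P \<eta>. \<exists>m.
          terminates_within P \<alpha>p \<alpha>c rc (stopping P \<epsilon> z0)
            (\<lambda>z. z \<in> feasible_set P \<and>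
                 mu P z \<le> \<epsilon> * mu P z0 \<and>
                 vnorm (residual P z) \<le> \<epsilon> * vnorm (residual P z0)) m z0 \<and>
          (\<epsilon> \<le> \<epsilon>0 \<longrightarrow> real m \<le> C * sqrt (real (dim_L n d)) * ln (1 / \<epsilon>))))"
proof (rule exI[of _ 26], rule conjI, simp, rule exI[of _ "1 / 3"], rule conjI, simp, intro allI impI)
  fix n d :: nat and p q :: "nat \<Rightarrow> mpoly" and k :: nat and A :: rmat and b c :: rvec
    and P :: conic_problem and \<epsilon> :: real
  assume h: "ordered_basis (poly_space n d) (dim_L n d) p"
    "ordered_basis (poly_space n (2 * d)) (dim_U n d) q"
    "A \<in> carrier_mat k (dim_U n d)" "b \<in> carrier_vec k" "c \<in> carrier_vec (dim_U n d)"
    "P = sos_problem n d p q k A b c" and \<epsilon>: "\<epsilon> > 0"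
  interpret sos_conic n d p q k A b c P by unfold_locales (use h in auto)
  let ?\<alpha> = "1 / (10 * sqrt (real (l + 1)))"
  let ?Q = "\<lambda>z0 z. z \<in> feasible_set P \<and> mu P z \<le> \<epsilon> * mu P z0 \<and>
      vnorm (residual P z) \<le> \<epsilon> * vnorm (residual P z0)"
  have main: "\<exists>r. terminates_within P ?\<alpha> 1 1 (stopping P \<epsilon> z0) (?Q z0) r z0 \<and>
      (\<epsilon> \<le> 1 / 3 \<longrightarrow> real r \<le> 26 * sqrt (real (dim_L n d)) * ln (1 / \<epsilon>))"
    if z0: "z0 \<in> neighborhood P (1 / 10)" for z0
  proof -
    obtain r where r: "terminates_within P ?\<alpha> 1 1 (stopping P \<epsilon> z0) (?Q z0) r z0"
      "\<epsilon> \<le> 1 / 3 \<longrightarrow> real r \<le> 13 * sqrt (real (l + 1)) * ln (1 / \<epsilon>)"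
      using complexity[OF \<epsilon> z0] by blast
    have "real r \<le> 26 * sqrt (real (dim_L n d)) * ln (1 / \<epsilon>)" if small: "\<epsilon> \<le> 1 / 3"
    proof -
      \<comment> \<open>\<open>l + 1 \<le> 4 * l\<close> because \<open>l \<ge> 1\<close>; 4 is a
        perfect square, and its root turns the constant 13 into 26.\<close>
      have "sqrt (real (l + 1)) \<le> sqrt (4 * real l)" using l_pos by (intro real_sqrt_le_mono) simp
      also have "\<dots> = 2 * sqrt (real l)" by (simp add: real_sqrt_mult)
      finally have "13 * sqrt (real (l + 1)) * ln (1 / \<epsilon>) \<le> 13 * (2 * sqrt (real l)) * ln (1 / \<epsilon>)"
        using \<epsilon> small by (intro mult_right_mono mult_left_mono) auto
      then have "real r \<le> 26 * sqrt (real l) * ln (1 / \<epsilon>)" using r(2) small by linarith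
      then show ?thesis by (simp add: l_def)
    qed
    with r(1) show ?thesis by blast
  qed
  \<comment> \<open>Of the four parameters only the predictor step length depends on the problem,
    through \<open>l\<close>; none depends on \<open>\<epsilon>\<close>.\<close>
  show "\<exists>(\<eta>::real) (\<alpha>p::real) (\<alpha>c::real) (rc::nat).
       0 < \<eta> \<and> \<eta> < 1 \<and> \<alpha>p > 0 \<and> \<alpha>c > 0 \<and> rc > 0 \<and>
       (\<forall>z0 \<in> neighborhood P \<eta>. \<exists>m.
          terminates_within P \<alpha>p \<alpha>c rc (stopping P \<epsilon> z0) (?Q z0) m z0 \<and>
          (\<epsilon> \<le> 1 / 3 \<longrightarrow> real m \<le> 26 * sqrt (real (dim_L n d)) * ln (1 / \<epsilon>)))"
  proof (rule exI[of _ "1 / 10"], rule exI[of _ ?\<alpha>], rule exI[of _ 1], rule exI[of _ 1], intro conjI)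
    show "\<forall>z0 \<in> neighborhood P (1 / 10). \<exists>m.
        terminates_within P ?\<alpha> 1 1 (stopping P \<epsilon> z0) (?Q z0) m z0 \<and>
        (\<epsilon> \<le> 1 / 3 \<longrightarrow> real m \<le> 26 * sqrt (real (dim_L n d)) * ln (1 / \<epsilon>))"
      using main by blast
  qed simp_all
qed

end
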